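(* Let $J$ be the isometric isomorphism of $\mathfrak C_{\mathrm{ov}}(\mathbb R_\sharp)$ and $\mathfrak C[-\infty,\infty]$ given by $Jf(x)=-f(x)$ for $x<0$, $Jf(x)=f(x)$ for $x>0$, and $Jf(0)=f(0+)$. Then: (a) The cosine families $\{\mathrm{Cos}^\perp_{\alpha,\beta}(t),\,t\in\mathbb R\}$ generated by $A^\perp_{\alpha,\beta}$ are equibounded: $$\|\mathrm{Cos}^\perp_{\alpha,\beta}(t)\|\le5\qquad\text{for all }\alpha,\beta\ge0\text{ with }\alpha+\beta>0\text{ and all }t\in\mathbb R.$$ Moreover, for any fixed $\alpha,\beta\ge0$ with $\alpha+\beta>0$: (b) $$\lim_{n\to\infty}\sup_{t\in\mathbb R}\|\mathrm{Cos}^\perp_{n\alpha,n\beta}(t)f-J^{-1}\mathrm{Cos}^{\mathrm{skew}}_{\beta,\alpha}(t)Jf\|=0,\qquad f\in\mathfrak C_{\mathrm{ov}}(\mathbb R_\sharp).$$ (c) $$\lim_{n\to\infty}\sup_{t\ge0}\|e^{tA^\perp_{n\alpha,n\beta}}f-J^{-1}e^{tA^{\mathrm{skew}}_{\beta,\alpha}}Jf\|=0,\qquad f\in\mathfrak C_{\mathrm{ov}}(\mathbb R_\sharp).$$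
   Context: $\mathfrak C[-\infty,\infty]$ is the space of real continuous functions on $\mathbb R$ with finite limits at $\pm\infty$ (supremum norm). $\mathfrak C(\mathbb R_\sharp)$ is the Banach space (supremum norm) of real continuous functions on $(-\infty,0)\cup(0,\infty)$ with finite limits at $\pm\infty$ and finite one-sided limits $f(0-),f(0+)$ at $0$; $\mathfrak C_{\mathrm{ov}}(\mathbb R_\sharp)$ is its subspace of functions with $f(0+)=-f(0-)$. $A^\perp_{\alpha,\beta}f=f''$ in $\mathfrak C_{\mathrm{ov}}(\mathbb R_\sharp)$, with domain consisting of $f\in\mathfrak C_{\mathrm{ov}}(\mathbb R_\sharp)$ such that: $f$ is twice continuously differentiable in both $(-\infty,0]$ and $[0,\infty)$, separately, with one-sided derivatives at $0$ (the two parts of $f$ being given at $0$ the values $f(0-)$ and $f(0+)$); the limits $\lim_{x\to\pm\infty}f''(x)$ exist and are finite; $f''(0+)=\alpha f'(0-)+\beta f'(0+)$ and $f''(0+)=-f''(0-)$. It generates a strongly continuous cosine family $\{\mathrm{Cos}^\perp_{\alpha,\beta}(t)\}_{t\in\mathbb R}$, and thus a semigroup $\{e^{tA^\perp_{\alpha,\beta}}\}_{t\ge0}$, in $\mathfrak C_{\mathrm{ov}}(\mathbb R_\sharp)$. Explicitly, with $C(t)g(x)=\frac12[g(x+t)+g(x-t)]$, $\mathrm{Cos}^\perp_{\alpha,\beta}(t)f(x)=C(t)\widetilde{f_\ell}(x)$ for $x<0$ and $=C(t)\widetilde{f_{\mathrm r}}(x)$ for $x>0$, where, for $x>0$, $\widetilde{f_\ell}(-x)=f(-x)$,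 $\widetilde{f_{\mathrm r}}(x)=f(x)$, $$\widetilde{f_\ell}(x)=-f(-x)-2f(0+)e^{-(\alpha+\beta)x}-2\int_0^xe^{-(\alpha+\beta)(x-y)}[\beta f(y)-\alpha f(-y)]\,dy,$$ $$\widetilde{f_{\mathrm r}}(-x)=-f(x)+2f(0+)e^{-(\alpha+\beta)x}+2\int_0^xe^{-(\alpha+\beta)(x-y)}[\beta f(y)-\alpha f(-y)]\,dy,$$ and $\widetilde{f_\ell}(0)=f(0-)$, $\widetilde{f_{\mathrm r}}(0)=f(0+)$. For $a,b\ge0$, $a+b>0$, $A^{\mathrm{skew}}_{a,b}f=f''$ in $\mathfrak C[-\infty,\infty]$, with domain consisting of $f\in\mathfrak C[-\infty,\infty]$ such that: $f$ is twice continuously differentiable in both $(-\infty,0]$ and $[0,\infty)$, separately, with one-sided derivatives at $0$; the limits $\lim_{x\to\pm\infty}f''(x)$ exist and are finite; $a f'(0+)=b f'(0-)$ and $f''(0+)=f''(0-)$. It generates a strongly continuous cosine family $\{\mathrm{Cos}^{\mathrm{skew}}_{a,b}(t)\}_{t\in\mathbb R}$ and a semigroup $\{e^{tA^{\mathrm{skew}}_{a,b}}\}_{t\ge0}$ in $\mathfrak C[-\infty,\infty]$. (In the theorem, $a=\beta$ and $b=\alpha$.) A strongly continuous cosine family is a strongly continuous family of bounded operators with $\mathrm{Cos}(0)=I$ and $2\,\mathrm{Cos}(t)\mathrm{Cos}(s)=\mathrm{Cos}(t+s)+\mathrm{Cos}(t-s)$; its generator is $Gf=\lim_{t\to0}2t^{-2}(\mathrm{Cos}(t)f-f)$,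 with domain the set of $f$ for which the limit exists. *)

theory Defs
  imports "HOL-Analysis.Analysis"
begin

section \<open>The supremum norm\<close>

definition supnorm :: "real set \<Rightarrow> (real \<Rightarrow> real) \<Rightarrow> real" where
  "supnorm S f = (SUP x\<in>S. \<bar>f x\<bar>)"

definition bounded_fun :: "real set \<Rightarrow> (real \<Rightarrow> real) \<Rightarrow> bool" where
  "bounded_fun S f \<longleftrightarrow> (\<exists>M. \<forall>x\<in>S. \<bar>f x\<bar> \<le> M)"

lemma abs_le_supnorm:
  assumes "bounded_fun S f" "x \<in> S"
  shows "\<bar>f x\<bar> \<le> supnorm S f"
  using assms unfolding bounded_fun_def supnorm_def
  by (auto intro!: cSUP_upper bdd_aboveI2)

lemma supnorm_le:
  assumes "S \<noteq> {}" "\<And>x. x \<in> S \<Longrightarrow> \<bar>f x\<bar> \<le> M"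
  shows "supnorm S f \<le> M"
  using assms unfolding supnorm_def by (auto intro!: cSUP_least)

lemma supnorm_eq_0_iff:
  assumes "bounded_fun S f" "S \<noteq> {}"
  shows "supnorm S f = 0 \<longleftrightarrow> (\<forall>x\<in>S. f x = 0)"
proof
  assume "supnorm S f = 0"
  then show "\<forall>x\<in>S. f x = 0"
    using abs_le_supnorm[OF assms(1)] by fastforce
next
  assume *: "\<forall>x\<in>S. f x = 0"
  obtain x where "x \<in> S" using assms(2) by blast
  then have "0 \<le> supnorm S f"
    using abs_le_supnorm[OF assms(1), of x] by (smt (verit) abs_ge_zero)
  moreover have "supnorm S f \<le> 0" using supnorm_le[OF assms(2)] * by simp
  ultimately show "supnorm S f = 0" by simp
qed

lemma supnorm_triangle:
  assumes "bounded_fun S f" "bounded_fun S g" "S \<noteq> {}"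
  shows "supnorm S (\<lambda>x. f x + g x) \<le> supnorm S f + supnorm S g"
  using abs_le_supnorm[OF assms(1)] abs_le_supnorm[OF assms(2)]
  by (intro supnorm_le assms(3)) (smt (verit))

lemma supnorm_scale:
  assumes "bounded_fun S f" "S \<noteq> {}"
  shows "supnorm S (\<lambda>x. c * f x) = \<bar>c\<bar> * supnorm S f"
proof (rule antisym)
  show "supnorm S (\<lambda>x. c * f x) \<le> \<bar>c\<bar> * supnorm S f"
    using abs_le_supnorm[OF assms(1)]
    by (intro supnorm_le assms(2)) (simp add: abs_mult mult_left_mono)
  show "\<bar>c\<bar> * supnorm S f \<le> supnorm S (\<lambda>x. c * f x)"
  proof (cases "c = 0")
    case True
    then show ?thesis using assms(2) by (simp add: supnorm_def)
  next
    case False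
    obtain M where M: "\<And>x. x \<in> S \<Longrightarrow> \<bar>f x\<bar> \<le> M"
      using assms(1) unfolding bounded_fun_def by blast
    have bd: "bounded_fun S (\<lambda>x. c * f x)"
      unfolding bounded_fun_def
      by (rule exI[of _ "\<bar>c\<bar> * M"]) (auto simp: abs_mult M mult_left_mono)
    have "supnorm S f \<le> supnorm S (\<lambda>x. c * f x) / \<bar>c\<bar>"
    proof (rule supnorm_le[OF assms(2)])
      fix x assume "x \<in> S"
      then show "\<bar>f x\<bar> \<le> supnorm S (\<lambda>x. c * f x) / \<bar>c\<bar>"
        using abs_le_supnorm[OF bd, of x] False
        by (simp add: abs_mult field_simps)
    qed
    then show ?thesis using False by (simp add: field_simps)
  qed
qed

text \<open>Uniform limits preserve the existence of finite limits along a filter.\<close>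

lemma uniform_limit_has_limit:
  fixes f :: "nat \<Rightarrow> real \<Rightarrow> real"
  assumes unif: "uniform_limit S f g sequentially"
    and lim: "\<And>n. \<exists>l. (f n \<longlongrightarrow> l) F"
    and ev: "eventually (\<lambda>x. x \<in> S) F" and F: "F \<noteq> bot"
  obtains L l where "\<And>n. (f n \<longlongrightarrow> L n) F" "L \<longlonglongrightarrow> l" "(g \<longlongrightarrow> l) F"
proof -
  obtain L where L: "\<And>n. (f n \<longlongrightarrow> L n) F" using lim by metis
  have "Cauchy L"
  proof (rule metric_CauchyI)
    fix e :: real assume "e > 0"
    then have "\<forall>\<^sub>F n in sequentially. \<forall>x\<in>S. dist (f n x) (g x) < e / 4"
      using uniform_limitD[OF unif, of "e / 4"] by simp
    then obtain N where N: "\<And>n x. n \<ge> N \<Longrightarrow> x \<in> S \<Longrightarrow> dist (f n x) (g x) < e / 4"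
      unfolding eventually_sequentially by blast
    have "dist (L m) (L n) < e" if "m \<ge> N" "n \<ge> N" for m n
    proof -
      have "((\<lambda>x. dist (f m x) (f n x)) \<longlongrightarrow> dist (L m) (L n)) F"
        by (intro tendsto_intros L)
      moreover have "eventually (\<lambda>x. dist (f m x) (f n x) \<le> e / 2) F"
        using ev
      proof eventually_elim
        case (elim x)
        show ?case
          using N[OF that(1) elim] N[OF that(2) elim]
            dist_triangle2[of "f m x" "f n x" "g x"] by linarith
      qed
      ultimately have "dist (L m) (L n) \<le> e / 2" by (rule tendsto_upperbound[OF _ _ F])
      then show ?thesis using \<open>e > 0\<close> by linarith
    qed
    then show "\<exists>M. \<forall>m\<ge>M. \<forall>n\<ge>M. dist (L m) (L n) < e" by blast
  qed
  then obtain l where l: "L \<longlonglongrightarrow> l" using Cauchy_convergent_iff convergentD by blast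
  have "(g \<longlongrightarrow> l) F"
  proof (rule tendstoI)
    fix e :: real assume "e > 0"
    then have "\<forall>\<^sub>F n in sequentially. \<forall>x\<in>S. dist (f n x) (g x) < e / 3"
      using uniform_limitD[OF unif, of "e / 3"] by simp
    moreover have "\<forall>\<^sub>F n in sequentially. dist (L n) l < e / 3"
      using tendstoD[OF l, of "e / 3"] \<open>e > 0\<close> by simp
    ultimately have "\<forall>\<^sub>F n in sequentially.
        (\<forall>x\<in>S. dist (f n x) (g x) < e / 3) \<and> dist (L n) l < e / 3"
      by eventually_elim auto
    then obtain n where n: "\<And>x. x \<in> S \<Longrightarrow> dist (f n x) (g x) < e / 3" "dist (L n) l < e / 3"
      unfolding eventually_sequentially by blast
    have "eventually (\<lambda>x. dist (f n x) (L n) < e / 3) F"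
      using tendstoD[OF L[of n], of "e / 3"] \<open>e > 0\<close> by simp
    then show "eventually (\<lambda>x. dist (g x) l < e) F"
      using ev
    proof eventually_elim
      case (elim x)
      show ?case
        using n(1)[OF elim(2)] n(2) elim(1)
          dist_triangle3[of "g x" "L n" "f n x"] dist_triangle[of "g x" l "L n"] by linarith
    qed
  qed
  with L l that show ?thesis by blast
qed


section \<open>The spaces of continuous functions\<close>

subsection \<open>Continuous functions with finite limits at infinity\<close>

definition C_infty :: "(real \<Rightarrow> real) set" where
  "C_infty = {f. continuous_on UNIV f \<and> (\<exists>l. (f \<longlongrightarrow> l) at_bot) \<and> (\<exists>l. (f \<longlongrightarrow> l) at_top)}"

text \<open>
  A function on \<open>(-\<infinity>,0) \<union> (0,\<infinity>)\<close> is represented by its extension to the real line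
  with value \<open>0\<close> at \<open>0\<close>, so that representatives are unique.
\<close>

definition C_sharp :: "(real \<Rightarrow> real) set" where
  "C_sharp = {f. f 0 = 0 \<and> continuous_on (- {0}) f \<and>
     (\<exists>l. (f \<longlongrightarrow> l) at_bot) \<and> (\<exists>l. (f \<longlongrightarrow> l) at_top) \<and>
     (\<exists>l. (f \<longlongrightarrow> l) (at_left 0)) \<and> (\<exists>l. (f \<longlongrightarrow> l) (at_right 0))}"

definition C_ov :: "(real \<Rightarrow> real) set" where
  "C_ov = {f \<in> C_sharp. Lim (at_right 0) f = - Lim (at_left 0) f}"

lemma tendsto_Lim_ex:
  fixes f :: "real \<Rightarrow> real"
  assumes "\<exists>l. (f \<longlongrightarrow> l) F" "F \<noteq> bot"
  shows "(f \<longlongrightarrow> Lim F f) F"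
  using assms tendsto_Lim by metis

lemma C_ov_iff:
  "f \<in> C_ov \<longleftrightarrow> f 0 = 0 \<and> continuous_on (- {0}) f \<and>
     (\<exists>l. (f \<longlongrightarrow> l) at_bot) \<and> (\<exists>l. (f \<longlongrightarrow> l) at_top) \<and>
     (\<exists>l. (f \<longlongrightarrow> - l) (at_left 0) \<and> (f \<longlongrightarrow> l) (at_right 0))"
  (is "?L \<longleftrightarrow> ?R")
proof
  assume ?L
  then have *: "f \<in> C_sharp" "Lim (at_right 0) f = - Lim (at_left 0) f"
    by (auto simp: C_ov_def)
  have "(f \<longlongrightarrow> Lim (at_left 0) f) (at_left 0)" "(f \<longlongrightarrow> Lim (at_right 0) f) (at_right 0)"
    using *(1) by (auto simp: C_sharp_def intro!: tendsto_Lim_ex)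
  then have "(f \<longlongrightarrow> - Lim (at_right 0) f) (at_left 0) \<and> (f \<longlongrightarrow> Lim (at_right 0) f) (at_right 0)"
    using *(2) by simp
  then show ?R using *(1) unfolding C_sharp_def by blast
next
  assume R: ?R
  then obtain l where l: "(f \<longlongrightarrow> - l) (at_left 0)" "(f \<longlongrightarrow> l) (at_right 0)" by blast
  then have "Lim (at_left 0) f = - l" "Lim (at_right 0) f = l"
    by (auto intro!: tendsto_Lim)
  then show ?L using R l unfolding C_ov_def C_sharp_def by auto
qed

lemma eventually_negative_at_bot: "eventually (\<lambda>x::real. x < 0) at_bot"
  unfolding eventually_at_bot_linorder by (rule exI[of _ "-1"]) auto

lemma bounded_fun_C_sharp:
  assumes "f \<in> C_sharp"
  shows "bounded_fun UNIV f"
proof -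
  have near: "\<exists>M. eventually (\<lambda>x. \<bar>f x\<bar> \<le> M) F" if "\<exists>l. (f \<longlongrightarrow> l) F" for F
  proof -
    from that obtain l where "(f \<longlongrightarrow> l) F" by blast
    then have "eventually (\<lambda>x. dist (f x) l < 1) F" by (simp add: tendstoD)
    then have "eventually (\<lambda>x. \<bar>f x\<bar> \<le> \<bar>l\<bar> + 1) F"
      by eventually_elim (auto simp: dist_real_def)
    then show ?thesis by blast
  qed
  obtain M1 A where A: "\<And>x. x \<le> A \<Longrightarrow> \<bar>f x\<bar> \<le> M1"
    using near[of at_bot] assms unfolding C_sharp_def eventually_at_bot_linorder by blast
  obtain M2 B where B: "\<And>x. x \<ge> B \<Longrightarrow> \<bar>f x\<bar> \<le> M2"
    using near[of at_top] assms unfolding C_sharp_def eventually_at_top_linorder by blast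
  obtain M3 c where c: "c < 0" "\<And>x. c < x \<Longrightarrow> x < 0 \<Longrightarrow> \<bar>f x\<bar> \<le> M3"
    using near[of "at_left 0"] assms eventually_at_left[of "-1" "0::real"]
    unfolding C_sharp_def by (auto simp: eventually_at_left)
  obtain M4 d where d: "d > 0" "\<And>x. 0 < x \<Longrightarrow> x < d \<Longrightarrow> \<bar>f x\<bar> \<le> M4"
    using near[of "at_right 0"] assms eventually_at_right[of "0::real" 1]
    unfolding C_sharp_def by (auto simp: eventually_at_right)
  have "compact (f ` ({A..c} \<union> {d..B}))"
  proof (rule compact_continuous_image)
    have "continuous_on (- {0}) f" using assms by (simp add: C_sharp_def)
    then show "continuous_on ({A..c} \<union> {d..B}) f"
      by (rule continuous_on_subset) (use c(1) d(1) in auto)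
  qed (simp add: compact_Un)
  then have "bounded (f ` ({A..c} \<union> {d..B}))" by (rule compact_imp_bounded)
  then obtain M5 where "\<forall>y \<in> f ` ({A..c} \<union> {d..B}). norm y \<le> M5"
    unfolding bounded_iff by blast
  then have M5: "\<And>x. x \<in> {A..c} \<union> {d..B} \<Longrightarrow> \<bar>f x\<bar> \<le> M5"
    by (metis imageI real_norm_def)
  have f0: "f 0 = 0" using assms by (simp add: C_sharp_def)
  define M where "M = Max {0, M1, M2, M3, M4, M5}"
  have M: "0 \<le> M" "M1 \<le> M" "M2 \<le> M" "M3 \<le> M" "M4 \<le> M" "M5 \<le> M"
    by (auto simp: M_def)
  have "\<bar>f x\<bar> \<le> M" for x
  proof -
    consider "x \<le> A" | "x \<ge> B" | "x = 0" | "c < x" "x < 0" | "0 < x" "x < d"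
      | "x \<in> {A..c} \<union> {d..B}" by fastforce
    then show ?thesis
      using A[of x] B[of x] c(2)[of x] d(2)[of x] M5[of x] f0 M by cases force+
  qed
  then show ?thesis unfolding bounded_fun_def by blast
qed

lemma bounded_fun_C_infty:
  assumes "f \<in> C_infty"
  shows "bounded_fun UNIV f"
proof -
  define g where "g x = (if x = 0 then 0 else f x)" for x
  have f: "isCont f 0" using assms by (auto simp: C_infty_def continuous_on_eq_continuous_at)
  have ev: "eventually (\<lambda>x. f x = g x) at_bot" "eventually (\<lambda>x. f x = g x) at_top"
    "eventually (\<lambda>x. f x = g x) (at_left 0)" "eventually (\<lambda>x. f x = g x) (at_right 0)"
    using eventually_mono[OF eventually_negative_at_bot, of "\<lambda>x. f x = g x"]
      eventually_mono[OF eventually_gt_at_top[of "0::real"], of "\<lambda>x. f x = g x"]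
    by (auto simp: eventually_at_filter g_def)
  have "\<exists>l. (f \<longlongrightarrow> l) (at_left 0)" "\<exists>l. (f \<longlongrightarrow> l) (at_right 0)"
    using f unfolding isCont_def filterlim_at_split by auto
  moreover have "continuous_on (- {0}) g"
  proof (rule continuous_on_eq)
    have "continuous_on UNIV f" using assms by (simp add: C_infty_def)
    then show "continuous_on (- {0}) f" by (rule continuous_on_subset) simp
  qed (simp add: g_def)
  moreover have "g 0 = 0" by (simp add: g_def)
  ultimately have "g \<in> C_sharp"
    using assms tendsto_cong[OF ev(1)] tendsto_cong[OF ev(2)] tendsto_cong[OF ev(3)]
      tendsto_cong[OF ev(4)] unfolding C_sharp_def C_infty_def by simp
  then obtain M where M: "\<And>x. \<bar>g x\<bar> \<le> M"
    using bounded_fun_C_sharp unfolding bounded_fun_def by blast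
  have "\<bar>f x\<bar> \<le> M + \<bar>f 0\<bar>" for x
    using M[of x] M[of 0] by (cases "x = 0") (auto simp: g_def)
  then show ?thesis unfolding bounded_fun_def by blast
qed

typedef cinf = C_infty
  by (rule exI[of _ "\<lambda>x. 0"]) (auto simp: C_infty_def)

typedef cov = C_ov
  by (rule exI[of _ "\<lambda>x. 0"]) (auto simp: C_ov_iff intro!: exI[of _ 0])

setup_lifting type_definition_cinf
setup_lifting type_definition_cov

instantiation cinf :: real_vector
begin
lift_definition zero_cinf :: cinf is "\<lambda>x. 0" by (auto simp: C_infty_def)
lift_definition plus_cinf :: "cinf \<Rightarrow> cinf \<Rightarrow> cinf" is "\<lambda>f g x. f x + g x"
  unfolding C_infty_def by (blast intro: continuous_intros tendsto_add)
lift_definition uminus_cinf :: "cinf \<Rightarrow> cinf" is "\<lambda>f x. - f x"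
  unfolding C_infty_def by (blast intro: continuous_intros tendsto_minus)
lift_definition minus_cinf :: "cinf \<Rightarrow> cinf \<Rightarrow> cinf" is "\<lambda>f g x. f x - g x"
  unfolding C_infty_def by (blast intro: continuous_intros tendsto_diff)
lift_definition scaleR_cinf :: "real \<Rightarrow> cinf \<Rightarrow> cinf" is "\<lambda>c f x. c * f x"
  unfolding C_infty_def by (blast intro: continuous_on_mult_left tendsto_mult_left)
instance
  by standard (simp_all add: Rep_cinf_inject[symmetric] fun_eq_iff plus_cinf.rep_eq
      minus_cinf.rep_eq uminus_cinf.rep_eq scaleR_cinf.rep_eq zero_cinf.rep_eq algebra_simps)
end

instantiation cov :: real_vector
begin
lift_definition zero_cov :: cov is "\<lambda>x. 0" by (auto simp: C_ov_iff intro!: exI[of _ 0])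
lift_definition plus_cov :: "cov \<Rightarrow> cov \<Rightarrow> cov" is "\<lambda>f g x. f x + g x"
proof -
  fix f g assume "f \<in> C_ov" "g \<in> C_ov"
  then obtain a b c a' b' c' where
    "f 0 = 0" "continuous_on (- {0}) f" "(f \<longlongrightarrow> a) at_bot" "(f \<longlongrightarrow> b) at_top"
    "(f \<longlongrightarrow> - c) (at_left 0)" "(f \<longlongrightarrow> c) (at_right 0)"
    "g 0 = 0" "continuous_on (- {0}) g" "(g \<longlongrightarrow> a') at_bot" "(g \<longlongrightarrow> b') at_top"
    "(g \<longlongrightarrow> - c') (at_left 0)" "(g \<longlongrightarrow> c') (at_right 0)"
    unfolding C_ov_iff by metis
  then show "(\<lambda>x. f x + g x) \<in> C_ov"
    unfolding C_ov_iff
    by (intro conjI exI[of _ "c + c'"] exI[of _ "a + a'"] exI[of _ "b + b'"])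
      (auto intro!: continuous_intros tendsto_eq_intros)
qed
lift_definition scaleR_cov :: "real \<Rightarrow> cov \<Rightarrow> cov" is "\<lambda>k f x. k * f x"
proof -
  fix k f assume "f \<in> C_ov"
  then obtain a b c where
    "f 0 = 0" "continuous_on (- {0}) f" "(f \<longlongrightarrow> a) at_bot" "(f \<longlongrightarrow> b) at_top"
    "(f \<longlongrightarrow> - c) (at_left 0)" "(f \<longlongrightarrow> c) (at_right 0)"
    unfolding C_ov_iff by metis
  then show "(\<lambda>x. k * f x) \<in> C_ov"
    unfolding C_ov_iff
    by (intro conjI exI[of _ "k * c"] exI[of _ "k * a"] exI[of _ "k * b"])
      (auto intro!: continuous_intros tendsto_eq_intros)
qed
definition "- (f :: cov) = (-1) *\<^sub>R f"
definition "f - (g :: cov) = f + (-1) *\<^sub>R g"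
instance
  by standard (simp_all add: Rep_cov_inject[symmetric] fun_eq_iff uminus_cov_def minus_cov_def
      plus_cov.rep_eq scaleR_cov.rep_eq zero_cov.rep_eq algebra_simps)
end

lemma Rep_cinf_diff: "Rep_cinf (f - g) x = Rep_cinf f x - Rep_cinf g x"
  by transfer simp

lemma Rep_cov_diff: "Rep_cov (f - g) x = Rep_cov f x - Rep_cov g x"
  unfolding minus_cov_def plus_cov.rep_eq scaleR_cov.rep_eq by simp

lemma bounded_Rep_cinf: "bounded_fun S (Rep_cinf f)"
  using bounded_fun_C_infty[OF Rep_cinf] unfolding bounded_fun_def by blast

lemma bounded_Rep_cov: "bounded_fun S (Rep_cov f)"
  using bounded_fun_C_sharp Rep_cov unfolding bounded_fun_def C_ov_def by blast

lemma Rep_cov_0: "Rep_cov f 0 = 0"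
  using Rep_cov[of f] by (simp add: C_ov_iff)

instantiation cinf :: real_normed_vector
begin
definition "norm (f :: cinf) = supnorm UNIV (Rep_cinf f)"
definition "sgn (f :: cinf) = f /\<^sub>R norm f"
definition "dist (f :: cinf) g = norm (f - g)"
definition "(uniformity :: (cinf \<times> cinf) filter) =
  (INF e\<in>{0<..}. principal {(f, g). dist f g < e})"
definition "open (U :: cinf set) \<longleftrightarrow> (\<forall>x\<in>U. eventually (\<lambda>(x', y). x' = x \<longrightarrow> y \<in> U) uniformity)"
instance
proof
  fix f g :: cinf and c :: real
  show "(norm f = 0) = (f = 0)"
    unfolding norm_cinf_def supnorm_eq_0_iff[OF bounded_Rep_cinf UNIV_not_empty]
    by transfer auto
  have "Rep_cinf (f + g) = (\<lambda>x. Rep_cinf f x + Rep_cinf g x)" by transfer simp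
  then show "norm (f + g) \<le> norm f + norm g"
    unfolding norm_cinf_def
    using supnorm_triangle[OF bounded_Rep_cinf bounded_Rep_cinf UNIV_not_empty] by metis
  have "Rep_cinf (c *\<^sub>R f) = (\<lambda>x. c * Rep_cinf f x)" by transfer simp
  then show "norm (c *\<^sub>R f) = \<bar>c\<bar> * norm f"
    unfolding norm_cinf_def
    using supnorm_scale[OF bounded_Rep_cinf UNIV_not_empty] by metis
qed (simp_all add: sgn_cinf_def dist_cinf_def uniformity_cinf_def open_cinf_def)
end

lemma Compl_0_nonempty: "- {0 :: real} \<noteq> {}"
  using zero_neq_one by blast

instantiation cov :: real_normed_vector
begin
definition "norm (f :: cov) = supnorm (- {0}) (Rep_cov f)"
definition "sgn (f :: cov) = f /\<^sub>R norm f"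
definition "dist (f :: cov) g = norm (f - g)"
definition "(uniformity :: (cov \<times> cov) filter) =
  (INF e\<in>{0<..}. principal {(f, g). dist f g < e})"
definition "open (U :: cov set) \<longleftrightarrow> (\<forall>x\<in>U. eventually (\<lambda>(x', y). x' = x \<longrightarrow> y \<in> U) uniformity)"
instance
proof
  fix f g :: cov and c :: real
  have "(\<forall>x\<in>-{0}. Rep_cov f x = 0) \<longleftrightarrow> (\<forall>x. Rep_cov f x = 0)"
    using Rep_cov_0[of f] by (metis ComplI singletonD)
  also have "\<dots> \<longleftrightarrow> f = 0" by transfer auto
  finally show "(norm f = 0) = (f = 0)"
    unfolding norm_cov_def supnorm_eq_0_iff[OF bounded_Rep_cov Compl_0_nonempty] .
  have "Rep_cov (f + g) = (\<lambda>x. Rep_cov f x + Rep_cov g x)" by transfer simp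
  then show "norm (f + g) \<le> norm f + norm g"
    unfolding norm_cov_def
    using supnorm_triangle[OF bounded_Rep_cov bounded_Rep_cov Compl_0_nonempty] by metis
  have "Rep_cov (c *\<^sub>R f) = (\<lambda>x. c * Rep_cov f x)" by transfer simp
  then show "norm (c *\<^sub>R f) = \<bar>c\<bar> * norm f"
    unfolding norm_cov_def
    using supnorm_scale[OF bounded_Rep_cov Compl_0_nonempty] by metis
qed (simp_all add: sgn_cov_def dist_cov_def uniformity_cov_def open_cov_def)
end

instance cinf :: banach
proof
  fix X :: "nat \<Rightarrow> cinf" assume X: "Cauchy X"
  let ?f = "\<lambda>n. Rep_cinf (X n)"
  have le: "dist (?f m x) (?f n x) \<le> dist (X m) (X n)" for m n x
    unfolding dist_cinf_def norm_cinf_def dist_real_def Rep_cinf_diff[symmetric]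
    by (rule abs_le_supnorm[OF bounded_Rep_cinf]) simp
  have "uniformly_Cauchy_on UNIV ?f"
    unfolding uniformly_Cauchy_on_def using X le unfolding Cauchy_def by (meson le_less_trans)
  then obtain g where g: "uniform_limit UNIV ?f g sequentially"
    using Cauchy_uniformly_convergent unfolding uniformly_convergent_on_def by blast
  have R: "?f n \<in> C_infty" for n by (rule Rep_cinf)
  have "continuous_on UNIV g"
    using R by (intro uniform_limit_theorem[OF _ g]) (auto simp: C_infty_def)
  moreover have "\<exists>l. (g \<longlongrightarrow> l) at_bot"
    using R by (rule_tac uniform_limit_has_limit[OF g, of at_bot]) (auto simp: C_infty_def)
  moreover have "\<exists>l. (g \<longlongrightarrow> l) at_top"
    using R by (rule_tac uniform_limit_has_limit[OF g, of at_top]) (auto simp: C_infty_def)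
  ultimately have "g \<in> C_infty" by (simp add: C_infty_def)
  then have Rg: "Rep_cinf (Abs_cinf g) = g" by (rule Abs_cinf_inverse)
  have "X \<longlonglongrightarrow> Abs_cinf g"
  proof (rule metric_LIMSEQ_I)
    fix e :: real assume "e > 0"
    then obtain N where N: "\<And>n x. n \<ge> N \<Longrightarrow> dist (?f n x) (g x) < e / 2"
      using uniform_limitD[OF g, of "e / 2"] unfolding eventually_sequentially by auto
    have "dist (X n) (Abs_cinf g) < e" if "n \<ge> N" for n
    proof -
      have "dist (X n) (Abs_cinf g) \<le> e / 2"
        unfolding dist_cinf_def norm_cinf_def
        using N[OF that] by (intro supnorm_le) (auto simp: Rep_cinf_diff Rg dist_real_def less_imp_le)
      then show ?thesis using \<open>e > 0\<close> by linarith
    qed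
    then show "\<exists>N. \<forall>n\<ge>N. dist (X n) (Abs_cinf g) < e" by blast
  qed
  then show "convergent X" by (rule convergentI)
qed

instance cov :: banach
proof
  fix X :: "nat \<Rightarrow> cov" assume X: "Cauchy X"
  let ?f = "\<lambda>n. Rep_cov (X n)"
  have le: "dist (?f m x) (?f n x) \<le> dist (X m) (X n)" for m n x
  proof (cases "x = 0")
    case False
    then show ?thesis
      unfolding dist_cov_def norm_cov_def dist_real_def Rep_cov_diff[symmetric]
      by (intro abs_le_supnorm[OF bounded_Rep_cov]) simp
  qed (simp add: Rep_cov_0)
  have "uniformly_Cauchy_on UNIV ?f"
    unfolding uniformly_Cauchy_on_def using X le unfolding Cauchy_def by (meson le_less_trans)
  then obtain g where g: "uniform_limit UNIV ?f g sequentially"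
    using Cauchy_uniformly_convergent unfolding uniformly_convergent_on_def by blast
  have R: "?f n \<in> C_ov" for n by (rule Rep_cov)
  have "continuous_on (- {0}) g"
    using R by (intro uniform_limit_theorem[OF _ uniform_limit_on_subset[OF g]]) (auto simp: C_ov_iff)
  moreover have "g 0 = 0"
    using tendsto_uniform_limitI[OF g, of 0] by (simp add: Rep_cov_0 LIMSEQ_const_iff)
  moreover have "\<exists>l. (g \<longlongrightarrow> l) at_bot"
    using R by (rule_tac uniform_limit_has_limit[OF g, of at_bot]) (auto simp: C_ov_iff)
  moreover have "\<exists>l. (g \<longlongrightarrow> l) at_top"
    using R by (rule_tac uniform_limit_has_limit[OF g, of at_top]) (auto simp: C_ov_iff)
  moreover have "\<exists>l. (g \<longlongrightarrow> - l) (at_left 0) \<and> (g \<longlongrightarrow> l) (at_right 0)"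
  proof -
    have ex: "\<And>n. \<exists>l. (?f n \<longlongrightarrow> l) (at_left 0)" "\<And>n. \<exists>l. (?f n \<longlongrightarrow> l) (at_right 0)"
      using R unfolding C_ov_iff by blast+
    obtain L l where L: "\<And>n. (?f n \<longlongrightarrow> L n) (at_left 0)" "L \<longlonglongrightarrow> l" "(g \<longlongrightarrow> l) (at_left 0)"
      by (rule uniform_limit_has_limit[OF g ex(1)]) auto
    obtain K k where K: "\<And>n. (?f n \<longlongrightarrow> K n) (at_right 0)" "K \<longlonglongrightarrow> k" "(g \<longlongrightarrow> k) (at_right 0)"
      by (rule uniform_limit_has_limit[OF g ex(2)]) auto
    have "L n = - K n" for n
    proof -
      obtain m where "(?f n \<longlongrightarrow> - m) (at_left 0)" "(?f n \<longlongrightarrow> m) (at_right 0)"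
        using R[of n] unfolding C_ov_iff by blast
      then have "L n = - m" "K n = m"
        using tendsto_unique[OF _ L(1)[of n]] tendsto_unique[OF _ K(1)[of n]] by auto
      then show ?thesis by simp
    qed
    then have "L = (\<lambda>n. - K n)" by blast
    then have "L \<longlonglongrightarrow> - k" using tendsto_minus[OF K(2)] by simp
    then have "l = - k" using L(2) LIMSEQ_unique by blast
    then show ?thesis using L(3) K(3) by blast
  qed
  ultimately have "g \<in> C_ov" by (simp add: C_ov_iff)
  then have Rg: "Rep_cov (Abs_cov g) = g" by (rule Abs_cov_inverse)
  have "X \<longlonglongrightarrow> Abs_cov g"
  proof (rule metric_LIMSEQ_I)
    fix e :: real assume "e > 0"
    then obtain N where N: "\<And>n x. n \<ge> N \<Longrightarrow> dist (?f n x) (g x) < e / 2"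
      using uniform_limitD[OF g, of "e / 2"] unfolding eventually_sequentially by auto
    have "dist (X n) (Abs_cov g) < e" if "n \<ge> N" for n
    proof -
      have "dist (X n) (Abs_cov g) \<le> e / 2"
        unfolding dist_cov_def norm_cov_def
        using N[OF that] Compl_0_nonempty
        by (intro supnorm_le) (auto simp: Rep_cov_diff Rg dist_real_def less_imp_le)
      then show ?thesis using \<open>e > 0\<close> by linarith
    qed
    then show "\<exists>N. \<forall>n\<ge>N. dist (X n) (Abs_cov g) < e" by blast
  qed
  then show "convergent X" by (rule convergentI)
qed


section \<open>Cosine families, semigroups and their generators\<close>

text \<open>A (possibly unbounded) operator is identified with its graph.\<close>

definition cosine_family :: "(real \<Rightarrow> 'a::real_normed_vector \<Rightarrow>\<^sub>L 'a) \<Rightarrow> bool" where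
  "cosine_family C \<longleftrightarrow>
     C 0 = id_blinfun \<and>
     (\<forall>t s. 2 *\<^sub>R (C t o\<^sub>L C s) = C (t + s) + C (t - s)) \<and>
     (\<forall>f. continuous_on UNIV (\<lambda>t. C t f))"

definition cosine_generator :: "(real \<Rightarrow> 'a::real_normed_vector \<Rightarrow>\<^sub>L 'a) \<Rightarrow> ('a \<times> 'a) set" where
  "cosine_generator C = {(f, g). ((\<lambda>t. (2 / t\<^sup>2) *\<^sub>R (C t f - f)) \<longlongrightarrow> g) (at 0)}"

definition semigroup :: "(real \<Rightarrow> 'a::real_normed_vector \<Rightarrow>\<^sub>L 'a) \<Rightarrow> bool" where
  "semigroup T \<longleftrightarrow>
     T 0 = id_blinfun \<and>
     (\<forall>t\<ge>0. \<forall>s\<ge>0. T (t + s) = T t o\<^sub>L T s) \<and>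
     (\<forall>f. continuous_on {0..} (\<lambda>t. T t f))"

definition semigroup_generator :: "(real \<Rightarrow> 'a::real_normed_vector \<Rightarrow>\<^sub>L 'a) \<Rightarrow> ('a \<times> 'a) set" where
  "semigroup_generator T = {(f, g). ((\<lambda>t. (1 / t) *\<^sub>R (T t f - f)) \<longlongrightarrow> g) (at_right 0)}"

definition generated_cosine :: "('a::real_normed_vector \<times> 'a) set \<Rightarrow> real \<Rightarrow> 'a \<Rightarrow>\<^sub>L 'a" where
  "generated_cosine A = (THE C. cosine_family C \<and> cosine_generator C = A)"

text \<open>
  The operator \<open>e\<^bsup>tA\<^esup>\<close> for \<open>t \<ge> 0\<close>. The description ranges over the value at \<open>t\<close>, because
  \<^const>\<open>semigroup\<close> leaves \<open>T t\<close> undetermined for \<open>t < 0\<close>.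
\<close>

definition generated_semigroup :: "('a::real_normed_vector \<times> 'a) set \<Rightarrow> real \<Rightarrow> 'a \<Rightarrow>\<^sub>L 'a" where
  "generated_semigroup A t = (THE S. \<exists>T. semigroup T \<and> semigroup_generator T = A \<and> S = T t)"


section \<open>The two operators\<close>

text \<open>\<open>f\<close> is twice continuously differentiable on \<open>S\<close>, with derivatives \<open>f'\<close> and \<open>f''\<close>;
  at a boundary point of \<open>S\<close> these are one-sided.\<close>

definition C2_on :: "real set \<Rightarrow> (real \<Rightarrow> real) \<Rightarrow> (real \<Rightarrow> real) \<Rightarrow> (real \<Rightarrow> real) \<Rightarrow> bool" where
  "C2_on S f f' f'' \<longleftrightarrow>
     (\<forall>x\<in>S. (f has_real_derivative f' x) (at x within S)) \<and>
     (\<forall>x\<in>S. (f' has_real_derivative f'' x) (at x within S)) \<and>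
     continuous_on S f''"

definition left_part :: "(real \<Rightarrow> real) \<Rightarrow> real \<Rightarrow> real" where
  "left_part f x = (if x < 0 then f x else Lim (at_left 0) f)"

definition right_part :: "(real \<Rightarrow> real) \<Rightarrow> real \<Rightarrow> real" where
  "right_part f x = (if x > 0 then f x else Lim (at_right 0) f)"

text \<open>
  In both definitions \<open>l', l''\<close> and \<open>r', r''\<close> are the derivatives of the left and the right
  part of \<open>f\<close>, so \<open>l' 0\<close> is \<open>f'(0-)\<close>, \<open>r' 0\<close> is \<open>f'(0+)\<close>, and similarly for \<open>f''\<close>.
\<close>

definition A_perp :: "real \<Rightarrow> real \<Rightarrow> (cov \<times> cov) set" where
  "A_perp \<alpha> \<beta> = {(f, g). \<exists>l' l'' r' r''.
     C2_on {..0} (left_part (Rep_cov f)) l' l'' \<and>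
     C2_on {0..} (right_part (Rep_cov f)) r' r'' \<and>
     (\<exists>c. (l'' \<longlongrightarrow> c) at_bot) \<and> (\<exists>c. (r'' \<longlongrightarrow> c) at_top) \<and>
     r'' 0 = \<alpha> * l' 0 + \<beta> * r' 0 \<and> r'' 0 = - l'' 0 \<and>
     (\<forall>x<0. Rep_cov g x = l'' x) \<and> (\<forall>x>0. Rep_cov g x = r'' x)}"

definition A_skew :: "real \<Rightarrow> real \<Rightarrow> (cinf \<times> cinf) set" where
  "A_skew a b = {(f, g). \<exists>l' l'' r' r''.
     C2_on {..0} (Rep_cinf f) l' l'' \<and>
     C2_on {0..} (Rep_cinf f) r' r'' \<and>
     (\<exists>c. (l'' \<longlongrightarrow> c) at_bot) \<and> (\<exists>c. (r'' \<longlongrightarrow> c) at_top) \<and>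
     a * r' 0 = b * l' 0 \<and> r'' 0 = l'' 0 \<and>
     (\<forall>x\<le>0. Rep_cinf g x = l'' x) \<and> (\<forall>x\<ge>0. Rep_cinf g x = r'' x)}"

definition Cos_perp :: "real \<Rightarrow> real \<Rightarrow> real \<Rightarrow> cov \<Rightarrow>\<^sub>L cov" where
  "Cos_perp \<alpha> \<beta> = generated_cosine (A_perp \<alpha> \<beta>)"

definition Cos_skew :: "real \<Rightarrow> real \<Rightarrow> real \<Rightarrow> cinf \<Rightarrow>\<^sub>L cinf" where
  "Cos_skew a b = generated_cosine (A_skew a b)"

definition exp_perp :: "real \<Rightarrow> real \<Rightarrow> real \<Rightarrow> cov \<Rightarrow>\<^sub>L cov" where
  "exp_perp \<alpha> \<beta> = generated_semigroup (A_perp \<alpha> \<beta>)"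

definition exp_skew :: "real \<Rightarrow> real \<Rightarrow> real \<Rightarrow> cinf \<Rightarrow>\<^sub>L cinf" where
  "exp_skew a b = generated_semigroup (A_skew a b)"


section \<open>The isometric isomorphism between the two spaces\<close>

lift_definition J :: "cov \<Rightarrow> cinf" is
  "\<lambda>f x. if x < 0 then - f x else if x > 0 then f x else Lim (at_right 0) f"
proof -
  fix f :: "real \<Rightarrow> real" assume "f \<in> C_ov"
  then obtain a b l where f: "continuous_on (- {0}) f" "(f \<longlongrightarrow> a) at_bot" "(f \<longlongrightarrow> b) at_top"
    "(f \<longlongrightarrow> - l) (at_left 0)" "(f \<longlongrightarrow> l) (at_right 0)" unfolding C_ov_iff by metis
  have Lim: "Lim (at_right 0) f = l" using f(5) by (intro tendsto_Lim) auto
  define g where "g x = (if x < 0 then - f x else if x > 0 then f x else Lim (at_right 0) f)" for x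
  have evl: "eventually (\<lambda>x. - f x = g x) (at_left 0)" and evr: "eventually (\<lambda>x. f x = g x) (at_right 0)"
    and evb: "eventually (\<lambda>x. - f x = g x) at_bot" and evt: "eventually (\<lambda>x. f x = g x) at_top"
    using eventually_mono[OF eventually_negative_at_bot, of "\<lambda>x. - f x = g x"]
      eventually_mono[OF eventually_gt_at_top[of "0::real"], of "\<lambda>x. f x = g x"]
    by (auto simp: eventually_at_filter g_def)
  have "(g \<longlongrightarrow> l) (at_left 0)"
    using tendsto_minus[OF f(4)] tendsto_cong[OF evl] by simp
  moreover have "(g \<longlongrightarrow> l) (at_right 0)" using f(5) tendsto_cong[OF evr] by simp
  moreover have "g 0 = l" by (simp add: g_def Lim)
  ultimately have "isCont g 0" unfolding isCont_def filterlim_at_split by simp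
  moreover have "isCont g x" if "x < 0" for x
  proof -
    have "continuous_on {..<0} g"
      by (rule continuous_on_eq[of _ "\<lambda>x. - f x"])
        (auto simp: g_def intro!: continuous_on_minus continuous_on_subset[OF f(1)])
    then show ?thesis using that by (simp add: continuous_on_eq_continuous_at)
  qed
  moreover have "isCont g x" if "x > 0" for x
  proof -
    have "continuous_on {0<..} g"
      by (rule continuous_on_eq[of _ f])
        (auto simp: g_def intro!: continuous_on_subset[OF f(1)])
    then show ?thesis using that by (simp add: continuous_on_eq_continuous_at)
  qed
  ultimately have "continuous_on UNIV g"
    by (metis continuous_on_eq_continuous_at linorder_neqE_linordered_idom open_UNIV)
  moreover have "(g \<longlongrightarrow> - a) at_bot" using tendsto_minus[OF f(2)] tendsto_cong[OF evb] by simp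
  moreover have "(g \<longlongrightarrow> b) at_top" using f(3) tendsto_cong[OF evt] by simp
  ultimately have "g \<in> C_infty" unfolding C_infty_def by blast
  then show "(\<lambda>x. if x < 0 then - f x else if x > 0 then f x else Lim (at_right 0) f) \<in> C_infty"
    unfolding g_def .
qed

lemma Rep_J:
  "Rep_cinf (J f) x = (if x < 0 then - Rep_cov f x else if x > 0 then Rep_cov f x
     else Lim (at_right 0) (Rep_cov f))"
  by transfer simp

lemma cinf_eqI:
  assumes "\<And>x. x \<noteq> 0 \<Longrightarrow> Rep_cinf f x = Rep_cinf g x"
  shows "f = g"
proof -
  have "isCont (Rep_cinf f) 0" "isCont (Rep_cinf g) 0"
    using Rep_cinf[of f] Rep_cinf[of g] by (auto simp: C_infty_def continuous_on_eq_continuous_at)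
  then have "(Rep_cinf f \<longlongrightarrow> Rep_cinf f 0) (at 0)" "(Rep_cinf g \<longlongrightarrow> Rep_cinf g 0) (at 0)"
    by (simp_all add: isCont_def)
  moreover have "eventually (\<lambda>x. Rep_cinf f x = Rep_cinf g x) (at 0)"
    using assms by (simp add: eventually_at_filter)
  ultimately have "Rep_cinf f 0 = Rep_cinf g 0"
    using tendsto_cong[of "Rep_cinf f" "Rep_cinf g" "at 0"] tendsto_unique[OF trivial_limit_at]
    by blast
  then have "Rep_cinf f x = Rep_cinf g x" for x using assms by (cases "x = 0") auto
  then have "Rep_cinf f = Rep_cinf g" by (rule ext)
  then show ?thesis by (simp add: Rep_cinf_inject)
qed

lemma linear_J: "linear J"
proof (rule linearI)
  fix f g :: cov and c :: real
  have "Rep_cinf (J f + J g) x = Rep_cinf (J f) x + Rep_cinf (J g) x"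
    "Rep_cov (f + g) x = Rep_cov f x + Rep_cov g x"
    "Rep_cinf (c *\<^sub>R J f) x = c * Rep_cinf (J f) x"
    "Rep_cov (c *\<^sub>R f) x = c * Rep_cov f x" for x
    by (transfer; simp)+
  then show "J (f + g) = J f + J g" "J (c *\<^sub>R f) = c *\<^sub>R J f"
    by (auto intro!: cinf_eqI simp: Rep_J)
qed

lemma norm_J: "norm (J f) = norm f"
proof (rule antisym)
  have le: "\<bar>Rep_cov f x\<bar> \<le> norm f" if "x \<noteq> 0" for x
    unfolding norm_cov_def using that by (intro abs_le_supnorm[OF bounded_Rep_cov]) simp
  obtain l where l: "(Rep_cov f \<longlongrightarrow> l) (at_right 0)"
    using Rep_cov[of f] unfolding C_ov_iff by blast
  then have "Lim (at_right 0) (Rep_cov f) = l" by (intro tendsto_Lim) auto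
  moreover have "\<bar>l\<bar> \<le> norm f"
    by (rule tendsto_upperbound[OF tendsto_rabs[OF l]])
      (use le in \<open>auto simp: eventually_at_filter\<close>)
  ultimately show "norm (J f) \<le> norm f"
    using le unfolding norm_cinf_def by (intro supnorm_le) (auto simp: Rep_J)
  show "norm f \<le> norm (J f)"
    unfolding norm_cov_def
  proof (rule supnorm_le[OF Compl_0_nonempty])
    fix x :: real assume "x \<in> - {0}"
    then have "\<bar>Rep_cov f x\<bar> = \<bar>Rep_cinf (J f) x\<bar>" by (auto simp: Rep_J)
    also have "\<dots> \<le> norm (J f)"
      unfolding norm_cinf_def by (rule abs_le_supnorm[OF bounded_Rep_cinf]) simp
    finally show "\<bar>Rep_cov f x\<bar> \<le> norm (J f)" .
  qed
qed

lemma bij_J: "bij J"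
proof (rule bijI)
  show "inj J"
  proof (rule injI)
    fix f g assume "J f = J g"
    then have "norm (f - g) = 0" using norm_J[of "f - g"] by (simp add: linear_diff[OF linear_J])
    then show "f = g" by simp
  qed
  show "surj J"
  proof -
    have "\<exists>h. J h = g" for g :: cinf
    proof -
      define f where "f x = (if x < 0 then - Rep_cinf g x else if x > 0 then Rep_cinf g x else 0)" for x
      obtain a b where g: "continuous_on UNIV (Rep_cinf g)" "(Rep_cinf g \<longlongrightarrow> a) at_bot"
        "(Rep_cinf g \<longlongrightarrow> b) at_top" using Rep_cinf[of g] unfolding C_infty_def by blast
      have g0: "(Rep_cinf g \<longlongrightarrow> Rep_cinf g 0) (at_left 0)" "(Rep_cinf g \<longlongrightarrow> Rep_cinf g 0) (at_right 0)"
        using g(1) unfolding continuous_on_eq_continuous_at[OF open_UNIV] isCont_def filterlim_at_split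
        by auto
      have evl: "eventually (\<lambda>x. - Rep_cinf g x = f x) (at_left 0)"
        and evr: "eventually (\<lambda>x. Rep_cinf g x = f x) (at_right 0)"
        and evb: "eventually (\<lambda>x. - Rep_cinf g x = f x) at_bot"
        and evt: "eventually (\<lambda>x. Rep_cinf g x = f x) at_top"
        using eventually_mono[OF eventually_negative_at_bot, of "\<lambda>x. - Rep_cinf g x = f x"]
          eventually_mono[OF eventually_gt_at_top[of "0::real"], of "\<lambda>x. Rep_cinf g x = f x"]
        by (auto simp: eventually_at_filter f_def)
      have "continuous_on ({..<0} \<union> {0<..}) f"
      proof (rule continuous_on_open_Un)
        show "continuous_on {..<0} f"
          by (rule continuous_on_eq[of _ "\<lambda>x. - Rep_cinf g x"])
            (auto simp: f_def intro!: continuous_on_minus continuous_on_subset[OF g(1)])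
        show "continuous_on {0<..} f"
          by (rule continuous_on_eq[of _ "Rep_cinf g"])
            (auto simp: f_def intro!: continuous_on_subset[OF g(1)])
      qed auto
      moreover have "{..<0} \<union> {0<..} = - {0 :: real}" by auto
      moreover have "(f \<longlongrightarrow> - a) at_bot" using tendsto_minus[OF g(2)] tendsto_cong[OF evb] by simp
      moreover have "(f \<longlongrightarrow> b) at_top" using g(3) tendsto_cong[OF evt] by simp
      moreover have "(f \<longlongrightarrow> - Rep_cinf g 0) (at_left 0)"
        using tendsto_minus[OF g0(1)] tendsto_cong[OF evl] by simp
      moreover have "(f \<longlongrightarrow> Rep_cinf g 0) (at_right 0)" using g0(2) tendsto_cong[OF evr] by simp
      moreover have "f 0 = 0" by (simp add: f_def)
      ultimately have "f \<in> C_ov" unfolding C_ov_iff by auto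
      then have "Rep_cov (Abs_cov f) = f" by (rule Abs_cov_inverse)
      then have "J (Abs_cov f) = g" by (intro cinf_eqI) (auto simp: Rep_J f_def)
      then show ?thesis ..
    qed
    then show ?thesis by (metis surjI)
  qed
qed

end

theory Submission
  imports Defs "HOL-Probability.Probability"
begin

text \<open>
  Transported by \<^term>\<open>J\<close> to continuous functions on the line, both operators become
  \<open>f \<mapsto> f''\<close> with the transmission condition
  \<open>d f''(0) = p f'(0+) - (1 - p) f'(0-)\<close>, where \<open>p = \<beta> / (\<alpha> + \<beta>)\<close>; here \<open>d = 1 / (\<alpha> + \<beta>)\<close> for
  \<^term>\<open>A_perp\<close> and \<open>d = 0\<close> for \<^term>\<open>A_skew\<close>, so replacing \<open>(\<alpha>, \<beta>)\<close> by \<open>(n \<alpha>, n \<beta>)\<close> sends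
  \<open>d\<close> to \<open>0\<close> with \<open>p\<close> fixed.

  The restrictions of \<open>f\<close> to the half-lines have unique extensions \<open>a, b\<close> to the whole line with a
  common even part \<open>q\<close> and \<open>d q' = p a\<^sub>o - (1 - p) b\<^sub>o\<close> for the odd parts. This relation is
  linear and invariant under \<open>u \<mapsto> u(\<cdot> + t) + u(\<cdot> - t)\<close>, so d'Alembert's formula applied to \<open>a\<close> and \<open>b\<close> is a
  cosine family; differentiating the relation at \<open>0\<close> gives the transmission condition. On
  \<open>[0, \<infinity>)\<close> it reads \<open>d q' = w - q\<close> with \<open>w(x) = p f(x) + (1 - p) f(-x)\<close>, hence \<open>q\<close> obeys the
  bounds of \<open>w\<close> and converges to \<open>w\<close> uniformly as \<open>d \<rightarrow> 0\<close>. The semigroups are Gaussian means of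
  the cosine families, so their convergence follows.
\<close>

section \<open>Symmetric second derivatives\<close>

text \<open>Origin of the relation between \<open>a\<close> and \<open>b\<close>: if d'Alembert's
  formula is to describe the orbit \<open>u(t, x)\<close> on both half-lines, then
  \<open>u(t, 0)\<close> is the even part of \<open>a\<close> at \<open>t\<close> seen from the
  right and that of \<open>b\<close> seen from the left, so continuity at 0 at all times forces a
  common even part \<open>q\<close>. At 0 one has \<open>u_xx = u_tt = q''\<close>, and the
  one-sided slopes at time \<open>t\<close> are the derivatives of the odd parts; hence the
  transmission condition at time \<open>t\<close> reads
  \<open>d q'' = p a_o' - (1 - p) b_o'\<close>, and integration from 0 gives the relation. In this
  integrated form it makes sense for every continuous \<open>f\<close>, and with \<open>d\<close>
  kept inside the derivative the case \<open>d = 0\<close> is covered by the same argument instead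
  of being a singular limit. The obstacle is that all families are definite descriptions through
  their generators. Each generator must therefore be identified exactly, by both inclusions, and
  must be shown to determine its family, first for cosine families and again for semigroups.
  Inclusion in the domain rests on passing from symmetric second quotients to true
  derivatives.\<close>

lemma C2_second_difference_bound_pos:
  fixes u :: "real \<Rightarrow> 'a::real_normed_vector"
  assumes u: "\<And>s. (u has_vector_derivative U s) (at s)"
    and U: "\<And>s. (U has_vector_derivative v s) (at s)"
    and v: "\<And>s. \<bar>s - x\<bar> \<le> h \<Longrightarrow> norm (v s - k) \<le> \<eta>" and h: "h > 0"
  shows "norm (u (x + h) + u (x - h) - 2 *\<^sub>R u x - h\<^sup>2 *\<^sub>R k) \<le> \<eta> * h\<^sup>2"
proof -
  have du: "((\<lambda>s. u (x + s)) has_vector_derivative U (x + s)) (at s)"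
    "((\<lambda>s. u (x - s)) has_vector_derivative - U (x - s)) (at s)"
    "((\<lambda>s. U (x + s)) has_vector_derivative v (x + s)) (at s)"
    "((\<lambda>s. U (x - s)) has_vector_derivative - v (x - s)) (at s)" for s
  proof -
    have p: "((\<lambda>s. x + s) has_vector_derivative 0 + 1) (at s)" by (intro derivative_intros)
    have m: "((\<lambda>s. x - s) has_vector_derivative 0 - 1) (at s)" by (intro derivative_intros)
    show "((\<lambda>s. u (x + s)) has_vector_derivative U (x + s)) (at s)"
      "((\<lambda>s. u (x - s)) has_vector_derivative - U (x - s)) (at s)"
      "((\<lambda>s. U (x + s)) has_vector_derivative v (x + s)) (at s)"
      "((\<lambda>s. U (x - s)) has_vector_derivative - v (x - s)) (at s)"
      using vector_diff_chain_at[OF p u] vector_diff_chain_at[OF m u]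
        vector_diff_chain_at[OF p U] vector_diff_chain_at[OF m U] by (simp_all add: o_def)
  qed
  have d1: "((\<lambda>s. U (x + s) - U (x - s) - (2 * s) *\<^sub>R k) has_vector_derivative
      (v (x + s) - k) + (v (x - s) - k)) (at s)" for s
  proof -
    have "((\<lambda>s. 2 * s) has_real_derivative 2) (at s)" by (auto intro!: derivative_eq_intros)
    then have "((\<lambda>s. U (x + s) - U (x - s) - (2 * s) *\<^sub>R k) has_vector_derivative
      v (x + s) - (- v (x - s)) - ((2 * s) *\<^sub>R 0 + 2 *\<^sub>R k)) (at s)"
      by (intro derivative_intros du)
    then show ?thesis by (simp add: scaleR_2 algebra_simps)
  qed
  have d0: "((\<lambda>s. u (x + s) + u (x - s) - s\<^sup>2 *\<^sub>R k) has_vector_derivative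
      U (x + s) - U (x - s) - (2 * s) *\<^sub>R k) (at s)" for s
  proof -
    have "((\<lambda>s. s\<^sup>2) has_real_derivative 2 * s) (at s)" by (auto intro!: derivative_eq_intros)
    then have "((\<lambda>s. u (x + s) + u (x - s) - s\<^sup>2 *\<^sub>R k) has_vector_derivative
      U (x + s) + (- U (x - s)) - (s\<^sup>2 *\<^sub>R 0 + (2 * s) *\<^sub>R k)) (at s)"
      by (intro derivative_intros du)
    then show ?thesis by simp
  qed
  have b1: "norm (U (x + s) - U (x - s) - (2 * s) *\<^sub>R k) \<le> 2 * \<eta> * s" if s: "0 < s" "s \<le> h" for s
  proof -
    have "norm ((U (x + s) - U (x - s) - (2 * s) *\<^sub>R k) - (U (x + 0) - U (x - 0) - (2 * 0) *\<^sub>R k))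
        \<le> 2 * \<eta> * s - 2 * \<eta> * 0"
    proof (rule differentiable_bound_general[OF s(1), where \<phi>' = "\<lambda>_. 2 * \<eta>"])
      show "continuous_on {0..s} (\<lambda>s. U (x + s) - U (x - s) - (2 * s) *\<^sub>R k)"
        using d1 by (intro continuous_at_imp_continuous_on ballI has_vector_derivative_continuous)
      show "norm ((v (x + r) - k) + (v (x - r) - k)) \<le> 2 * \<eta>" if "0 < r" "r < s" for r
        using v[of "x + r"] v[of "x - r"] norm_triangle_ineq[of "v (x + r) - k" "v (x - r) - k"] that s
        by simp
    qed (auto intro!: d1 continuous_intros derivative_eq_intros simp: has_real_derivative_iff_has_vector_derivative[symmetric])
    then show ?thesis by simp
  qed
  have "norm ((u (x + h) + u (x - h) - h\<^sup>2 *\<^sub>R k) - (u (x + 0) + u (x - 0) - 0\<^sup>2 *\<^sub>R k))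
      \<le> \<eta> * h\<^sup>2 - \<eta> * 0\<^sup>2"
  proof (rule differentiable_bound_general[OF h, where \<phi>' = "\<lambda>s. 2 * \<eta> * s"])
    show "continuous_on {0..h} (\<lambda>s. u (x + s) + u (x - s) - s\<^sup>2 *\<^sub>R k)"
      using d0 by (intro continuous_at_imp_continuous_on ballI has_vector_derivative_continuous)
    show "norm (U (x + r) - U (x - r) - (2 * r) *\<^sub>R k) \<le> 2 * \<eta> * r" if "0 < r" "r < h" for r
      using b1 that by simp
  qed (auto intro!: d0 continuous_intros derivative_eq_intros simp: has_real_derivative_iff_has_vector_derivative[symmetric])
  then show ?thesis by (simp add: scaleR_2 algebra_simps)
qed

text \<open>The mean value inequality is applied twice in the increment \<open>s\<close>, since the
  derivative of \<open>u (x + s) + u (x - s) - s^2 k\<close> vanishes at \<open>s = 0\<close>. The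
  reference value \<open>k\<close> is free rather than \<open>v x\<close>: closedness of the
  generator needs it to be a limit of second derivatives.\<close>

lemma C2_second_difference_bound:
  fixes u :: "real \<Rightarrow> 'a::real_normed_vector"
  assumes u: "\<And>s. (u has_vector_derivative U s) (at s)"
    and U: "\<And>s. (U has_vector_derivative v s) (at s)"
    and v: "\<And>s. \<bar>s - x\<bar> \<le> \<bar>h\<bar> \<Longrightarrow> norm (v s - k) \<le> \<eta>"
  shows "norm (u (x + h) + u (x - h) - 2 *\<^sub>R u x - h\<^sup>2 *\<^sub>R k) \<le> \<eta> * h\<^sup>2"
proof (cases "h = 0")
  case True then show ?thesis by (simp add: scaleR_2)
next
  case False
  then show ?thesis
    using C2_second_difference_bound_pos[of u U v x "\<bar>h\<bar>" k \<eta>] assms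
    by (cases "h > 0") (auto simp: add.commute)
qed

text \<open>A maximum of \<open>f\<close> plus a small convex parabola vanishing at both ends contradicts the
  second-difference condition.\<close>

lemma nonpos_if_almost_convex:
  fixes f :: "real \<Rightarrow> real"
  assumes cont: "continuous_on {c..d} f" and fc: "f c \<le> 0" and fd: "f d \<le> 0"
    and conv: "\<And>x e. c < x \<Longrightarrow> x < d \<Longrightarrow> e > 0 \<Longrightarrow>
      eventually (\<lambda>h. f (x + h) + f (x - h) - 2 * f x \<ge> - e * h\<^sup>2) (at_right 0)"
    and x: "x \<in> {c..d}"
  shows "f x \<le> 0"
proof (rule ccontr)
  assume "\<not> f x \<le> 0"
  then have fx: "f x > 0" by simp
  then have cd: "c < x" "x < d" using x fc fd by (auto simp: less_le)
  define P where "P y = (y - c) * (d - y)" for y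
  have Px: "P x > 0" using cd by (simp add: P_def)
  \<comment> \<open>With this \<open>e\<close> half of \<open>f x\<close> survives in
    \<open>m x\<close>, so the maximum of \<open>m\<close> is positive and hence interior. There
    \<open>- e * P\<close> contributes \<open>2 * e * h^2\<close> to the second difference, more
    than the loss \<open>e * h^2\<close> that \<open>conv\<close> allows.\<close>
  define e where "e = f x / (2 * P x)"
  have e: "e > 0" using fx Px by (simp add: e_def)
  define m where "m y = f y - e * P y" for y
  have "continuous_on {c..d} m" unfolding m_def P_def by (intro continuous_intros cont)
  then obtain z where z: "z \<in> {c..d}" "\<And>y. y \<in> {c..d} \<Longrightarrow> m y \<le> m z"
    using continuous_attains_sup[of "{c..d}" m] x by auto
  have "m x = f x / 2" using Px by (simp add: m_def e_def)
  then have mz: "m z > 0" using z(2)[OF x] fx by linarith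
  have "m c \<le> 0" "m d \<le> 0" using fc fd by (auto simp: m_def P_def)
  then have zcd: "c < z" "z < d" using z(1) mz by (auto simp: less_le)
  have "eventually (\<lambda>h. h < min (z - c) (d - z)) (at_right 0)"
    using zcd by (intro order_tendstoD(2)[OF tendsto_ident_at]) simp
  moreover have "eventually (\<lambda>h::real. h > 0) (at_right 0)" by (simp add: eventually_at_right_less)
  ultimately have "eventually (\<lambda>h::real. False) (at_right 0)"
    using conv[OF zcd e]
  proof eventually_elim
    case (elim h)
    have "m (z + h) \<le> m z" "m (z - h) \<le> m z" using elim by (auto intro!: z(2))
    then have "m (z + h) + m (z - h) - 2 * m z \<le> 0" by simp
    moreover have "m (z + h) + m (z - h) - 2 * m z = f (z + h) + f (z - h) - 2 * f z + 2 * e * h\<^sup>2"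
      by (simp add: m_def P_def algebra_simps power2_eq_square)
    moreover have "e * h\<^sup>2 > 0" using e elim by simp
    ultimately show False using elim by (simp add: algebra_simps)
  qed
  then show False by simp
qed

text \<open>The Schwarz derivative; the quotient is even in \<open>h\<close>, so a right limit is
  enough. It suits cosine families: by the cosine equation the quotient of an orbit at
  \<open>t\<close> is \<open>C t\<close> applied to the generator quotient, before any
  differentiability of the orbit is known.\<close>

definition sym_deriv2 :: "(real \<Rightarrow> 'a::real_normed_vector) \<Rightarrow> 'a \<Rightarrow> real \<Rightarrow> bool" where
  "sym_deriv2 u v x \<longleftrightarrow>
    ((\<lambda>h. (1 / h\<^sup>2) *\<^sub>R (u (x + h) + u (x - h) - 2 *\<^sub>R u x)) \<longlongrightarrow> v) (at_right 0)"

lemma sym_deriv2_diff: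
  assumes "sym_deriv2 u v x" "sym_deriv2 u' v' x"
  shows "sym_deriv2 (\<lambda>y. u y - u' y) (v - v') x"
  using tendsto_diff[OF assms[unfolded sym_deriv2_def]]
  unfolding sym_deriv2_def by (simp add: algebra_simps)

lemma sym_deriv2_affine: "sym_deriv2 (\<lambda>y. a + y *\<^sub>R b) 0 x"
proof -
  have "a + (x + h) *\<^sub>R b + (a + (x - h) *\<^sub>R b) - 2 *\<^sub>R (a + x *\<^sub>R b) = 0" for h
    by (simp add: algebra_simps flip: scaleR_2)
  then show ?thesis unfolding sym_deriv2_def by simp
qed

lemma sym_deriv2_C2:
  fixes u :: "real \<Rightarrow> 'a::real_normed_vector"
  assumes u: "\<And>s. (u has_vector_derivative U s) (at s)"
    and U: "\<And>s. (U has_vector_derivative v s) (at s)" and v: "isCont v x"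
  shows "sym_deriv2 u (v x) x"
  unfolding sym_deriv2_def
proof (rule tendstoI)
  fix e :: real assume e: "e > 0"
  then obtain d where d: "d > 0" "\<And>s. \<bar>s - x\<bar> < d \<Longrightarrow> norm (v s - v x) < e / 2"
    using v unfolding continuous_at_eps_delta dist_norm by (metis half_gt_zero real_norm_def)
  have "eventually (\<lambda>h. h < d) (at_right 0)"
    using d(1) by (intro order_tendstoD(2)[OF tendsto_ident_at])
  moreover have "eventually (\<lambda>h::real. h > 0) (at_right 0)" by (simp add: eventually_at_right_less)
  ultimately show "eventually (\<lambda>h. dist ((1 / h\<^sup>2) *\<^sub>R (u (x + h) + u (x - h) - 2 *\<^sub>R u x)) (v x) < e) (at_right 0)"
  proof eventually_elim
    case (elim h)
    have "norm (u (x + h) + u (x - h) - 2 *\<^sub>R u x - h\<^sup>2 *\<^sub>R v x) \<le> (e / 2) * h\<^sup>2"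
      using d(2) elim by (intro C2_second_difference_bound[OF u U]) (auto intro!: less_imp_le)
    moreover have "(1 / h\<^sup>2) *\<^sub>R (u (x + h) + u (x - h) - 2 *\<^sub>R u x) - v x
        = (1 / h\<^sup>2) *\<^sub>R (u (x + h) + u (x - h) - 2 *\<^sub>R u x - h\<^sup>2 *\<^sub>R v x)"
      using elim by (simp add: scaleR_diff_right)
    ultimately have "dist ((1 / h\<^sup>2) *\<^sub>R (u (x + h) + u (x - h) - 2 *\<^sub>R u x)) (v x) \<le> e / 2"
      using elim by (simp add: dist_norm divide_simps)
    then show ?case using e by simp
  qed
qed

text \<open>The maximum argument needs an order, so it is applied to \<open>norm (u x)\<close>. By
  the triangle inequality the second difference of the norm is at least minus the norm of the second
  difference of \<open>u\<close>.\<close>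

lemma sym_deriv2_zero_interval:
  fixes u :: "real \<Rightarrow> 'a::real_normed_vector"
  assumes cont: "continuous_on {c..d} u" and ends: "u c = 0" "u d = 0"
    and s: "\<And>x. sym_deriv2 u 0 x" and x: "x \<in> {c..d}"
  shows "u x = 0"
proof -
  have "norm (u x) \<le> 0"
  proof (rule nonpos_if_almost_convex[OF _ _ _ _ x])
    show "continuous_on {c..d} (\<lambda>x. norm (u x))" by (intro continuous_intros cont)
    fix x e :: real assume e: "e > 0"
    have "eventually (\<lambda>h. norm ((1 / h\<^sup>2) *\<^sub>R (u (x + h) + u (x - h) - 2 *\<^sub>R u x)) < e) (at_right 0)"
      using tendstoD[OF s[of x, unfolded sym_deriv2_def] e] by (simp add: dist_norm)
    moreover have "eventually (\<lambda>h::real. h > 0) (at_right 0)" by (simp add: eventually_at_right_less)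
    ultimately show "eventually (\<lambda>h. norm (u (x + h)) + norm (u (x - h)) - 2 * norm (u x) \<ge> - e * h\<^sup>2) (at_right 0)"
    proof eventually_elim
      case (elim h)
      have "norm (u (x + h) + u (x - h) - 2 *\<^sub>R u x) \<le> e * h\<^sup>2"
        using elim by (simp add: divide_simps split: if_splits)
      moreover have "norm (2 *\<^sub>R u x) \<le> norm (u (x + h)) + norm (u (x - h))
          + norm (u (x + h) + u (x - h) - 2 *\<^sub>R u x)"
        using norm_triangle_ineq4[of "u (x + h) + u (x - h)" "u (x + h) + u (x - h) - 2 *\<^sub>R u x"]
          norm_triangle_ineq[of "u (x + h)" "u (x - h)"] by simp
      ultimately show ?case by simp
    qed
  qed (use ends in auto)
  then show ?thesis by simp
qed

lemma antiderivative_at_0: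
  fixes f :: "real \<Rightarrow> 'a::banach"
  assumes f: "continuous_on UNIV f"
  obtains F where "\<And>x. (F has_vector_derivative f x) (at x)" "F 0 = 0"
proof -
  define F where "F x = (if x \<ge> 0 then integral {0..x} f else - integral {x..0} f)" for x
  have int: "f integrable_on {a..b}" for a b
    by (intro integrable_continuous_real continuous_on_subset[OF f]) simp
  have F: "F y = integral {c..y} f - integral {c..0} f" if "c < 0" "c < y" for c y
    using Henstock_Kurzweil_Integration.integral_combine[OF _ _ int, of c 0 y]
      Henstock_Kurzweil_Integration.integral_combine[OF _ _ int, of c y 0] that
    by (auto simp: F_def algebra_simps)
  have "(F has_vector_derivative f x) (at x)" for x
  proof -
    define c where "c = min x 0 - 1"
    define d where "d = x + 1"
    have "((\<lambda>u. integral {c..u} f) has_vector_derivative f x) (at x within {c..d})"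
      by (rule integral_has_vector_derivative[OF continuous_on_subset[OF f]]) (auto simp: c_def d_def)
    then have "((\<lambda>u. integral {c..u} f - integral {c..0} f) has_vector_derivative f x - 0) (at x within {c..d})"
      by (intro derivative_intros)
    then have "((\<lambda>u. integral {c..u} f - integral {c..0} f) has_vector_derivative f x) (at x)"
      by (subst (asm) at_within_interior) (auto simp: c_def d_def)
    then show ?thesis
      by (rule has_vector_derivative_transform_within_open[of _ _ _ "{c<..}"]) (auto simp: F[symmetric] c_def)
  qed
  moreover have "F 0 = 0" by (simp add: F_def)
  ultimately show ?thesis by (rule that)
qed

lemma has_vector_derivative_imp_continuous_UNIV:
  assumes "\<And>x. (F has_vector_derivative f x) (at x)"
  shows "continuous_on UNIV F"
  using assms by (intro continuous_at_imp_continuous_on ballI has_vector_derivative_continuous)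

text \<open>Schwarz's theorem: subtracting a twofold antiderivative of \<open>v\<close> leaves a
  continuous function with vanishing symmetric second derivative, and such a function is
  affine.\<close>

theorem sym_deriv2_imp_C2:
  fixes u :: "real \<Rightarrow> 'a::banach"
  assumes u: "continuous_on UNIV u" and v: "continuous_on UNIV v" and s: "\<And>x. sym_deriv2 u (v x) x"
  obtains U where "\<And>x. (u has_vector_derivative U x) (at x)" "\<And>x. (U has_vector_derivative v x) (at x)"
proof -
  obtain V where V: "\<And>x. (V has_vector_derivative v x) (at x)"
    using antiderivative_at_0[OF v] by blast
  obtain W where W: "\<And>x. (W has_vector_derivative V x) (at x)"
    using antiderivative_at_0[OF has_vector_derivative_imp_continuous_UNIV[OF V]] by blast
  define w where "w x = u x - W x" for x
  have wc: "continuous_on UNIV w"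
    unfolding w_def by (intro continuous_intros u has_vector_derivative_imp_continuous_UNIV[OF W])
  have ws: "sym_deriv2 w 0 x" for x
    using sym_deriv2_diff[OF s[of x] sym_deriv2_C2[OF W V, of x]] v
    by (simp add: w_def[abs_def] continuous_on_eq_continuous_at)
  define b where "b = w 1 - w 0"
  have w: "w x = w 0 + x *\<^sub>R b" for x
  proof -
    \<comment> \<open>The interval contains 0, 1 and \<open>x\<close>. The affine function that
      interpolates \<open>w\<close> at its ends agrees with \<open>w\<close> at all three points,
      hence is the one determined by 0 and 1.\<close>
    define c d where "c = min x 0" and "d = max x 1"
    define B where "B = (1 / (d - c)) *\<^sub>R (w d - w c)"
    define A where "A = w c - c *\<^sub>R B"
    have cd: "c < d" by (auto simp: c_def d_def)
    have "w y - (A + y *\<^sub>R B) = 0" if "y \<in> {c..d}" for y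
    proof (rule sym_deriv2_zero_interval[OF _ _ _ _ that])
      show "continuous_on {c..d} (\<lambda>y. w y - (A + y *\<^sub>R B))"
        by (intro continuous_intros continuous_on_subset[OF wc]) auto
      show "w c - (A + c *\<^sub>R B) = 0" by (simp add: A_def)
      have "(d - c) *\<^sub>R B = w d - w c" using cd by (simp add: B_def)
      then show "w d - (A + d *\<^sub>R B) = 0" by (simp add: A_def algebra_simps)
      show "sym_deriv2 (\<lambda>y. w y - (A + y *\<^sub>R B)) 0 x" for x
        using sym_deriv2_diff[OF ws sym_deriv2_affine] by simp
    qed
    from this[of 0] this[of 1] this[of x] show ?thesis
      by (auto simp: c_def d_def b_def algebra_simps)
  qed
  show ?thesis
  proof (rule that)
    have "u x = w 0 + x *\<^sub>R b + W x" for x unfolding w[of x, symmetric] by (simp add: w_def)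
    then have eq: "u = (\<lambda>x. w 0 + x *\<^sub>R b + W x)" by blast
    show "(u has_vector_derivative b + V x) (at x)" for x
    proof -
      have "((\<lambda>x. w 0 + x *\<^sub>R b + W x) has_vector_derivative 0 + (x *\<^sub>R 0 + 1 *\<^sub>R b) + V x) (at x)"
        by (intro has_vector_derivative_add has_vector_derivative_const has_vector_derivative_scaleR DERIV_ident W)
      then show ?thesis by (simp add: eq[symmetric])
    qed
    show "((\<lambda>x. b + V x) has_vector_derivative v x) (at x)" for x
      using has_vector_derivative_add[OF has_vector_derivative_const V] by simp
  qed
qed

text \<open>The generator of a semigroup sees right quotients only, so constancy has to follow from
  a right derivative. The points obeying the slope bound
  \<open>norm (f x - f a) \<le> e * (x - a)\<close> form a compact set; if its last point lay before
  \<open>b\<close>, the right quotient there would carry the bound further.\<close>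

lemma zero_right_derivative_imp_eq:
  fixes f :: "real \<Rightarrow> 'a::real_normed_vector"
  assumes ab: "a \<le> b" and cont: "continuous_on {a..b} f"
    and f: "\<And>x. a \<le> x \<Longrightarrow> x < b \<Longrightarrow> ((\<lambda>h. (1 / h) *\<^sub>R (f (x + h) - f x)) \<longlongrightarrow> 0) (at_right 0)"
  shows "f b = f a"
proof -
  have "norm (f b - f a) \<le> e * (b - a)" if e: "e > 0" for e
  proof (rule ccontr)
    assume nb: "\<not> norm (f b - f a) \<le> e * (b - a)"
    define S where "S = {x \<in> {a..b}. norm (f x - f a) - e * (x - a) \<le> 0}"
    have "S = {a..b} \<inter> (\<lambda>x. norm (f x - f a) - e * (x - a)) -` {..0}" by (auto simp: S_def)
    moreover have "closed ({a..b} \<inter> (\<lambda>x. norm (f x - f a) - e * (x - a)) -` {..0})"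
      by (intro continuous_closed_preimage continuous_intros cont closed_atMost closed_atLeastAtMost)
    ultimately have "closed S" by (simp only:)
    moreover have "S \<subseteq> {a..b}" by (auto simp: S_def)
    ultimately have "compact S" by (meson bounded_closed_interval bounded_subset compact_eq_bounded_closed)
    moreover have "a \<in> S" using ab by (simp add: S_def)
    ultimately obtain c where c: "c \<in> S" "\<And>x. x \<in> S \<Longrightarrow> x \<le> c"
      using compact_attains_sup[of S] by blast
    have "c \<noteq> b" using c nb by (auto simp: S_def)
    then have cb: "a \<le> c" "c < b" using c(1) by (auto simp: S_def)
    have "eventually (\<lambda>h. norm ((1 / h) *\<^sub>R (f (c + h) - f c)) < e) (at_right 0)"
      using tendstoD[OF f[OF cb] e] by (simp add: dist_norm)
    moreover have "eventually (\<lambda>h. h < b - c) (at_right 0)"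
      using cb by (intro order_tendstoD(2)[OF tendsto_ident_at]) simp
    moreover have "eventually (\<lambda>h::real. h > 0) (at_right 0)" by (simp add: eventually_at_right_less)
    ultimately have "eventually (\<lambda>h::real. False) (at_right 0)"
    proof eventually_elim
      case (elim h)
      have "norm (f (c + h) - f c) \<le> e * h" using elim by (simp add: divide_simps split: if_splits)
      moreover have "norm (f c - f a) \<le> e * (c - a)" using c(1) by (simp add: S_def)
      moreover have "norm (f (c + h) - f a) \<le> norm (f (c + h) - f c) + norm (f c - f a)"
        using norm_triangle_ineq[of "f (c + h) - f c" "f c - f a"] by simp
      ultimately have "c + h \<in> S" using elim cb by (simp add: S_def algebra_simps)
      then show False using c(2) elim by fastforce
    qed
    then show False by simp
  qed
  note * = this
  have "norm (f b - f a) \<le> 0 + e" if "e > 0" for e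
    using *[of "e / (b - a)"] that ab by (cases "a = b") auto
  then have "norm (f b - f a) \<le> 0" by (rule field_le_epsilon)
  then show ?thesis by simp
qed

section \<open>Cosine families\<close>

lemma has_vector_derivative_iff_difference_quotient:
  fixes f :: "real \<Rightarrow> 'a::real_normed_vector"
  shows "(f has_vector_derivative d) (at x within S) \<longleftrightarrow>
    ((\<lambda>y. (1 / (y - x)) *\<^sub>R (f y - f x)) \<longlongrightarrow> d) (at x within S)"
proof -
  have "norm ((f y - f x - (y - x) *\<^sub>R d) /\<^sub>R norm (y - x)) = norm ((1 / (y - x)) *\<^sub>R (f y - f x) - d)"
    if "y \<noteq> x" for y
  proof -
    have "(1 / (y - x)) *\<^sub>R (f y - f x) - d = (1 / (y - x)) *\<^sub>R (f y - f x - (y - x) *\<^sub>R d)"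
      using that by (simp add: scaleR_diff_right)
    then show ?thesis by (simp add: divide_inverse)
  qed
  then have ev: "eventually (\<lambda>y. norm ((f y - f x - (y - x) *\<^sub>R d) /\<^sub>R norm (y - x))
      = norm ((1 / (y - x)) *\<^sub>R (f y - f x) - d)) (at x within S)"
    by (simp add: eventually_at_filter)
  have "(f has_vector_derivative d) (at x within S) \<longleftrightarrow>
      ((\<lambda>y. (f y - f x - (y - x) *\<^sub>R d) /\<^sub>R norm (y - x)) \<longlongrightarrow> 0) (at x within S)"
    by (auto simp: has_vector_derivative_def has_derivative_at_within bounded_linear_scaleR_left)
  also have "\<dots> \<longleftrightarrow> ((\<lambda>y. (1 / (y - x)) *\<^sub>R (f y - f x) - d) \<longlongrightarrow> 0) (at x within S)"
    by (subst (1 2) tendsto_norm_zero_iff[symmetric]) (rule tendsto_cong[OF ev])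
  finally show ?thesis by (simp add: LIM_zero_iff)
qed

text \<open>Product rule for \<open>B\<close> differentiable only strongly, on the single vector
  \<open>u x\<close>. As \<open>B\<close> need not be continuous in norm, it is the uniform bound
  \<open>M\<close> that sends \<open>B y (q y - u')\<close> to 0.\<close>

lemma has_vector_derivative_blinfun_apply:
  fixes B :: "real \<Rightarrow> 'a::real_normed_vector \<Rightarrow>\<^sub>L 'b::real_normed_vector"
  assumes M: "\<And>s. s \<in> S \<Longrightarrow> norm (B s) \<le> M"
    and B: "((\<lambda>s. B s (u x)) has_vector_derivative b) (at x within S)"
    and u: "(u has_vector_derivative u') (at x within S)"
    and c: "((\<lambda>s. B s u') \<longlongrightarrow> B x u') (at x within S)"
  shows "((\<lambda>s. B s (u s)) has_vector_derivative b + B x u') (at x within S)"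
proof -
  define q where "q y = (1 / (y - x)) *\<^sub>R (u y - u x)" for y
  have q: "((\<lambda>y. q y - u') \<longlongrightarrow> 0) (at x within S)"
    using u unfolding has_vector_derivative_iff_difference_quotient q_def by (simp add: LIM_zero)
  have "((\<lambda>y. B y (q y - u')) \<longlongrightarrow> 0) (at x within S)"
  proof (rule Lim_null_comparison)
    have "norm (B y (q y - u')) \<le> M * norm (q y - u')" if "y \<in> S" for y
      using norm_blinfun[of "B y" "q y - u'"] M[OF that] mult_right_mono[of "norm (B y)" M "norm (q y - u')"]
      by simp
    then show "eventually (\<lambda>y. norm (B y (q y - u')) \<le> M * norm (q y - u')) (at x within S)"
      by (auto simp: eventually_at_filter)
    show "((\<lambda>y. M * norm (q y - u')) \<longlongrightarrow> 0) (at x within S)"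
      using tendsto_mult_right_zero[OF tendsto_norm_zero[OF q]] by simp
  qed
  from tendsto_add[OF tendsto_add[OF this c] B[unfolded has_vector_derivative_iff_difference_quotient]]
  have lim: "((\<lambda>y. B y (q y - u') + B y u' + (1 / (y - x)) *\<^sub>R (B y (u x) - B x (u x)))
      \<longlongrightarrow> b + B x u') (at x within S)" by (simp add: add.commute)
  have "B y (q y - u') + B y u' + (1 / (y - x)) *\<^sub>R (B y (u x) - B x (u x))
      = (1 / (y - x)) *\<^sub>R (B y (u y) - B x (u x))" for y
    by (simp add: q_def blinfun.bilinear_simps algebra_simps)
  then show ?thesis using lim unfolding has_vector_derivative_iff_difference_quotient by simp
qed

section \<open>Algebra of cosine families and their generators\<close>

lemma cosine_family_0: "cosine_family C \<Longrightarrow> C 0 f = f"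
  by (simp add: cosine_family_def)

lemma cosine_family_mult:
  assumes "cosine_family C"
  shows "2 *\<^sub>R C t (C s f) = C (t + s) f + C (t - s) f"
proof -
  have "2 *\<^sub>R (C t o\<^sub>L C s) = C (t + s) + C (t - s)" using assms by (simp add: cosine_family_def)
  then have "blinfun_apply (2 *\<^sub>R (C t o\<^sub>L C s)) f = blinfun_apply (C (t + s) + C (t - s)) f" by simp
  then show ?thesis by (simp add: blinfun.bilinear_simps)
qed

lemma cosine_family_minus:
  assumes "cosine_family C"
  shows "C (- t) f = C t f"
  using cosine_family_mult[OF assms, of 0 t f] by (simp add: cosine_family_0[OF assms] scaleR_2)

lemma cosine_family_commute:
  assumes "cosine_family C"
  shows "C t (C s f) = C s (C t f)"
proof -
  have "2 *\<^sub>R C t (C s f) = 2 *\<^sub>R C s (C t f)"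
    using cosine_family_mult[OF assms, of t s f] cosine_family_mult[OF assms, of s t f]
      cosine_family_minus[OF assms, of "t - s" f] by (simp add: add.commute)
  then show ?thesis by simp
qed

lemma cosine_family_continuous: "cosine_family C \<Longrightarrow> continuous_on UNIV (\<lambda>t. C t f)"
  by (simp add: cosine_family_def)

lemma cosine_generator_iff:
  assumes C: "cosine_family C"
  shows "(f, g) \<in> cosine_generator C \<longleftrightarrow> ((\<lambda>h. (2 / h\<^sup>2) *\<^sub>R (C h f - f)) \<longlongrightarrow> g) (at_right 0)"
  using cosine_family_minus[OF C]
  by (simp add: cosine_generator_def filterlim_at_split filterlim_at_left_to_right)

lemma cosine_generator_iff_sym_deriv2:
  assumes C: "cosine_family C"
  shows "(f, g) \<in> cosine_generator C \<longleftrightarrow> sym_deriv2 (\<lambda>t. C t f) g 0"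
  unfolding cosine_generator_iff[OF C] sym_deriv2_def
  by (simp add: cosine_family_minus[OF C] cosine_family_0[OF C] scaleR_2[symmetric]
      scaleR_diff_right[symmetric])

lemma cosine_generator_invariant:
  assumes C: "cosine_family C" and fg: "(f, g) \<in> cosine_generator C"
  shows "(C t f, C t g) \<in> cosine_generator C"
proof -
  have "((\<lambda>h. C t ((2 / h\<^sup>2) *\<^sub>R (C h f - f))) \<longlongrightarrow> C t g) (at_right 0)"
    using fg unfolding cosine_generator_iff[OF C] by (intro tendsto_intros)
  then show ?thesis unfolding cosine_generator_iff[OF C]
    by (simp add: blinfun.bilinear_simps cosine_family_commute[OF C, of _ t])
qed

text \<open>\<open>C t\<close> applied to the generator quotient is the symmetric second quotient of
  the orbit at \<open>t\<close>, so Schwarz's theorem applies to the orbit. The orbit is even in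
  time, which forces \<open>U 0 = 0\<close>.\<close>

lemma cosine_generator_imp_C2:
  fixes C :: "real \<Rightarrow> 'a::banach \<Rightarrow>\<^sub>L 'a"
  assumes C: "cosine_family C" and fg: "(f, g) \<in> cosine_generator C"
  obtains U where "\<And>t. ((\<lambda>t. C t f) has_vector_derivative U t) (at t)"
    "\<And>t. (U has_vector_derivative C t g) (at t)" "U 0 = 0"
proof -
  have "sym_deriv2 (\<lambda>t. C t f) (C t g) t" for t
  proof -
    have "((\<lambda>h. C t ((2 / h\<^sup>2) *\<^sub>R (C h f - f))) \<longlongrightarrow> C t g) (at_right 0)"
      using fg unfolding cosine_generator_iff[OF C] by (intro tendsto_intros)
    moreover have "C t ((2 / h\<^sup>2) *\<^sub>R (C h f - f)) = (1 / h\<^sup>2) *\<^sub>R (C (t + h) f + C (t - h) f - 2 *\<^sub>R C t f)" for h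
      unfolding cosine_family_mult[OF C, symmetric] by (simp add: blinfun.bilinear_simps algebra_simps)
    ultimately show ?thesis unfolding sym_deriv2_def by simp
  qed
  then obtain U where U: "\<And>t. ((\<lambda>t. C t f) has_vector_derivative U t) (at t)"
    "\<And>t. (U has_vector_derivative C t g) (at t)"
    using sym_deriv2_imp_C2[OF cosine_family_continuous[OF C] cosine_family_continuous[OF C]] by blast
  have m: "((\<lambda>s. - s) has_vector_derivative - 1) (at (0::real))"
    by (auto intro!: derivative_eq_intros simp: has_real_derivative_iff_has_vector_derivative[symmetric])
  have "((\<lambda>t. C (- t) f) has_vector_derivative - U 0) (at 0)"
    using vector_diff_chain_at[OF m, of "\<lambda>t. C t f" "U 0"] U(1)[of 0] by (simp add: o_def)
  then have "((\<lambda>t. C t f) has_vector_derivative - U 0) (at 0)" by (simp add: cosine_family_minus[OF C])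
  then have "- U 0 = U 0" using vector_derivative_unique_at[OF _ U(1)[of 0]] by blast
  then have "2 *\<^sub>R U 0 = 0" by (metis scaleR_2 add.right_inverse)
  then have "U 0 = 0" by simp
  with U that show ?thesis by blast
qed

lemma norm_rescaled_diff_le:
  fixes w k :: "'a::real_normed_vector"
  assumes h: "h \<noteq> 0" and le: "norm (2 *\<^sub>R w - h\<^sup>2 *\<^sub>R k) \<le> \<eta> * h\<^sup>2"
  shows "norm ((2 / h\<^sup>2) *\<^sub>R w - k) \<le> \<eta>"
proof -
  have eq: "(2 / h\<^sup>2) *\<^sub>R w - k = (1 / h\<^sup>2) *\<^sub>R (2 *\<^sub>R w - h\<^sup>2 *\<^sub>R k)"
    unfolding scaleR_diff_right scaleR_scaleR using h by simp
  show ?thesis unfolding eq norm_scaleR using le h by (simp add: pos_divide_le_eq)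
qed

text \<open>The quotient is controlled by the orbit of \<open>g\<close> on
  \<open>[-|h|, |h|]\<close> alone, so the estimate is uniform over all pairs of the graph whose
  second components are close.\<close>

lemma cosine_generator_quotient_bound:
  fixes C :: "real \<Rightarrow> 'a::banach \<Rightarrow>\<^sub>L 'a"
  assumes C: "cosine_family C" and fg: "(f, g) \<in> cosine_generator C"
    and k: "\<And>s. \<bar>s\<bar> \<le> \<bar>h\<bar> \<Longrightarrow> norm (C s g - k) \<le> \<eta>" and h: "h \<noteq> 0"
  shows "norm ((2 / h\<^sup>2) *\<^sub>R (C h f - f) - k) \<le> \<eta>"
proof (rule norm_rescaled_diff_le[OF h])
  obtain U where U: "\<And>t. ((\<lambda>t. C t f) has_vector_derivative U t) (at t)"
    "\<And>t. (U has_vector_derivative C t g) (at t)" "U 0 = 0"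
    by (rule cosine_generator_imp_C2[OF C fg], rule that)
  have k': "norm (C s g - k) \<le> \<eta>" if "\<bar>s - 0\<bar> \<le> \<bar>h\<bar>" for s
    using that by (intro k) simp
  have eq: "C (0 + h) f + C (0 - h) f - 2 *\<^sub>R C 0 f = 2 *\<^sub>R (C h f - f)"
    by (simp add: cosine_family_minus[OF C] cosine_family_0[OF C] scaleR_2)
  show "norm (2 *\<^sub>R (C h f - f) - h\<^sup>2 *\<^sub>R k) \<le> \<eta> * h\<^sup>2"
    unfolding eq[symmetric] by (rule C2_second_difference_bound[OF U(1,2) k'])
qed

text \<open>For fixed \<open>h\<close> the quotient bound passes to the limit in \<open>n\<close>,
  and only then \<open>h\<close> tends to 0. The bound \<open>M\<close> keeps
  \<open>C s (G n - g)\<close> small for all \<open>s\<close> at once.\<close>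

lemma cosine_generator_closed:
  fixes C :: "real \<Rightarrow> 'a::banach \<Rightarrow>\<^sub>L 'a"
  assumes C: "cosine_family C" and M: "\<And>t. norm (C t) \<le> M"
    and fg: "\<And>n. (F n, G n) \<in> cosine_generator C" and F: "F \<longlonglongrightarrow> f" and G: "G \<longlonglongrightarrow> g"
  shows "(f, g) \<in> cosine_generator C"
  unfolding cosine_generator_iff[OF C]
proof (rule tendstoI)
  fix e :: real assume e: "e > 0"
  have "isCont (\<lambda>t. C t g) 0"
    using cosine_family_continuous[OF C, of g] by (simp add: continuous_on_eq_continuous_at)
  then have "\<exists>d>0. \<forall>s. norm (s - 0) < d \<longrightarrow> norm (C s g - C 0 g) < e / 2"
    unfolding continuous_at_eps_delta dist_norm using e by (meson half_gt_zero)
  then obtain d where d: "d > 0" "\<And>s. \<bar>s\<bar> < d \<Longrightarrow> norm (C s g - g) < e / 2"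
    by (auto simp: cosine_family_0[OF C])
  have le: "norm ((2 / h\<^sup>2) *\<^sub>R (C h f - f) - g) \<le> e / 2" if h: "0 < h" "h < d" for h
  proof -
    have *: "norm ((2 / h\<^sup>2) *\<^sub>R (C h (F n) - F n) - g) \<le> M * norm (G n - g) + e / 2" for n
    proof (rule cosine_generator_quotient_bound[OF C fg])
      fix s assume "\<bar>s\<bar> \<le> \<bar>h\<bar>"
      then have "norm (C s g - g) < e / 2" using d(2) h by simp
      moreover have "norm (C s (G n - g)) \<le> M * norm (G n - g)"
        using norm_blinfun[of "C s" "G n - g"] M[of s] mult_right_mono[of "norm (C s)" M "norm (G n - g)"]
        by simp
      moreover have eq: "C s (G n) - g = C s (G n - g) + (C s g - g)" by (simp add: blinfun.bilinear_simps)
      ultimately show "norm (C s (G n) - g) \<le> M * norm (G n - g) + e / 2"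
        unfolding eq using norm_triangle_ineq[of "C s (G n - g)" "C s g - g"] by linarith
    qed (use h in simp)
    have l: "(\<lambda>n. norm ((2 / h\<^sup>2) *\<^sub>R (C h (F n) - F n) - g)) \<longlonglongrightarrow> norm ((2 / h\<^sup>2) *\<^sub>R (C h f - f) - g)"
      by (intro tendsto_intros F)
    have r: "(\<lambda>n. M * norm (G n - g) + e / 2) \<longlonglongrightarrow> M * norm (g - g) + e / 2"
      by (intro tendsto_intros G)
    show ?thesis using LIMSEQ_le[OF l r] * by auto
  qed
  have "eventually (\<lambda>h. h < d) (at_right 0)"
    using d(1) by (intro order_tendstoD(2)[OF tendsto_ident_at])
  moreover have "eventually (\<lambda>h::real. h > 0) (at_right 0)" by (simp add: eventually_at_right_less)
  ultimately show "eventually (\<lambda>h. dist ((2 / h\<^sup>2) *\<^sub>R (C h f - f)) g < e) (at_right 0)"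
  proof eventually_elim
    case (elim h)
    then show ?case using le[of h] e unfolding dist_norm by linarith
  qed
qed

lemma cosine_generator_add:
  assumes "(f, g) \<in> cosine_generator C" "(f', g') \<in> cosine_generator C"
  shows "(f + f', g + g') \<in> cosine_generator C"
  using tendsto_add[of _ g _ _ g'] assms unfolding cosine_generator_def
  by (force simp: blinfun.bilinear_simps algebra_simps)

lemma cosine_generator_scaleR:
  assumes "(f, g) \<in> cosine_generator C"
  shows "(c *\<^sub>R f, c *\<^sub>R g) \<in> cosine_generator C"
  using tendsto_scaleR[OF tendsto_const[of c], of _ g] assms unfolding cosine_generator_def
  by (force simp: blinfun.bilinear_simps algebra_simps)

text \<open>The double integral \<open>F\<close> of \<open>C(t) f\<close> takes values in the domain, and
  \<open>h\<^sup>-\<^sup>2 (F(h) + F(-h))\<close> tends to \<open>f\<close>.\<close>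

lemma cosine_generator_dense:
  fixes C :: "real \<Rightarrow> 'a::banach \<Rightarrow>\<^sub>L 'a"
  assumes C: "cosine_family C"
  obtains X Y where "\<And>n. (X n, Y n) \<in> cosine_generator C" "X \<longlonglongrightarrow> f"
proof -
  obtain S where S: "\<And>t. (S has_vector_derivative C t f) (at t)" "S 0 = 0"
    using antiderivative_at_0[OF cosine_family_continuous[OF C]] by blast
  obtain F where F: "\<And>t. (F has_vector_derivative S t) (at t)" "F 0 = 0"
    using antiderivative_at_0[OF has_vector_derivative_imp_continuous_UNIV[OF S(1)]] by blast
  have shift: "((\<lambda>t. G (t + h)) has_vector_derivative g (t + h)) (at t)"
    if "\<And>t. (G has_vector_derivative g t) (at t)" for G g :: "real \<Rightarrow> 'a" and t h
  proof -
    have "((\<lambda>s. s + h) has_vector_derivative 1 + 0) (at t)"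
      by (intro has_vector_derivative_add has_vector_derivative_const has_vector_derivative_id)
    then show ?thesis using vector_diff_chain_at[OF _ that, of "\<lambda>s. s + h" "1 + 0" t] by (simp add: o_def)
  qed
  have neg: "((\<lambda>t. G (- t)) has_vector_derivative - g (- t)) (at t)"
    if "\<And>t. (G has_vector_derivative g t) (at t)" for G g :: "real \<Rightarrow> 'a" and t
  proof -
    have "((\<lambda>s. - s) has_vector_derivative - 1) (at t)"
      by (auto intro!: derivative_eq_intros simp: has_real_derivative_iff_has_vector_derivative[symmetric])
    then show ?thesis using vector_diff_chain_at[OF _ that, of "\<lambda>s. - s" "- 1" t] by (simp add: o_def)
  qed
  have const: "G t = G 0" if "\<And>t. (G has_vector_derivative 0) (at t)" for G :: "real \<Rightarrow> 'a" and t
    using has_vector_derivative_zero_constant[of UNIV G] that by (metis UNIV_I convex_UNIV)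
  have Sodd: "S h + S (- h) = 0" for h
    using const[of "\<lambda>h. S h + S (- h)" h] has_vector_derivative_add[OF S(1) neg[OF S(1)]] S(2)
    by (simp add: cosine_family_minus[OF C])
  \<comment> \<open>Both sides of \<open>CS\<close>, and of \<open>CF\<close> below, have the same
    derivative in \<open>t\<close>; the constant is read off at \<open>t = 0\<close>. For
    \<open>CF\<close> this leaves the term \<open>F h + F (- h)\<close>, which is the source of
    \<open>- f\<close> in the generator value \<open>C t f - f\<close>.\<close>
  have CS: "2 *\<^sub>R C h (S t) = S (t + h) + S (t - h)" for h t
  proof -
    have "((\<lambda>t. 2 *\<^sub>R C h (S t) - (S (t + h) + S (t + - h))) has_vector_derivative
        2 *\<^sub>R C h (C t f) - (C (t + h) f + C (t + - h) f)) (at t)" for t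
      by (intro has_vector_derivative_diff has_vector_derivative_add shift S(1)
          bounded_linear.has_vector_derivative[OF bounded_linear_scaleR_right]
          bounded_linear.has_vector_derivative[OF blinfun.bounded_linear_right])
    moreover have "2 *\<^sub>R C h (C t f) - (C (t + h) f + C (t + - h) f) = 0" for t
      using cosine_family_mult[OF C, of t h f] cosine_family_commute[OF C, of h t f] by simp
    ultimately have "2 *\<^sub>R C h (S t) - (S (t + h) + S (t + - h))
        = 2 *\<^sub>R C h (S 0) - (S (0 + h) + S (0 + - h))" by (intro const) simp
    then show ?thesis using Sodd[of h] by (simp add: S(2) blinfun.bilinear_simps)
  qed
  have CF: "2 *\<^sub>R C h (F t) = F (t + h) + F (t - h) - (F h + F (- h))" for h t
  proof -
    have "((\<lambda>t. 2 *\<^sub>R C h (F t) - (F (t + h) + F (t + - h))) has_vector_derivative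
        2 *\<^sub>R C h (S t) - (S (t + h) + S (t + - h))) (at t)" for t
      by (intro has_vector_derivative_diff has_vector_derivative_add shift F(1)
          bounded_linear.has_vector_derivative[OF bounded_linear_scaleR_right]
          bounded_linear.has_vector_derivative[OF blinfun.bounded_linear_right])
    then have "2 *\<^sub>R C h (F t) - (F (t + h) + F (t + - h))
        = 2 *\<^sub>R C h (F 0) - (F (0 + h) + F (0 + - h))" by (intro const) (simp add: CS)
    then show ?thesis by (simp add: F(2) blinfun.bilinear_simps algebra_simps)
  qed
  have iC: "isCont (\<lambda>t. C t f) t" for t
    using cosine_family_continuous[OF C] by (simp add: continuous_on_eq_continuous_at)
  have F0: "((\<lambda>h. (1 / h\<^sup>2) *\<^sub>R (F h + F (- h))) \<longlongrightarrow> f) (at_right 0)"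
    using sym_deriv2_C2[OF F(1) S(1) iC, of 0] by (simp add: sym_deriv2_def F(2) cosine_family_0[OF C])
  have dom: "(F t, C t f - f) \<in> cosine_generator C" for t
  proof -
    have "((\<lambda>h. (1 / h\<^sup>2) *\<^sub>R (F (t + h) + F (t - h) - 2 *\<^sub>R F t) - (1 / h\<^sup>2) *\<^sub>R (F h + F (- h)))
        \<longlongrightarrow> C t f - f) (at_right 0)"
      using sym_deriv2_C2[OF F(1) S(1) iC, of t] unfolding sym_deriv2_def by (intro tendsto_diff F0)
    moreover have "(1 / h\<^sup>2) *\<^sub>R (F (t + h) + F (t - h) - 2 *\<^sub>R F t) - (1 / h\<^sup>2) *\<^sub>R (F h + F (- h))
        = (2 / h\<^sup>2) *\<^sub>R (C h (F t) - F t)" for h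
    proof -
      have "(2 / h\<^sup>2) *\<^sub>R (C h (F t) - F t) = (1 / h\<^sup>2) *\<^sub>R (2 *\<^sub>R C h (F t) - 2 *\<^sub>R F t)"
        by (simp add: algebra_simps)
      then show ?thesis by (simp add: CF algebra_simps)
    qed
    ultimately show ?thesis unfolding cosine_generator_iff[OF C] by simp
  qed
  define h where "h n = 1 / real (Suc n)" for n
  have "filterlim h (at_right 0) sequentially"
    unfolding h_def filterlim_at using LIMSEQ_inverse_real_of_nat
    by (auto simp: inverse_eq_divide)
  then have "(\<lambda>n. (1 / (h n)\<^sup>2) *\<^sub>R (F (h n) + F (- h n))) \<longlonglongrightarrow> f"
    using filterlim_compose[OF F0] by blast
  then show ?thesis
    by (rule that[OF cosine_generator_scaleR[OF cosine_generator_add[OF dom dom]]])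
qed

lemma blinfun_eqI_dense:
  fixes A B :: "'a::real_normed_vector \<Rightarrow>\<^sub>L 'b::real_normed_vector"
  assumes "\<And>x. \<exists>X. (\<forall>n::nat. X n \<in> D) \<and> X \<longlonglongrightarrow> x" "\<And>x. x \<in> D \<Longrightarrow> A x = B x"
  shows "A = B"
proof (rule blinfun_eqI)
  fix x
  obtain X where X: "\<And>n::nat. X n \<in> D" "X \<longlonglongrightarrow> x" using assms(1)[of x] by blast
  have "(\<lambda>n. A (X n)) \<longlonglongrightarrow> A x" "(\<lambda>n. B (X n)) \<longlonglongrightarrow> B x" by (intro tendsto_intros X(2))+
  then show "A x = B x" using assms(2)[OF X(1)] LIMSEQ_unique by simp
qed

text \<open>Uniqueness: with \<open>S\<close> the sine family of \<open>C\<close> and \<open>u(s) = C'(s) f\<close>, the function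
  \<open>C(t-s) u(s) + S(t-s) u'(s)\<close> has derivative \<open>0\<close> on \<open>[0,t]\<close>.\<close>

lemma cosine_family_unique_nonneg:
  fixes C C' :: "real \<Rightarrow> 'a::banach \<Rightarrow>\<^sub>L 'a"
  assumes C: "cosine_family C" and C': "cosine_family C'" and M: "\<And>t. norm (C t) \<le> M"
    and gen: "cosine_generator C' = cosine_generator C"
    and fg: "(f, g) \<in> cosine_generator C" and t: "t \<ge> 0"
  shows "C' t f = C t f"
proof -
  \<comment> \<open>For \<open>r < 0\<close> the interval is empty and the integral is 0, so this is
    the sine family only for \<open>r \<ge> 0\<close>; the argument \<open>t - s\<close> stays in
    that range.\<close>
  define S where "S r = Blinfun (\<lambda>x. integral {0..r} (\<lambda>s. C s x))" for r
  have int: "(\<lambda>s. C s x) integrable_on {a..b}" for a b x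
    by (intro integrable_continuous_real continuous_on_subset[OF cosine_family_continuous[OF C]]) simp
  have Sb: "norm (integral {0..r} (\<lambda>s. C s x)) \<le> M * r * norm x" if "r \<ge> 0" for r x
  proof -
    have "norm (integral {0..r} (\<lambda>s. C s x)) \<le> integral {0..r} (\<lambda>s. M * norm x)"
      by (intro Henstock_Kurzweil_Integration.integral_norm_bound_integral int)
        (auto intro!: order_trans[OF norm_blinfun] mult_right_mono M)
    then show ?thesis using that by (simp add: mult_ac)
  qed
  have S: "S r x = integral {0..r} (\<lambda>s. C s x)" if "r \<ge> 0" for r x
  proof -
    have "bounded_linear (\<lambda>x. integral {0..r} (\<lambda>s. C s x))"
      by (rule bounded_linear_intro[of _ "M * r"])
        (use Sb[OF that] in \<open>auto simp: blinfun.bilinear_simps Henstock_Kurzweil_Integration.integral_add[OF int int] mult.commute\<close>)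
    then show ?thesis by (simp add: S_def bounded_linear_Blinfun_apply)
  qed
  have Mn: "0 \<le> M" using M[of 0] norm_ge_zero order_trans by blast
  have Sn: "norm (S r) \<le> M * t" if "0 \<le> r" "r \<le> t" for r
  proof (rule norm_blinfun_bound)
    show "norm (S r x) \<le> M * t * norm x" for x
      using Sb[OF that(1), of x] that Mn mult_right_mono[of "M * r" "M * t" "norm x"]
      by (simp add: S[OF that(1)] mult_left_mono)
  qed (use Mn t in simp)
  have refl: "((\<lambda>s. t - s) has_vector_derivative - 1) (at s within X)" for s X
  proof -
    have "((\<lambda>s. t - s) has_vector_derivative 0 - 1) (at s within X)"
      by (intro has_vector_derivative_diff has_vector_derivative_const has_vector_derivative_id)
    then show ?thesis by simp
  qed
  have im: "(\<lambda>s. t - s) ` {0..t} = {0..t}"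
    by (auto simp: image_iff intro!: bexI[of _ "t - _"])
  have dS: "((\<lambda>s. S (t - s) x) has_vector_derivative - C (t - s) x) (at s within {0..t})"
    if "s \<in> {0..t}" for s x
  proof -
    have "((\<lambda>r. integral {0..r} (\<lambda>s. C s x)) has_vector_derivative C (t - s) x) (at (t - s) within {0..t})"
      using that by (intro integral_has_vector_derivative continuous_on_subset[OF cosine_family_continuous[OF C]]) auto
    then have "((\<lambda>s. integral {0..t - s} (\<lambda>s. C s x)) has_vector_derivative - C (t - s) x) (at s within {0..t})"
      using vector_diff_chain_within[OF refl[of s "{0..t}"], of "\<lambda>r. integral {0..r} (\<lambda>s. C s x)" "C (t - s) x"]
      by (simp add: o_def im)
    then show ?thesis
      by (rule has_vector_derivative_transform[OF that, rotated]) (use S in simp)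
  qed
  have dC: "((\<lambda>s. C (t - s) y) has_vector_derivative - S (t - s) z) (at s within {0..t})"
    if s: "s \<in> {0..t}" and yz: "(y, z) \<in> cosine_generator C" for s y z
  proof -
    obtain U where U: "\<And>t. ((\<lambda>t. C t y) has_vector_derivative U t) (at t)"
      "\<And>t. (U has_vector_derivative C t z) (at t)" "U 0 = 0"
      by (rule cosine_generator_imp_C2[OF C yz], rule that)
    have "((\<lambda>r. C r z) has_integral (U (t - s) - U 0)) {0..t - s}"
      using s by (intro fundamental_theorem_of_calculus has_vector_derivative_at_within[OF U(2)]) simp
    then have "U (t - s) = S (t - s) z" using s U(3) by (simp add: S has_integral_iff)
    moreover have "((\<lambda>s. C (t - s) y) has_vector_derivative - U (t - s)) (at s within {0..t})"
      using vector_diff_chain_within[OF refl[of s "{0..t}"], of "\<lambda>r. C r y" "U (t - s)"]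
        has_vector_derivative_at_within[OF U(1)] by (simp add: o_def)
    ultimately show ?thesis by simp
  qed
  have fg': "(f, g) \<in> cosine_generator C'" using fg gen by simp
  obtain U where U: "\<And>t. ((\<lambda>t. C' t f) has_vector_derivative U t) (at t)"
    "\<And>t. (U has_vector_derivative C' t g) (at t)" "U 0 = 0"
    by (rule cosine_generator_imp_C2[OF C' fg'], rule that)
  define W where "W s = C (t - s) (C' s f) + S (t - s) (U s)" for s
  have "(W has_vector_derivative 0) (at s within {0..t})" if s: "s \<in> {0..t}" for s
  proof -
    have "(C' s f, C' s g) \<in> cosine_generator C"
      using cosine_generator_invariant[OF C' fg'] gen by simp
    note 1 = dC[OF s this]
    have "((\<lambda>s. C (t - s) (U s0)) \<longlongrightarrow> C (t - s) (U s0)) (at s within {0..t})" for s0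
    proof (rule isCont_tendsto_compose[where g = "\<lambda>r. C r (U s0)"])
      show "isCont (\<lambda>r. C r (U s0)) (t - s)"
        using cosine_family_continuous[OF C] by (simp add: continuous_on_eq_continuous_at)
    qed (intro tendsto_intros)
    then have a: "((\<lambda>s. C (t - s) (C' s f)) has_vector_derivative - S (t - s) (C' s g) + C (t - s) (U s))
        (at s within {0..t})"
      by (intro has_vector_derivative_blinfun_apply[OF M 1 has_vector_derivative_at_within[OF U(1)]])
    have "((\<lambda>s. S (t - s) (U s)) has_vector_derivative - C (t - s) (U s) + S (t - s) (C' s g))
        (at s within {0..t})"
    proof (rule has_vector_derivative_blinfun_apply[OF _ dS[OF s] has_vector_derivative_at_within[OF U(2)]])
      show "norm (S (t - r)) \<le> M * t" if "r \<in> {0..t}" for r using Sn that by simp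
      show "((\<lambda>r. S (t - r) (C' s g)) \<longlongrightarrow> S (t - s) (C' s g)) (at s within {0..t})"
        using has_vector_derivative_continuous[OF dS[OF s]] by (simp add: continuous_within)
    qed
    from has_vector_derivative_add[OF a this] show ?thesis by (simp add: W_def[abs_def])
  qed
  then obtain c where "\<And>s. s \<in> {0..t} \<Longrightarrow> W s = c"
    using has_vector_derivative_zero_constant[of "{0..t}" W] by auto
  then have "W 0 = W t" using t by simp
  then show ?thesis
    by (simp add: W_def U(3) S cosine_family_0[OF C] cosine_family_0[OF C'] blinfun.bilinear_simps)
qed

text \<open>The description ranges over all cosine families, bounded or not. In the uniqueness
  argument only \<open>C\<close> and its sine family act on a moving vector, so a bound on
  \<open>C\<close> alone is enough; agreement on the dense domain and evenness in time finish the
  comparison.\<close>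

theorem generated_cosine_eq:
  fixes C :: "real \<Rightarrow> 'a::banach \<Rightarrow>\<^sub>L 'a"
  assumes C: "cosine_family C" and M: "\<And>t. norm (C t) \<le> M"
  shows "generated_cosine (cosine_generator C) = C"
  unfolding generated_cosine_def
proof (rule the_equality)
  fix C' assume "cosine_family C' \<and> cosine_generator C' = cosine_generator C"
  then have C': "cosine_family C'" and gen: "cosine_generator C' = cosine_generator C" by auto
  show "C' = C"
  proof
    fix t
    show "C' t = C t"
    proof (rule blinfun_eqI_dense[of "Domain (cosine_generator C)"])
      show "\<exists>X. (\<forall>n::nat. X n \<in> Domain (cosine_generator C)) \<and> X \<longlonglongrightarrow> x" for x
        using cosine_generator_dense[OF C, of x] by (metis DomainI)
      fix x assume "x \<in> Domain (cosine_generator C)"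
      then obtain y where "(x, y) \<in> cosine_generator C" by blast
      from cosine_family_unique_nonneg[OF C C' M gen this, of "\<bar>t\<bar>"]
      show "C' t x = C t x"
        using cosine_family_minus[OF C, of t x] cosine_family_minus[OF C', of t x]
        by (cases "t \<ge> 0") auto
    qed
  qed
qed (use C in auto)

section \<open>Semigroups\<close>

lemma semigroup_0: "semigroup T \<Longrightarrow> T 0 f = f"
  by (simp add: semigroup_def)

lemma semigroup_add:
  assumes "semigroup T" "t \<ge> 0" "s \<ge> 0"
  shows "T (t + s) f = T t (T s f)"
  using assms by (simp add: semigroup_def)

lemma semigroup_continuous: "semigroup T \<Longrightarrow> continuous_on {0..} (\<lambda>t. T t f)"
  by (simp add: semigroup_def)

lemma semigroup_generator_invariant:
  assumes T: "semigroup T" and fg: "(f, g) \<in> semigroup_generator T" and s: "s \<ge> 0"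
  shows "(T s f, T s g) \<in> semigroup_generator T"
proof -
  have "((\<lambda>h. T s ((1 / h) *\<^sub>R (T h f - f))) \<longlongrightarrow> T s g) (at_right 0)"
    using fg unfolding semigroup_generator_def by (auto intro!: tendsto_intros)
  moreover have "eventually (\<lambda>h. T s ((1 / h) *\<^sub>R (T h f - f)) = (1 / h) *\<^sub>R (T h (T s f) - T s f)) (at_right 0)"
    using eventually_at_right_less[of "0::real"]
  proof eventually_elim
    case (elim h)
    then have "T s (T h f) = T h (T s f)"
      using semigroup_add[OF T, of s h f] semigroup_add[OF T, of h s f] s by (simp add: add.commute)
    then show ?case by (simp add: blinfun.bilinear_simps)
  qed
  ultimately show ?thesis
    unfolding semigroup_generator_def using tendsto_cong by fastforce
qed

lemma has_vector_derivative_imp_right_quotient: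
  fixes F :: "real \<Rightarrow> 'a::real_normed_vector"
  assumes F: "(F has_vector_derivative d) (at x within {a..b})" and x: "a \<le> x" "x < b"
  shows "((\<lambda>h. (1 / h) *\<^sub>R (F (x + h) - F x)) \<longlongrightarrow> d) (at_right 0)"
proof -
  have "filterlim (\<lambda>h. x + h) (at x within {a..b}) (at_right 0)"
    unfolding filterlim_at
  proof
    have "((\<lambda>h. x + h) \<longlongrightarrow> x + 0) (at_right 0)" by (intro tendsto_intros)
    then show "((\<lambda>h. x + h) \<longlongrightarrow> x) (at_right 0)" by simp
    have "eventually (\<lambda>h. h < b - x) (at_right 0)"
      using x by (intro order_tendstoD(2)[OF tendsto_ident_at]) simp
    then show "eventually (\<lambda>h. x + h \<in> {a..b} \<and> x + h \<noteq> x) (at_right 0)"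
      using eventually_at_right_less[of "0::real"] by eventually_elim (use x in auto)
  qed
  from filterlim_compose[OF F[unfolded has_vector_derivative_iff_difference_quotient] this]
  show ?thesis by simp
qed

text \<open>The difference of the two sides has vanishing right derivative. This upgrades the
  one-sided generator limit to a derivative of the orbit on an interval.\<close>

lemma semigroup_integral:
  fixes T :: "real \<Rightarrow> 'a::banach \<Rightarrow>\<^sub>L 'a"
  assumes T: "semigroup T" and fg: "(f, g) \<in> semigroup_generator T" and s: "s \<ge> 0"
  shows "T s f = f + integral {0..s} (\<lambda>r. T r g)"
proof -
  have cont: "continuous_on {0..b} (\<lambda>t. T t f)" for b f
    by (rule continuous_on_subset[OF semigroup_continuous[OF T]]) auto
  define G where "G s = integral {0..s} (\<lambda>r. T r g)" for s
  have dG: "(G has_vector_derivative T x g) (at x within {0..s})" if "x \<in> {0..s}" for x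
    unfolding G_def by (rule integral_has_vector_derivative[OF cont that])
  have "T s f - G s = T 0 f - G 0"
  proof (rule zero_right_derivative_imp_eq[OF s])
    show "continuous_on {0..s} (\<lambda>x. T x f - G x)"
    proof (intro continuous_on_diff cont)
      show "continuous_on {0..s} G"
        unfolding continuous_on_eq_continuous_within
        using has_vector_derivative_continuous[OF dG] by blast
    qed
    fix x assume x: "0 \<le> x" "x < s"
    have "((\<lambda>h. (1 / h) *\<^sub>R (T h (T x f) - T x f)) \<longlongrightarrow> T x g) (at_right 0)"
      using semigroup_generator_invariant[OF T fg x(1)] by (simp add: semigroup_generator_def)
    moreover have "((\<lambda>h. (1 / h) *\<^sub>R (G (x + h) - G x)) \<longlongrightarrow> T x g) (at_right 0)"
      using has_vector_derivative_imp_right_quotient[OF dG x] x by simp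
    ultimately have "((\<lambda>h. (1 / h) *\<^sub>R (T h (T x f) - T x f) - (1 / h) *\<^sub>R (G (x + h) - G x)) \<longlongrightarrow> T x g - T x g) (at_right 0)"
      by (rule tendsto_diff)
    moreover have "eventually (\<lambda>h. (1 / h) *\<^sub>R (T h (T x f) - T x f) - (1 / h) *\<^sub>R (G (x + h) - G x)
        = (1 / h) *\<^sub>R (T (x + h) f - G (x + h) - (T x f - G x))) (at_right 0)"
      using eventually_at_right_less[of "0::real"]
    proof eventually_elim
      case (elim h)
      then have "T h (T x f) = T (x + h) f"
        using semigroup_add[OF T, of h x f] x by (simp add: add.commute)
      then show ?case by (simp add: algebra_simps)
    qed
    ultimately show "((\<lambda>h. (1 / h) *\<^sub>R (T (x + h) f - G (x + h) - (T x f - G x))) \<longlongrightarrow> 0) (at_right 0)"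
      using tendsto_cong by fastforce
  qed
  then show ?thesis by (simp add: G_def semigroup_0[OF T] algebra_simps)
qed

lemma semigroup_has_vector_derivative:
  fixes T :: "real \<Rightarrow> 'a::banach \<Rightarrow>\<^sub>L 'a"
  assumes T: "semigroup T" and fg: "(f, g) \<in> semigroup_generator T" and s: "s \<in> {0..b}"
  shows "((\<lambda>s. T s f) has_vector_derivative T s g) (at s within {0..b})"
proof -
  have "continuous_on {0..b} (\<lambda>t. T t g)"
    by (rule continuous_on_subset[OF semigroup_continuous[OF T]]) auto
  then have "((\<lambda>s. f + integral {0..s} (\<lambda>r. T r g)) has_vector_derivative 0 + T s g) (at s within {0..b})"
    using s by (intro has_vector_derivative_add has_vector_derivative_const integral_has_vector_derivative)
  then have "((\<lambda>s. f + integral {0..s} (\<lambda>r. T r g)) has_vector_derivative T s g) (at s within {0..b})"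
    by simp
  then show ?thesis
    by (rule has_vector_derivative_transform[OF s, rotated]) (use semigroup_integral[OF T fg] in simp)
qed

text \<open>\<open>T (t - s) (T' s f)\<close> is constant in \<open>s\<close>: the two contributions
  to its derivative cancel because \<open>T'\<close> leaves the common domain invariant. Only
  \<open>T\<close> acts on a moving vector, so the bound is asked of \<open>T\<close>.\<close>

lemma semigroup_unique:
  fixes T T' :: "real \<Rightarrow> 'a::banach \<Rightarrow>\<^sub>L 'a"
  assumes T: "semigroup T" and T': "semigroup T'" and M: "\<And>t. t \<ge> 0 \<Longrightarrow> norm (T t) \<le> M"
    and gen: "semigroup_generator T' = semigroup_generator T"
    and fg: "(f, g) \<in> semigroup_generator T" and t: "t \<ge> 0"
  shows "T' t f = T t f"
proof -
  have fg': "(f, g) \<in> semigroup_generator T'" using fg gen by simp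
  have refl: "((\<lambda>s. t - s) has_vector_derivative - 1) (at s within X)" for s X
  proof -
    have "((\<lambda>s. t - s) has_vector_derivative 0 - 1) (at s within X)"
      by (intro has_vector_derivative_diff has_vector_derivative_const has_vector_derivative_id)
    then show ?thesis by simp
  qed
  have im: "(\<lambda>s. t - s) ` {0..t} = {0..t}"
    by (auto simp: image_iff intro!: bexI[of _ "t - _"])
  have "((\<lambda>s. T (t - s) (T' s f)) has_vector_derivative 0) (at s within {0..t})"
    if s: "s \<in> {0..t}" for s
  proof -
    have yz: "(T' s f, T' s g) \<in> semigroup_generator T"
      using semigroup_generator_invariant[OF T' fg'] gen s by simp
    have "((\<lambda>r. T r (T' s f)) has_vector_derivative T (t - s) (T' s g)) (at (t - s) within {0..t})"
      using s by (intro semigroup_has_vector_derivative[OF T yz]) simp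
    then have 1: "((\<lambda>r. T (t - r) (T' s f)) has_vector_derivative - T (t - s) (T' s g)) (at s within {0..t})"
      using vector_diff_chain_within[OF refl[of s "{0..t}"], of "\<lambda>r. T r (T' s f)" "T (t - s) (T' s g)"]
      by (simp add: o_def im)
    have "continuous_on {0..t} (\<lambda>r. T (t - r) (T' s g))"
      by (rule continuous_on_compose2[OF semigroup_continuous[OF T]]) (auto intro!: continuous_intros)
    then have 2: "((\<lambda>r. T (t - r) (T' s g)) \<longlongrightarrow> T (t - s) (T' s g)) (at s within {0..t})"
      using s by (simp add: continuous_on_def)
    have "((\<lambda>s. T (t - s) (T' s f)) has_vector_derivative - T (t - s) (T' s g) + T (t - s) (T' s g))
        (at s within {0..t})"
      by (rule has_vector_derivative_blinfun_apply[where M = M, OF _ 1 semigroup_has_vector_derivative[OF T' fg' s] 2])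
        (use M in simp)
    then show ?thesis by simp
  qed
  then obtain c where c: "\<And>s. s \<in> {0..t} \<Longrightarrow> T (t - s) (T' s f) = c"
    using has_vector_derivative_zero_constant[of "{0..t}" "\<lambda>s. T (t - s) (T' s f)"] by auto
  show ?thesis using c[of 0] c[of t] t by (simp add: semigroup_0[OF T] semigroup_0[OF T'])
qed

theorem generated_semigroup_eq:
  fixes T :: "real \<Rightarrow> 'a::banach \<Rightarrow>\<^sub>L 'a"
  assumes T: "semigroup T" and M: "\<And>t. t \<ge> 0 \<Longrightarrow> norm (T t) \<le> M"
    and dense: "\<And>x. \<exists>X. (\<forall>n::nat. X n \<in> Domain (semigroup_generator T)) \<and> X \<longlonglongrightarrow> x"
    and t: "t \<ge> 0"
  shows "generated_semigroup (semigroup_generator T) t = T t"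
  unfolding generated_semigroup_def
proof (rule the_equality)
  fix S assume "\<exists>T'. semigroup T' \<and> semigroup_generator T' = semigroup_generator T \<and> S = T' t"
  then obtain T' where T': "semigroup T'" "semigroup_generator T' = semigroup_generator T" "S = T' t"
    by blast
  show "S = T t" unfolding T'(3)
  proof (rule blinfun_eqI_dense[OF dense])
    fix x assume "x \<in> Domain (semigroup_generator T)"
    then obtain y where "(x, y) \<in> semigroup_generator T" by blast
    from semigroup_unique[OF T T'(1) M T'(2) this t] show "T' t x = T t x" by simp
  qed
qed (use T in auto)

section \<open>Gaussian means of functions with values in a Banach space\<close>

definition gauss_mean :: "(real \<Rightarrow> 'a::real_normed_vector) \<Rightarrow> 'a" where
  "gauss_mean F = integral UNIV (\<lambda>z. std_normal_density z *\<^sub>R F z)"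

text \<open>The moments 1, 1, 3 of the standard normal law. The fourth enters through the generator
  estimate, where a factor \<open>z^2\<close> meets an error of order \<open>t z^2\<close>.\<close>

lemma gauss_poly:
  "integrable lborel (\<lambda>z. std_normal_density z * (A + B * z\<^sup>2 + D * z ^ 4))"
  "(LINT z|lborel. std_normal_density z * (A + B * z\<^sup>2 + D * z ^ 4)) = A + B + 3 * D"
proof -
  have "has_bochner_integral lborel (\<lambda>z. A * (std_normal_density z * z ^ (2 * 0))
      + B * (std_normal_density z * z ^ (2 * 1)) + D * (std_normal_density z * z ^ (2 * 2)))
      (A * (fact (2 * 0) / (2 ^ 0 * fact 0)) + B * (fact (2 * 1) / (2 ^ 1 * fact 1)) + D * (fact (2 * 2) / (2 ^ 2 * fact 2)))"
    by (intro has_bochner_integral_add has_bochner_integral_mult_right std_normal_moment_even)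
  moreover have "A * (fact (2 * 0) / (2 ^ 0 * fact 0)) + B * (fact (2 * 1) / (2 ^ 1 * fact 1))
      + D * (fact (2 * 2) / (2 ^ 2 * fact 2)) = A + B + 3 * D"
    by (simp add: fact_numeral)
  moreover have "A * (std_normal_density z * z ^ (2 * 0)) + B * (std_normal_density z * z ^ (2 * 1))
      + D * (std_normal_density z * z ^ (2 * 2)) = std_normal_density z * (A + B * z\<^sup>2 + D * z ^ 4)" for z
    by (simp add: algebra_simps power2_eq_square)
  ultimately have "has_bochner_integral lborel (\<lambda>z. std_normal_density z * (A + B * z\<^sup>2 + D * z ^ 4)) (A + B + 3 * D)"
    by (simp only:)
  then show "integrable lborel (\<lambda>z. std_normal_density z * (A + B * z\<^sup>2 + D * z ^ 4))"
    "(LINT z|lborel. std_normal_density z * (A + B * z\<^sup>2 + D * z ^ 4)) = A + B + 3 * D"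
    by (auto simp: has_bochner_integral_iff)
qed

text \<open>The gauge integral makes sense without separability of the values: continuity gives
  integrability on compact intervals, and the polynomial majorant extends it to the line. Lebesgue
  integrals are used for real integrands only.\<close>

lemma gauss_mean_bound:
  fixes F :: "real \<Rightarrow> 'a::banach"
  assumes F: "continuous_on UNIV F" and b: "\<And>z. norm (F z) \<le> A + B * z\<^sup>2 + D * z ^ 4"
  shows "(\<lambda>z. std_normal_density z *\<^sub>R F z) integrable_on UNIV"
    and "norm (gauss_mean F) \<le> A + B + 3 * D"
proof -
  let ?b = "\<lambda>z. std_normal_density z * (A + B * z\<^sup>2 + D * z ^ 4)"
  have b': "norm (std_normal_density z *\<^sub>R F z) \<le> ?b z" for z
    using mult_left_mono[OF b[of z], of "std_normal_density z"] by simp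
  have int: "?b integrable_on UNIV" by (rule integrable_on_lborel[OF gauss_poly(1)])
  show 1: "(\<lambda>z. std_normal_density z *\<^sub>R F z) integrable_on UNIV"
  proof (rule integrable_on_all_intervals_integrable_bound[OF _ b' int])
    fix a c :: real
    show "(\<lambda>x. if x \<in> UNIV then std_normal_density x *\<^sub>R F x else 0) integrable_on cbox a c"
      unfolding std_normal_density_def
      by (auto intro!: integrable_continuous_real continuous_intros continuous_on_subset[OF F])
  qed
  show "norm (gauss_mean F) \<le> A + B + 3 * D"
    unfolding gauss_mean_def
    using Henstock_Kurzweil_Integration.integral_norm_bound_integral[OF 1 int b']
    by (simp add: integral_lborel[OF gauss_poly(1)] gauss_poly(2))
qed

lemma gauss_mean_integrable:
  fixes F :: "real \<Rightarrow> 'a::banach"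
  assumes "continuous_on UNIV F" "\<And>z. norm (F z) \<le> A"
  shows "(\<lambda>z. std_normal_density z *\<^sub>R F z) integrable_on UNIV"
  using gauss_mean_bound(1)[of F A 0 0] assms by simp

lemma gauss_mean_norm_le:
  fixes F :: "real \<Rightarrow> 'a::banach"
  assumes "continuous_on UNIV F" "\<And>z. norm (F z) \<le> A"
  shows "norm (gauss_mean F) \<le> A"
  using gauss_mean_bound(2)[of F A 0 0] assms by simp

lemma gauss_mean_linear:
  fixes F :: "real \<Rightarrow> 'a::banach"
  assumes "bounded_linear L" "(\<lambda>z. std_normal_density z *\<^sub>R F z) integrable_on UNIV"
  shows "L (gauss_mean F) = gauss_mean (\<lambda>z. L (F z))"
  using integral_linear[OF assms(2,1)]
  by (simp add: gauss_mean_def o_def linear_simps(5)[OF assms(1)])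

lemma gauss_mean_diff:
  fixes F G :: "real \<Rightarrow> 'a::banach"
  assumes "(\<lambda>z. std_normal_density z *\<^sub>R F z) integrable_on UNIV"
    "(\<lambda>z. std_normal_density z *\<^sub>R G z) integrable_on UNIV"
  shows "gauss_mean (\<lambda>z. F z - G z) = gauss_mean F - gauss_mean G"
  using Henstock_Kurzweil_Integration.integral_diff[OF assms] by (simp add: gauss_mean_def scaleR_diff_right)

lemma gauss_mean_scaled_vector:
  fixes c :: "'a::banach"
  assumes "integrable lborel (\<lambda>z. std_normal_density z * p z)"
  shows "((\<lambda>z. std_normal_density z *\<^sub>R (p z *\<^sub>R c)) has_integral
    (LINT z|lborel. std_normal_density z * p z) *\<^sub>R c) UNIV"
  using has_integral_linear[OF has_integral_integral_real[OF assms], of "\<lambda>x. x *\<^sub>R c"]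
  by (simp add: o_def bounded_linear_scaleR_left)

lemma gauss_mean_const:
  fixes c :: "'a::banach"
  shows "(\<lambda>z. std_normal_density z *\<^sub>R c) integrable_on UNIV" "gauss_mean (\<lambda>z. c) = c"
  using gauss_mean_scaled_vector[of "\<lambda>z. 1" c] gauss_poly[of 1 0 0]
  by (auto simp: gauss_mean_def has_integral_iff)

lemma gauss_mean_square:
  fixes c :: "'a::banach"
  shows "(\<lambda>z. std_normal_density z *\<^sub>R (z\<^sup>2 *\<^sub>R c)) integrable_on UNIV" "gauss_mean (\<lambda>z. z\<^sup>2 *\<^sub>R c) = c"
  using gauss_mean_scaled_vector[of "\<lambda>z. z\<^sup>2" c] gauss_poly[of 0 1 0]
  by (auto simp: gauss_mean_def has_integral_iff)

section \<open>Gaussian means\<close>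

abbreviation gauss_measure :: "real \<Rightarrow> real measure" where
  "gauss_measure \<sigma> \<equiv> density lborel (\<lambda>x. ennreal (normal_density 0 \<sigma> x))"

lemma gauss_mean_lborel:
  fixes F :: "real \<Rightarrow> real"
  assumes [measurable]: "F \<in> borel_measurable borel" and b: "\<And>z. \<bar>F z\<bar> \<le> K"
  shows "integrable lborel (\<lambda>z. std_normal_density z * F z)"
    "gauss_mean F = (LINT z|lborel. std_normal_density z * F z)"
proof -
  show 1: "integrable lborel (\<lambda>z. std_normal_density z * F z)"
  proof (rule Bochner_Integration.integrable_bound[OF gauss_poly(1)[of K 0 0]])
    show "AE z in lborel. norm (std_normal_density z * F z) \<le> norm (std_normal_density z * (K + 0 * z\<^sup>2 + 0 * z ^ 4))"
    proof (rule AE_I2)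
      fix z
      have "\<bar>F z\<bar> \<le> \<bar>K\<bar>" using b[of z] by linarith
      then show "norm (std_normal_density z * F z) \<le> norm (std_normal_density z * (K + 0 * z\<^sup>2 + 0 * z ^ 4))"
        by (simp add: abs_mult mult_left_mono)
    qed
  qed simp
  then show "gauss_mean F = (LINT z|lborel. std_normal_density z * F z)"
    unfolding gauss_mean_def by (simp add: integral_lborel)
qed

lemma nn_integral_gauss_mean:
  fixes F :: "real \<Rightarrow> real"
  assumes F[measurable]: "F \<in> borel_measurable borel" and b: "\<And>z. 0 \<le> F z" "\<And>z. F z \<le> K"
  shows "(\<integral>\<^sup>+z. ennreal (F z) \<partial>gauss_measure 1) = ennreal (gauss_mean F)"
proof -
  have b': "\<bar>F z\<bar> \<le> K" for z using b[of z] by simp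
  have "(\<integral>\<^sup>+z. ennreal (F z) \<partial>gauss_measure 1)
      = (\<integral>\<^sup>+z. ennreal (std_normal_density z) * ennreal (F z) \<partial>lborel)"
    by (rule nn_integral_density) auto
  also have "\<dots> = (\<integral>\<^sup>+z. ennreal (std_normal_density z * F z) \<partial>lborel)"
    by (simp add: ennreal_mult b)
  also have "\<dots> = ennreal (LINT z|lborel. std_normal_density z * F z)"
    by (rule nn_integral_eq_integral[OF gauss_mean_lborel(1)[OF F b']]) (simp add: b)
  finally show ?thesis by (simp add: gauss_mean_lborel(2)[OF F b'])
qed

lemma nn_integral_gauss_measure_scale:
  fixes f :: "real \<Rightarrow> ennreal"
  assumes [measurable]: "f \<in> borel_measurable borel" and \<sigma>: "\<sigma> > 0"
  shows "(\<integral>\<^sup>+x. f x \<partial>gauss_measure \<sigma>) = (\<integral>\<^sup>+z. f (\<sigma> * z) \<partial>gauss_measure 1)"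
proof -
  have "(\<integral>\<^sup>+x. f x \<partial>gauss_measure \<sigma>) = (\<integral>\<^sup>+x. ennreal (normal_density 0 \<sigma> x) * f x \<partial>lborel)"
    by (rule nn_integral_density) auto
  also have "\<dots> = ennreal \<bar>\<sigma>\<bar> * (\<integral>\<^sup>+z. ennreal (normal_density 0 \<sigma> (0 + \<sigma> * z)) * f (0 + \<sigma> * z) \<partial>lborel)"
    using \<sigma> by (intro nn_integral_real_affine) auto
  also have "\<dots> = (\<integral>\<^sup>+z. ennreal \<sigma> * (ennreal (normal_density 0 \<sigma> (\<sigma> * z)) * f (\<sigma> * z)) \<partial>lborel)"
    using \<sigma> by (subst nn_integral_cmult) auto
  also have "\<dots> = (\<integral>\<^sup>+z. ennreal (std_normal_density z) * f (\<sigma> * z) \<partial>lborel)"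
  proof (rule nn_integral_cong)
    fix z
    have "\<sigma> * normal_density 0 \<sigma> (\<sigma> * z) = std_normal_density z"
      using \<sigma> by (simp add: normal_density_def power_mult_distrib real_sqrt_mult)
    then show "ennreal \<sigma> * (ennreal (normal_density 0 \<sigma> (\<sigma> * z)) * f (\<sigma> * z))
        = ennreal (std_normal_density z) * f (\<sigma> * z)"
      using \<sigma> by (simp add: mult.assoc[symmetric] ennreal_mult[symmetric])
  qed
  also have "\<dots> = (\<integral>\<^sup>+z. f (\<sigma> * z) \<partial>gauss_measure 1)"
    by (rule nn_integral_density[symmetric]) auto
  finally show ?thesis .
qed

text \<open>Sums of independent centred normal variables: the convolution of two centred normal
  densities is again one, and the variances add.\<close>

lemma nn_integral_gauss_measure_add:
  fixes f :: "real \<Rightarrow> ennreal"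
  assumes f[measurable]: "f \<in> borel_measurable borel" and pos: "a > 0" "b > 0"
  shows "(\<integral>\<^sup>+u. (\<integral>\<^sup>+v. f (a * u + b * v) \<partial>gauss_measure 1) \<partial>gauss_measure 1)
    = (\<integral>\<^sup>+z. f (sqrt (a\<^sup>2 + b\<^sup>2) * z) \<partial>gauss_measure 1)"
proof -
  have fin: "finite_measure (gauss_measure \<sigma>)" if "\<sigma> > 0" for \<sigma>
    using prob_space_normal_density[OF that] by (simp add: prob_space_def)
  interpret B: finite_measure "gauss_measure b" using fin pos by simp
  have "(\<integral>\<^sup>+u. (\<integral>\<^sup>+v. f (a * u + b * v) \<partial>gauss_measure 1) \<partial>gauss_measure 1)
      = (\<integral>\<^sup>+u. (\<integral>\<^sup>+y. f (a * u + y) \<partial>gauss_measure b) \<partial>gauss_measure 1)"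
    using pos by (intro nn_integral_cong nn_integral_gauss_measure_scale[symmetric]) auto
  also have "\<dots> = (\<integral>\<^sup>+x. (\<integral>\<^sup>+y. f (x + y) \<partial>gauss_measure b) \<partial>gauss_measure a)"
    using pos by (intro nn_integral_gauss_measure_scale[symmetric, where f = "\<lambda>x. \<integral>\<^sup>+y. f (x + y) \<partial>gauss_measure b"]
        B.borel_measurable_nn_integral) auto
  also have "\<dots> = (\<integral>\<^sup>+x. f x \<partial>(gauss_measure a \<star> gauss_measure b))"
    using pos by (intro nn_integral_convolution[symmetric] fin) auto
  also have "gauss_measure a \<star> gauss_measure b = gauss_measure (sqrt (a\<^sup>2 + b\<^sup>2))"
    using pos conv_normal_density_zero_mean[OF pos]
    by (subst convolution_density) (auto simp: fin ennreal_mult[symmetric] fun_eq_iff)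
  also have "(\<integral>\<^sup>+x. f x \<partial>gauss_measure (sqrt (a\<^sup>2 + b\<^sup>2)))
      = (\<integral>\<^sup>+z. f (sqrt (a\<^sup>2 + b\<^sup>2) * z) \<partial>gauss_measure 1)"
    using pos by (intro nn_integral_gauss_measure_scale) (auto intro: add_pos_pos)
  finally show ?thesis .
qed

lemma gauss_mean_add_const:
  fixes F :: "real \<Rightarrow> real"
  assumes F[measurable]: "F \<in> borel_measurable borel" and b: "\<And>z. \<bar>F z\<bar> \<le> K"
  shows "gauss_mean (\<lambda>z. F z + c) = gauss_mean F + c"
proof -
  have "(\<lambda>z. std_normal_density z *\<^sub>R F z) integrable_on UNIV"
    using integrable_on_lborel[OF gauss_mean_lborel(1)[OF F b]] by simp
  from Henstock_Kurzweil_Integration.integral_add[OF this gauss_mean_const(1)[of c]]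
  show ?thesis using gauss_mean_const(2)[of c] by (simp add: gauss_mean_def algebra_simps)
qed

lemma gauss_mean_gauss_mean:
  fixes p :: "real \<Rightarrow> real"
  assumes p: "continuous_on UNIV p" and K: "\<And>x. \<bar>p x\<bar> \<le> K" and pos: "a > 0" "b > 0"
  shows "gauss_mean (\<lambda>u. gauss_mean (\<lambda>v. p (a * u + b * v))) = gauss_mean (\<lambda>z. p (sqrt (a\<^sup>2 + b\<^sup>2) * z))"
proof -
  have pm[measurable]: "p \<in> borel_measurable borel" using p by (rule borel_measurable_continuous_onI)
  \<comment> \<open>Adding the bound \<open>K\<close> makes the integrand nonnegative, as the
    convolution formula for nonnegative integrals requires. The mean of a constant is that constant,
    so the shift cancels at the end.\<close>
  define q where "q x = p x + K" for x
  have qm[measurable]: "q \<in> borel_measurable borel" unfolding q_def by measurable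
  have q: "0 \<le> q x" "q x \<le> 2 * K" "\<bar>q x\<bar> \<le> 2 * K" for x using K[of x] by (auto simp: q_def)
  define h where "h u = gauss_mean (\<lambda>v. q (a * u + b * v))" for u
  have hp: "h u = gauss_mean (\<lambda>v. p (a * u + b * v)) + K" for u
    unfolding h_def q_def by (rule gauss_mean_add_const[where K = K]) (auto simp: K)
  have "h u = (LINT v|lborel. std_normal_density v * q (a * u + b * v))" for u
    unfolding h_def by (rule gauss_mean_lborel(2)[where K = "2 * K"]) (auto simp: q)
  then have hm[measurable]: "h \<in> borel_measurable borel"
    by (subst ext[of h], assumption) measurable
  have he: "(\<integral>\<^sup>+v. ennreal (q (a * u + b * v)) \<partial>gauss_measure 1) = ennreal (h u)" for u
    unfolding h_def by (rule nn_integral_gauss_mean[where K = "2 * K"]) (auto simp: q)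
  have hle: "\<bar>h u\<bar> \<le> 2 * K" and h0: "0 \<le> h u" for u
  proof -
    have "continuous_on UNIV (\<lambda>v. p (a * u + b * v))"
      by (rule continuous_on_compose2[OF p]) (auto intro!: continuous_intros)
    then have "norm (gauss_mean (\<lambda>v. p (a * u + b * v))) \<le> K"
      by (rule gauss_mean_norm_le) (simp add: K)
    then show "\<bar>h u\<bar> \<le> 2 * K" "0 \<le> h u" unfolding hp by auto
  qed
  have "ennreal (gauss_mean h) = (\<integral>\<^sup>+u. ennreal (h u) \<partial>gauss_measure 1)"
    using hle h0 by (intro nn_integral_gauss_mean[symmetric, where K = "2 * K"] hm) (auto simp: abs_le_iff)
  also have "\<dots> = (\<integral>\<^sup>+z. ennreal (q (sqrt (a\<^sup>2 + b\<^sup>2) * z)) \<partial>gauss_measure 1)"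
    unfolding he[symmetric] by (rule nn_integral_gauss_measure_add[OF _ pos]) measurable
  also have "\<dots> = ennreal (gauss_mean (\<lambda>z. q (sqrt (a\<^sup>2 + b\<^sup>2) * z)))"
    by (rule nn_integral_gauss_mean[where K = "2 * K"]) (auto simp: q)
  finally have "ennreal (gauss_mean h) = ennreal (gauss_mean (\<lambda>z. q (sqrt (a\<^sup>2 + b\<^sup>2) * z)))" .
  moreover have "0 \<le> gauss_mean h"
    unfolding gauss_mean_lborel(2)[OF hm hle] by (intro Bochner_Integration.integral_nonneg) (simp add: h0)
  moreover have "0 \<le> gauss_mean (\<lambda>z. q (sqrt (a\<^sup>2 + b\<^sup>2) * z))"
    by (subst gauss_mean_lborel(2)[where K = "2 * K"]) (auto simp: q)
  ultimately have "gauss_mean h = gauss_mean (\<lambda>z. q (sqrt (a\<^sup>2 + b\<^sup>2) * z))" by simp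
  moreover have "gauss_mean (\<lambda>z. q (sqrt (a\<^sup>2 + b\<^sup>2) * z)) = gauss_mean (\<lambda>z. p (sqrt (a\<^sup>2 + b\<^sup>2) * z)) + K"
    unfolding q_def by (rule gauss_mean_add_const[where K = K]) (auto simp: K)
  moreover have "gauss_mean h = gauss_mean (\<lambda>u. gauss_mean (\<lambda>v. p (a * u + b * v))) + K"
  proof -
    have "gauss_mean (\<lambda>u. h u + (- K)) = gauss_mean h + (- K)"
      by (rule gauss_mean_add_const[OF hm hle])
    then show ?thesis by (simp add: hp)
  qed
  ultimately show ?thesis by simp
qed

lemma gauss_mean_reflect:
  fixes F :: "real \<Rightarrow> real"
  assumes F[measurable]: "F \<in> borel_measurable borel" and b: "\<And>z. \<bar>F z\<bar> \<le> K"
  shows "gauss_mean (\<lambda>z. F (- z)) = gauss_mean F"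
proof -
  have "gauss_mean F = (LINT z|lborel. std_normal_density z * F z)"
    by (rule gauss_mean_lborel[OF F b])
  also have "\<dots> = (LINT z|lborel. std_normal_density z * F (- z))"
    using lborel_integral_real_affine[of "-1" "\<lambda>z. std_normal_density z * F z" 0]
    by (simp add: std_normal_density_def)
  also have "\<dots> = gauss_mean (\<lambda>z. F (- z))"
    by (rule gauss_mean_lborel(2)[symmetric, where K = K]) (auto simp: b)
  finally show ?thesis by simp
qed

section \<open>The Weierstrass formula\<close>

text \<open>The kernel \<open>exp (- s^2 / (4 t)) / sqrt (4 pi t)\<close> on the whole line after
  the substitution \<open>s = sqrt (2 t) z\<close>. Scaling the time instead of the density keeps
  one weight for all \<open>t\<close> and gives the identity at \<open>t = 0\<close> without a
  separate case.\<close>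

definition weierstrass :: "(real \<Rightarrow> 'a::banach \<Rightarrow>\<^sub>L 'a) \<Rightarrow> real \<Rightarrow> 'a \<Rightarrow>\<^sub>L 'a" where
  "weierstrass C t = Blinfun (\<lambda>f. gauss_mean (\<lambda>z. C (sqrt (2 * t) * z) f))"

locale bounded_cosine =
  fixes C :: "real \<Rightarrow> 'a::banach \<Rightarrow>\<^sub>L 'a" and M :: real
  assumes C: "cosine_family C" and M: "norm (C t) \<le> M"
begin

abbreviation "T \<equiv> weierstrass C"

lemma norm_C_le: "norm (C t f) \<le> M * norm f"
  using norm_blinfun[of "C t" f] mult_right_mono[OF M[of t] norm_ge_zero[of f]] by linarith

lemma M_nonneg: "0 \<le> M"
  using M[of 0] norm_ge_zero order_trans by blast

lemma continuous_C_scaled: "continuous_on UNIV (\<lambda>z. C (a * z) f)"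
  by (rule continuous_on_compose2[OF cosine_family_continuous[OF C]]) (auto intro!: continuous_intros)

lemma integrable_C: "(\<lambda>z. std_normal_density z *\<^sub>R C (a * z) f) integrable_on UNIV"
  by (rule gauss_mean_integrable[OF continuous_C_scaled norm_C_le])

lemma weierstrass_apply: "T t f = gauss_mean (\<lambda>z. C (sqrt (2 * t) * z) f)"
proof -
  have "bounded_linear (\<lambda>f. gauss_mean (\<lambda>z. C (sqrt (2 * t) * z) f))"
  proof (rule bounded_linear_intro[of _ M])
    fix f g :: 'a and c :: real
    show "gauss_mean (\<lambda>z. C (sqrt (2 * t) * z) (f + g))
        = gauss_mean (\<lambda>z. C (sqrt (2 * t) * z) f) + gauss_mean (\<lambda>z. C (sqrt (2 * t) * z) g)"
      using Henstock_Kurzweil_Integration.integral_add[OF integrable_C integrable_C]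
      by (simp add: gauss_mean_def blinfun.bilinear_simps scaleR_add_right)
    show "gauss_mean (\<lambda>z. C (sqrt (2 * t) * z) (c *\<^sub>R f)) = c *\<^sub>R gauss_mean (\<lambda>z. C (sqrt (2 * t) * z) f)"
      using gauss_mean_linear[OF bounded_linear_scaleR_right integrable_C]
      by (simp add: blinfun.bilinear_simps)
    show "norm (gauss_mean (\<lambda>z. C (sqrt (2 * t) * z) f)) \<le> norm f * M"
      using gauss_mean_norm_le[OF continuous_C_scaled norm_C_le, of "sqrt (2 * t)" f]
      by (simp only: mult.commute[of "norm f"])
  qed
  then show ?thesis by (simp add: weierstrass_def bounded_linear_Blinfun_apply)
qed

lemma norm_weierstrass: "norm (T t) \<le> M"
  by (rule norm_blinfun_bound[OF M_nonneg])
    (simp add: weierstrass_apply gauss_mean_norm_le[OF continuous_C_scaled norm_C_le])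

lemma weierstrass_linear:
  assumes "bounded_linear L"
  shows "L (T t f) = gauss_mean (\<lambda>z. L (C (sqrt (2 * t) * z) f))"
  unfolding weierstrass_apply by (rule gauss_mean_linear[OF assms integrable_C])

lemma weierstrass_0: "T 0 f = f"
  by (simp add: weierstrass_apply cosine_family_0[OF C] gauss_mean_const(2))

lemma weierstrass_commute: "C s (T t f) = T t (C s f)"
  unfolding weierstrass_linear[OF blinfun.bounded_linear_right]
  by (simp add: weierstrass_apply cosine_family_commute[OF C, of s])

text \<open>An argument of Chebyshev type: where continuity at 0 stops helping, the crude bound
  \<open>(M + 1) * norm f\<close> is below \<open>K * s^2\<close>, and the mean of
  \<open>s^2 = 2 t z^2\<close> is \<open>2 t\<close>.\<close>

lemma weierstrass_minus_id_bound:
  assumes e: "e > 0"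
  shows "\<exists>K. \<forall>t\<ge>0. norm (T t f - f) \<le> e + K * t"
proof -
  have "isCont (\<lambda>t. C t f) 0"
    using cosine_family_continuous[OF C, of f] by (simp add: continuous_on_eq_continuous_at)
  then have "\<exists>d>0. \<forall>s. norm (s - 0) < d \<longrightarrow> norm (C s f - C 0 f) < e"
    unfolding continuous_at_eps_delta dist_norm using e by meson
  then obtain d where d: "d > 0" "\<And>s. \<bar>s\<bar> < d \<Longrightarrow> norm (C s f - f) < e"
    by (auto simp: cosine_family_0[OF C])
  define K where "K = (M + 1) * norm f / d\<^sup>2"
  have K: "norm (C s f - f) \<le> e + K * s\<^sup>2" for s
  proof (cases "\<bar>s\<bar> < d")
    case True
    have "0 \<le> K * s\<^sup>2" using M_nonneg by (simp add: K_def)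
    then show ?thesis using d(2)[OF True] by linarith
  next
    case False
    then have "d\<^sup>2 \<le> s\<^sup>2" using power_mono[of d "\<bar>s\<bar>" 2] d(1) by simp
    then have "(M + 1) * norm f * 1 \<le> (M + 1) * norm f * (s\<^sup>2 / d\<^sup>2)"
      using d(1) M_nonneg by (intro mult_left_mono) auto
    then have "(M + 1) * norm f \<le> K * s\<^sup>2" by (simp add: K_def)
    moreover have "norm (C s f - f) \<le> (M + 1) * norm f"
      using norm_triangle_ineq4[of "C s f" f] norm_C_le[of s f] by (simp add: algebra_simps)
    ultimately show ?thesis using e by linarith
  qed
  have "norm (T t f - f) \<le> e + 2 * K * t" if t: "t \<ge> 0" for t
  proof -
    have "T t f - f = gauss_mean (\<lambda>z. C (sqrt (2 * t) * z) f - f)"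
      unfolding weierstrass_apply
      by (subst gauss_mean_diff) (auto simp: integrable_C gauss_mean_const)
    moreover have "norm (gauss_mean (\<lambda>z. C (sqrt (2 * t) * z) f - f)) \<le> e + K * (2 * t) + 3 * 0"
    proof (rule gauss_mean_bound(2))
      show "norm (C (sqrt (2 * t) * z) f - f) \<le> e + K * (2 * t) * z\<^sup>2 + 0 * z ^ 4" for z
        using K[of "sqrt (2 * t) * z"] t by (simp add: power_mult_distrib mult_ac)
    qed (intro continuous_on_diff continuous_C_scaled continuous_on_const)
    ultimately show ?thesis by (simp add: mult_ac)
  qed
  then show ?thesis by blast
qed

text \<open>With \<open>h = sqrt (2 t) z\<close> one has \<open>1 / t = z^2 (2 / h^2)\<close>, so
  the integrand is \<open>z^2\<close> times a generator quotient and tends to \<open>z^2 g\<close>,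
  while \<open>z^2\<close> has mean 1. By the second and fourth moments the error
  \<open>z^2 (e / 2 + K h^2)\<close> has mean \<open>e / 2 + 6 K t\<close>.\<close>

lemma weierstrass_generator:
  assumes fg: "(f, g) \<in> cosine_generator C"
  shows "(f, g) \<in> semigroup_generator T"
proof -
  have "((\<lambda>t. (1 / t) *\<^sub>R (T t f - f)) \<longlongrightarrow> g) (at_right 0)"
  proof (rule tendstoI)
    fix e :: real assume e: "e > 0"
    have "isCont (\<lambda>t. C t g) 0"
      using cosine_family_continuous[OF C, of g] by (simp add: continuous_on_eq_continuous_at)
    then have "\<exists>d>0. \<forall>s. norm (s - 0) < d \<longrightarrow> norm (C s g - C 0 g) < e / 2"
      unfolding continuous_at_eps_delta dist_norm using e by (meson half_gt_zero)
    then obtain d where d: "d > 0" "\<And>s. \<bar>s\<bar> < d \<Longrightarrow> norm (C s g - g) < e / 2"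
      by (auto simp: cosine_family_0[OF C])
    define K where "K = (M + 1) * norm g / d\<^sup>2"
    have K0: "0 \<le> K" using M_nonneg by (simp add: K_def)
    have K: "norm ((2 / h\<^sup>2) *\<^sub>R (C h f - f) - g) \<le> e / 2 + K * h\<^sup>2" if h: "h \<noteq> 0" for h
    proof (rule cosine_generator_quotient_bound[OF C fg _ h])
      fix s assume s: "\<bar>s\<bar> \<le> \<bar>h\<bar>"
      show "norm (C s g - g) \<le> e / 2 + K * h\<^sup>2"
      proof (cases "\<bar>h\<bar> < d")
        case True
        then have "norm (C s g - g) < e / 2" using d(2) s by simp
        moreover have "0 \<le> K * h\<^sup>2" using K0 by simp
        ultimately show ?thesis by linarith
      next
        case False
        then have "d\<^sup>2 \<le> h\<^sup>2" using power_mono[of d "\<bar>h\<bar>" 2] d(1) by simp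
        then have "(M + 1) * norm g * 1 \<le> (M + 1) * norm g * (h\<^sup>2 / d\<^sup>2)"
          using d(1) M_nonneg by (intro mult_left_mono) auto
        then have "(M + 1) * norm g \<le> K * h\<^sup>2" by (simp add: K_def)
        moreover have "norm (C s g - g) \<le> (M + 1) * norm g"
          using norm_triangle_ineq4[of "C s g" g] norm_C_le[of s g] by (simp add: algebra_simps)
        ultimately show ?thesis using e by linarith
      qed
    qed
    have bound: "norm ((1 / t) *\<^sub>R (T t f - f) - g) \<le> e / 2 + 6 * K * t" if t: "t > 0" for t
    proof -
      define F where "F z = (1 / t) *\<^sub>R (C (sqrt (2 * t) * z) f - f) - z\<^sup>2 *\<^sub>R g" for z
      have Fb: "norm (F z) \<le> 0 + e / 2 * z\<^sup>2 + 2 * K * t * z ^ 4" for z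
      proof (cases "z = 0")
        case False
        define h where "h = sqrt (2 * t) * z"
        have h: "h \<noteq> 0" "h\<^sup>2 = 2 * t * z\<^sup>2" using False t by (auto simp: h_def power_mult_distrib)
        have zt: "z\<^sup>2 * (2 / h\<^sup>2) = 1 / t" using False t by (simp add: h(2))
        have "F z = z\<^sup>2 *\<^sub>R ((2 / h\<^sup>2) *\<^sub>R (C h f - f) - g)"
          unfolding F_def h_def[symmetric] scaleR_diff_right[of "z\<^sup>2"] scaleR_scaleR zt ..
        then have "norm (F z) \<le> z\<^sup>2 * (e / 2 + K * h\<^sup>2)"
          using mult_left_mono[OF K[OF h(1)], of "z\<^sup>2"] by (simp only: norm_scaleR abs_power2 zero_le_power2)
        also have "\<dots> = 0 + e / 2 * z\<^sup>2 + 2 * K * t * z ^ 4"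
          unfolding h(2) by (simp add: algebra_simps power4_eq_xxxx power2_eq_square)
        finally show ?thesis .
      qed (use t in \<open>simp add: F_def cosine_family_0[OF C]\<close>)
      have Fc: "continuous_on UNIV F"
        unfolding F_def by (intro continuous_intros continuous_C_scaled)
      have i1: "(\<lambda>z. std_normal_density z *\<^sub>R (C (sqrt (2 * t) * z) f - f)) integrable_on UNIV"
        using Henstock_Kurzweil_Integration.integrable_diff[OF integrable_C gauss_mean_const(1)]
        by (simp add: scaleR_diff_right)
      have i2: "(\<lambda>z. std_normal_density z *\<^sub>R ((1 / t) *\<^sub>R (C (sqrt (2 * t) * z) f - f))) integrable_on UNIV"
        using integrable_linear[OF i1 bounded_linear_scaleR_right[of "1 / t"]]
        by (simp add: o_def mult.commute)
      have "gauss_mean F = gauss_mean (\<lambda>z. (1 / t) *\<^sub>R (C (sqrt (2 * t) * z) f - f)) - g"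
        unfolding F_def gauss_mean_diff[OF i2 gauss_mean_square(1)] gauss_mean_square(2) ..
      also have "gauss_mean (\<lambda>z. (1 / t) *\<^sub>R (C (sqrt (2 * t) * z) f - f))
          = (1 / t) *\<^sub>R gauss_mean (\<lambda>z. C (sqrt (2 * t) * z) f - f)"
        by (rule gauss_mean_linear[OF bounded_linear_scaleR_right i1, symmetric])
      also have "gauss_mean (\<lambda>z. C (sqrt (2 * t) * z) f - f) = T t f - f"
        unfolding weierstrass_apply gauss_mean_diff[OF integrable_C gauss_mean_const(1)] gauss_mean_const(2) ..
      finally have "(1 / t) *\<^sub>R (T t f - f) - g = gauss_mean F" by simp
      then show ?thesis using gauss_mean_bound(2)[OF Fc Fb] by (simp only:)
    qed
    have "((\<lambda>t. e / 2 + 6 * K * t) \<longlongrightarrow> e / 2 + 6 * K * 0) (at_right 0)" by (intro tendsto_intros)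
    then have "eventually (\<lambda>t. e / 2 + 6 * K * t < e) (at_right 0)"
      using e by (elim order_tendstoD(2)) linarith
    then show "eventually (\<lambda>t. dist ((1 / t) *\<^sub>R (T t f - f)) g < e) (at_right 0)"
      using eventually_at_right_less[of "0::real"]
    proof eventually_elim
      case (elim t)
      then show ?case using bound[of t] unfolding dist_norm by linarith
    qed
  qed
  then show ?thesis by (simp add: semigroup_generator_def)
qed

end

text \<open>The semigroup law is checked on scalar functionals, where Tonelli's theorem is available; the
  ambient space must therefore have enough of them.\<close>

locale separated_bounded_cosine = bounded_cosine C M
  for C :: "real \<Rightarrow> 'a::banach \<Rightarrow>\<^sub>L 'a" and M +
  assumes separating: "\<And>x y::'a. (\<And>L::'a \<Rightarrow> real. bounded_linear L \<Longrightarrow> L x = L y) \<Longrightarrow> x = y"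
begin

text \<open>\<open>C (a u) C (b v)\<close> is half the sum of \<open>C (a u + b v)\<close> and
  \<open>C (a u - b v)\<close>. The law of \<open>v\<close> is symmetric, so both halves contribute
  equally, and \<open>a u + b v\<close> is normal with variance \<open>2 t + 2 s\<close>.\<close>

lemma weierstrass_add_pos:
  assumes t: "t > 0" and s: "s > 0"
  shows "T t (T s f) = T (t + s) f"
proof (rule separating)
  fix L :: "'a \<Rightarrow> real" assume L: "bounded_linear L"
  obtain K where K: "\<And>x. norm (L x) \<le> norm x * K" using bounded_linear.bounded[OF L] by blast
  define a b where "a = sqrt (2 * t)" and "b = sqrt (2 * s)"
  have ab: "a > 0" "b > 0" "sqrt (a\<^sup>2 + b\<^sup>2) = sqrt (2 * (t + s))"
    using t s by (auto simp: a_def b_def)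
  define p where "p r = L (C r f)" for r
  have pc: "continuous_on UNIV p"
    unfolding p_def by (rule bounded_linear.continuous_on[OF L cosine_family_continuous[OF C]])
  have pb: "\<bar>p r\<bar> \<le> M * norm f * \<bar>K\<bar>" for r
    using K[of "C r f"] mult_right_mono[OF norm_C_le[of r f], of "\<bar>K\<bar>"] M_nonneg
      mult_left_mono[of K "\<bar>K\<bar>" "norm (C r f)"] unfolding p_def real_norm_def by force
  have pc2: "continuous_on UNIV (\<lambda>v. p (c + d * v))" for c d
    by (rule continuous_on_compose2[OF pc]) (auto intro!: continuous_intros)
  have pi: "(\<lambda>v. std_normal_density v *\<^sub>R p (c + d * v)) integrable_on UNIV" for c d
    by (rule gauss_mean_integrable[OF pc2, where A = "M * norm f * \<bar>K\<bar>"]) (simp add: pb)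
  have inner: "L (C (a * u) (T s f)) = gauss_mean (\<lambda>v. p (a * u + b * v))" for u
  proof -
    have lin: "bounded_linear (\<lambda>x. L (C (a * u) x))"
      by (rule bounded_linear_compose[OF L blinfun.bounded_linear_right])
    have half: "L (C (a * u) (C r f)) = (1 / 2) *\<^sub>R (p (a * u + r) + p (a * u - r))" for r
    proof -
      have "2 * L (C (a * u) (C r f)) = L (2 *\<^sub>R C (a * u) (C r f))"
        by (simp add: linear_simps(5)[OF L])
      also have "\<dots> = p (a * u + r) + p (a * u - r)"
        unfolding cosine_family_mult[OF C] by (simp add: linear_simps(1)[OF L] p_def)
      finally show ?thesis by simp
    qed
    have m: "(\<lambda>v. p (a * u + b * v)) \<in> borel_measurable borel"
      by (rule borel_measurable_continuous_onI[OF pc2])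
    have refl: "gauss_mean (\<lambda>v. p (a * u - b * v)) = gauss_mean (\<lambda>v. p (a * u + b * v))"
      using gauss_mean_reflect[OF m pb] by simp
    have pi': "(\<lambda>v. std_normal_density v *\<^sub>R p (a * u - b * v)) integrable_on UNIV"
      using pi[of "a * u" "- b"] by simp
    have "L (C (a * u) (T s f)) = gauss_mean (\<lambda>v. L (C (a * u) (C (b * v) f)))"
      unfolding weierstrass_linear[OF lin] b_def ..
    also have "\<dots> = gauss_mean (\<lambda>v. (1 / 2) *\<^sub>R (p (a * u + b * v) + p (a * u - b * v)))"
      by (simp only: half)
    also have "\<dots> = (1 / 2) *\<^sub>R (gauss_mean (\<lambda>v. p (a * u + b * v)) + gauss_mean (\<lambda>v. p (a * u - b * v)))"
      using Henstock_Kurzweil_Integration.integral_add[OF pi pi', of "a * u" b]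
        integral_cmul[of UNIV "1 / 2" "\<lambda>v. std_normal_density v * (p (a * u + b * v) + p (a * u - b * v))"]
      by (simp add: gauss_mean_def algebra_simps)
    finally show ?thesis by (simp add: refl)
  qed
  have "L (T t (T s f)) = gauss_mean (\<lambda>u. L (C (a * u) (T s f)))"
    unfolding weierstrass_linear[OF L] a_def ..
  also have "\<dots> = gauss_mean (\<lambda>u. gauss_mean (\<lambda>v. p (a * u + b * v)))"
    by (simp only: inner)
  also have "\<dots> = gauss_mean (\<lambda>z. p (sqrt (a\<^sup>2 + b\<^sup>2) * z))"
    by (rule gauss_mean_gauss_mean[OF pc pb ab(1,2)])
  also have "\<dots> = L (T (t + s) f)"
    unfolding weierstrass_linear[OF L] ab(3) p_def ..
  finally show "L (T t (T s f)) = L (T (t + s) f)" .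
qed

lemma weierstrass_add:
  assumes "t \<ge> 0" "s \<ge> 0"
  shows "T (t + s) f = T t (T s f)"
  using weierstrass_add_pos[of t s f] assms
  by (cases "t = 0"; cases "s = 0") (auto simp: weierstrass_0)

lemma semigroup_weierstrass: "semigroup T"
  unfolding semigroup_def
proof (intro conjI allI impI)
  show "T 0 = id_blinfun" by (rule blinfun_eqI) (simp add: weierstrass_0)
  show "T (t + s) = T t o\<^sub>L T s" if "t \<ge> 0" "s \<ge> 0" for t s
    by (rule blinfun_eqI) (simp add: weierstrass_add[OF that])
  fix f
  have diff: "norm (T t f - T s f) \<le> M * norm (T (t - s) f - f)" if "0 \<le> s" "s \<le> t" for s t
  proof -
    have "T t f - T s f = T s (T (t - s) f - f)"
      using weierstrass_add[of s "t - s" f] that by (simp add: blinfun.bilinear_simps)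
    then show ?thesis
      using norm_blinfun[of "T s" "T (t - s) f - f"] mult_right_mono[OF norm_weierstrass[of s], of "norm (T (t - s) f - f)"]
      by simp
  qed
  show "continuous_on {0..} (\<lambda>t. T t f)"
    unfolding continuous_on_iff
  proof (intro ballI allI impI)
    fix t e :: real assume t: "t \<in> {0..}" and e: "e > 0"
    \<comment> \<open>Chosen so that \<open>M * (2 * e') < e\<close>, since \<open>diff\<close>
      costs a factor \<open>M\<close>.\<close>
    define e' where "e' = e / (2 * (M + 1))"
    have e': "e' > 0" using e M_nonneg by (simp add: e'_def)
    obtain K where K: "\<And>r. r \<ge> 0 \<Longrightarrow> norm (T r f - f) \<le> e' + K * r"
      using weierstrass_minus_id_bound[OF e'] by blast
    define d where "d = e' / (\<bar>K\<bar> + 1)"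
    have d: "d > 0" using e' by (simp add: d_def)
    have "dist (T s f) (T t f) < e" if s: "s \<in> {0..}" "dist s t < d" for s
    proof -
      define r where "r = \<bar>s - t\<bar>"
      have r: "r \<ge> 0" "r < d" using s by (auto simp: r_def dist_real_def)
      have "K * r \<le> (\<bar>K\<bar> + 1) * d" using r by (intro mult_mono) auto
      then have "norm (T r f - f) \<le> 2 * e'" using K[OF r(1)] by (simp add: d_def)
      then have "M * norm (T r f - f) \<le> M * (2 * e')" by (rule mult_left_mono[OF _ M_nonneg])
      also have "\<dots> < (M + 1) * (2 * e')" using e' by simp
      also have "\<dots> = e" using M_nonneg by (simp add: e'_def field_simps)
      finally have "M * norm (T r f - f) < e" .
      then show ?thesis
        using diff[of s t] diff[of t s] s t
        by (cases "s \<le> t") (auto simp: r_def dist_norm norm_minus_commute)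
    qed
    then show "\<exists>d>0. \<forall>s\<in>{0..}. dist s t < d \<longrightarrow> dist (T s f) (T t f) < e"
      using d by blast
  qed
qed

text \<open>For the inclusion of the semigroup generator, the integral \<open>I r x\<close> of the
  orbit over \<open>[0, r]\<close> is shown to lie in the cosine domain with value
  \<open>T r x - x\<close>: for \<open>x\<close> in that domain because \<open>T\<close> and
  \<open>C\<close> commute, for every \<open>x\<close> by density and closedness. Dividing by
  \<open>r\<close> and using closedness once more, as \<open>r\<close> tends to 0, places
  \<open>f\<close> itself in the domain.\<close>

lemma semigroup_generator_weierstrass: "semigroup_generator T = cosine_generator C"
proof
  show "cosine_generator C \<subseteq> semigroup_generator T" using weierstrass_generator by auto
  show "semigroup_generator T \<subseteq> cosine_generator C"
  proof (clarify)
    fix f h assume fh: "(f, h) \<in> semigroup_generator T"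
    have cont: "continuous_on {0..r} (\<lambda>s. T s x)" for r x
      by (rule continuous_on_subset[OF semigroup_continuous[OF semigroup_weierstrass]]) auto
    have int: "(\<lambda>s. T s x) integrable_on {0..r}" for r x
      by (rule integrable_continuous_real[OF cont])
    define I where "I r x = integral {0..r} (\<lambda>s. T s x)" for r x
    have lin: "bounded_linear (I r)" if r: "r \<ge> 0" for r
      unfolding I_def
    proof (rule bounded_linear_intro[of _ "M * r"])
      show "norm (integral {0..r} (\<lambda>s. T s x)) \<le> norm x * (M * r)" for x
      proof -
        have "norm (integral {0..r} (\<lambda>s. T s x)) \<le> integral {0..r} (\<lambda>s. M * norm x)"
          by (intro Henstock_Kurzweil_Integration.integral_norm_bound_integral int)
            (auto intro!: order_trans[OF norm_blinfun] mult_right_mono norm_weierstrass)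
        then show ?thesis using r by (simp add: mult_ac)
      qed
    qed (auto simp: blinfun.bilinear_simps Henstock_Kurzweil_Integration.integral_add[OF int int])
    have dom: "(I r x, T r x - x) \<in> cosine_generator C" if xy: "(x, y) \<in> cosine_generator C" and r: "r \<ge> 0" for r x y
    proof -
      have "C k (I r x) = I r (C k x)" for k
        using integral_linear[OF int[of x r] blinfun.bounded_linear_right[of "C k"]]
        by (simp add: I_def o_def weierstrass_commute)
      then have eq: "(2 / k\<^sup>2) *\<^sub>R (C k (I r x) - I r x) = I r ((2 / k\<^sup>2) *\<^sub>R (C k x - x))" for k
        by (simp add: linear_simps[OF lin[OF r]])
      have "((\<lambda>k. I r ((2 / k\<^sup>2) *\<^sub>R (C k x - x))) \<longlongrightarrow> I r y) (at_right 0)"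
        using xy unfolding cosine_generator_iff[OF C] by (rule bounded_linear.tendsto[OF lin[OF r]])
      moreover have "I r y = T r x - x"
        using semigroup_integral[OF semigroup_weierstrass weierstrass_generator[OF xy] r] by (simp add: I_def)
      ultimately show ?thesis unfolding cosine_generator_iff[OF C] eq by simp
    qed
    have all: "(I r f, T r f - f) \<in> cosine_generator C" if r: "r \<ge> 0" for r
    proof -
      obtain X Y where XY: "\<And>n. (X n, Y n) \<in> cosine_generator C" "X \<longlonglongrightarrow> f"
        by (rule cosine_generator_dense[OF C, of f], rule that)
      show ?thesis
      proof (rule cosine_generator_closed[OF C M])
        show "(I r (X n), T r (X n) - X n) \<in> cosine_generator C" for n by (rule dom[OF XY(1) r])
        show "(\<lambda>n. I r (X n)) \<longlonglongrightarrow> I r f" by (rule bounded_linear.tendsto[OF lin[OF r] XY(2)])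
        show "(\<lambda>n. T r (X n) - X n) \<longlonglongrightarrow> T r f - f" by (intro tendsto_intros XY(2))
      qed
    qed
    define r where "r n = 1 / real (Suc n)" for n
    have r0: "r n \<ge> 0" for n by (simp add: r_def)
    have rlim: "filterlim r (at_right 0) sequentially"
      unfolding r_def filterlim_at using LIMSEQ_inverse_real_of_nat
      by (auto simp: inverse_eq_divide)
    show "(f, h) \<in> cosine_generator C"
    proof (rule cosine_generator_closed[OF C M cosine_generator_scaleR[OF all[OF r0]]])
      have "((\<lambda>r. I r f) has_vector_derivative T 0 f) (at 0 within {0..1})"
        unfolding I_def by (rule integral_has_vector_derivative[OF cont]) simp
      from has_vector_derivative_imp_right_quotient[OF this]
      have "((\<lambda>k. (1 / k) *\<^sub>R I k f) \<longlongrightarrow> f) (at_right 0)" by (simp add: weierstrass_0 I_def)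
      from filterlim_compose[OF this rlim] show "(\<lambda>n. (1 / r n) *\<^sub>R I (r n) f) \<longlonglongrightarrow> f" .
      show "(\<lambda>n. (1 / r n) *\<^sub>R (T (r n) f - f)) \<longlonglongrightarrow> h"
        using filterlim_compose[OF _ rlim] fh by (auto simp: semigroup_generator_def)
    qed
  qed
qed

theorem generated_semigroup_weierstrass:
  assumes "t \<ge> 0"
  shows "generated_semigroup (cosine_generator C) t = weierstrass C t"
  unfolding semigroup_generator_weierstrass[symmetric]
proof (rule generated_semigroup_eq[OF semigroup_weierstrass norm_weierstrass _ assms])
  show "\<exists>X. (\<forall>n::nat. X n \<in> Domain (semigroup_generator T)) \<and> X \<longlonglongrightarrow> x" for x
    unfolding semigroup_generator_weierstrass using cosine_generator_dense[OF C, of x] by (metis DomainI)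
qed

end

section \<open>Relaxation at the interface and extension to the line\<close>

lemma abs_Rep_cinf_le: "\<bar>Rep_cinf f x\<bar> \<le> norm f"
  unfolding norm_cinf_def by (rule abs_le_supnorm[OF bounded_Rep_cinf]) simp

lemma norm_cinf_le: "(\<And>x. \<bar>Rep_cinf f x\<bar> \<le> M) \<Longrightarrow> norm f \<le> M"
  unfolding norm_cinf_def by (rule supnorm_le) auto

lemma uniformly_continuous_C_infty:
  assumes "g \<in> C_infty"
  shows "uniformly_continuous_on UNIV g"
  unfolding uniformly_continuous_on_def
proof (intro allI impI)
  fix e :: real assume e: "e > 0"
  obtain k l where g: "continuous_on UNIV g" "(g \<longlongrightarrow> k) at_bot" "(g \<longlongrightarrow> l) at_top"
    using assms by (auto simp: C_infty_def)
  obtain A where A: "\<And>x. x \<le> A \<Longrightarrow> dist (g x) k < e / 2"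
    using tendstoD[OF g(2), of "e / 2"] e unfolding eventually_at_bot_linorder by auto
  obtain B where B: "\<And>x. x \<ge> B \<Longrightarrow> dist (g x) l < e / 2"
    using tendstoD[OF g(3), of "e / 2"] e unfolding eventually_at_top_linorder by auto
  have "uniformly_continuous_on {A - 1..B + 1} g"
    by (intro compact_uniformly_continuous continuous_on_subset[OF g(1)]) auto
  then obtain d where d: "d > 0"
    "\<And>x y. x \<in> {A - 1..B + 1} \<Longrightarrow> y \<in> {A - 1..B + 1} \<Longrightarrow> dist y x < d \<Longrightarrow> dist (g y) (g x) < e"
    unfolding uniformly_continuous_on_def using e by metis
  \<comment> \<open>The margin 1 around \<open>[A, B]\<close> ensures that two points closer than 1
    lie together in one of three regions.\<close>
  have "dist (g y) (g x) < e" if xy: "dist y x < min d 1" for x y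
  proof -
    have "\<bar>y - x\<bar> < 1" "dist y x < d" using xy by (auto simp: dist_real_def)
    then consider "x \<le> A" "y \<le> A" | "x \<ge> B" "y \<ge> B" | "x \<in> {A - 1..B + 1}" "y \<in> {A - 1..B + 1}"
      by fastforce
    then show ?thesis
    proof cases
      case 1
      then show ?thesis using dist_triangle_half_l[of "g y" k e "g x"] A[of x] A[of y] by simp
    next
      case 2
      then show ?thesis using dist_triangle_half_l[of "g y" l e "g x"] B[of x] B[of y] by simp
    qed (use d \<open>dist y x < d\<close> in auto)
  qed
  then show "\<exists>d>0. \<forall>x\<in>UNIV. \<forall>x'\<in>UNIV. dist x' x < d \<longrightarrow> dist (g x') (g x) < e"
    using d(1) by (intro exI[of _ "min d 1"]) auto
qed

lemma uniformly_continuous_on_subset: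
  fixes f :: "'a::metric_space \<Rightarrow> 'b::metric_space"
  assumes "uniformly_continuous_on S f" "U \<subseteq> S"
  shows "uniformly_continuous_on U f"
  unfolding uniformly_continuous_on_def
proof (intro allI impI)
  fix e :: real assume "e > 0"
  then obtain d where "d > 0" "\<forall>x\<in>S. \<forall>x'\<in>S. dist x' x < d \<longrightarrow> dist (f x') (f x) < e"
    using assms(1) unfolding uniformly_continuous_on_def by blast
  then show "\<exists>d>0. \<forall>x\<in>U. \<forall>x'\<in>U. dist x' x < d \<longrightarrow> dist (f x') (f x) < e"
    using assms(2) by (intro exI[of _ d]) blast
qed

text \<open>For \<open>d = 0\<close> the derivative hypothesis forces \<open>k = 0\<close>.\<close>

lemma relaxation_comparison:
  fixes z k :: "real \<Rightarrow> real"
  assumes d: "d \<ge> 0" and X: "X \<ge> 0"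
    and z: "\<And>x. 0 \<le> x \<Longrightarrow> x \<le> X \<Longrightarrow> ((\<lambda>x. d * z x) has_real_derivative k x) (at x)"
    and le: "\<And>x. 0 \<le> x \<Longrightarrow> x \<le> X \<Longrightarrow> k x + z x \<le> 0" and z0: "z 0 \<le> 0"
  shows "z X \<le> 0"
proof (cases "d = 0")
  case True
  then have "((\<lambda>x. 0) has_real_derivative k X) (at X)" using z[of X] X by simp
  then have "k X = 0" by (rule DERIV_unique[OF _ DERIV_const])
  then show ?thesis using le[of X] X by simp
next
  case False
  then have d0: "d > 0" using d by simp
  have "exp (X / d) * (d * z X) \<le> exp (0 / d) * (d * z 0)"
  proof (rule DERIV_nonpos_imp_nonincreasing[OF X])
    fix x assume x: "0 \<le> x" "x \<le> X"
    have "((\<lambda>x. exp (x / d) * (d * z x)) has_real_derivative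
        exp (x / d) * (1 / d) * (d * z x) + k x * exp (x / d)) (at x)"
      using d0 by (intro DERIV_mult[OF DERIV_fun_exp z[OF x]] DERIV_cdivide DERIV_ident)
    moreover have "exp (x / d) * (1 / d) * (d * z x) + k x * exp (x / d) = exp (x / d) * (k x + z x)"
      using d0 by (simp add: algebra_simps)
    moreover have "exp (x / d) * (k x + z x) \<le> 0" using le[OF x] by (simp add: mult_le_0_iff)
    ultimately show "\<exists>y. ((\<lambda>x. exp (x / d) * (d * z x)) has_real_derivative y) (at x) \<and> y \<le> 0" by metis
  qed
  also have "\<dots> \<le> 0" using d0 z0 by (simp add: mult_le_0_iff)
  finally show ?thesis using d0 by (simp add: mult_le_0_iff)
qed

text \<open>On \<open>[0, \<infinity>)\<close> this is variation of constants. The initial value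
  \<open>Q 0 = w 0\<close> makes the right-hand side vanish at 0, so the even reflection of the
  solution is differentiable across 0. For \<open>d = 0\<close> the equation is algebraic, with
  solution \<open>w |x|\<close>.\<close>

lemma relaxation_exists:
  fixes w :: "real \<Rightarrow> real"
  assumes w: "continuous_on UNIV w" and d: "d \<ge> 0"
  shows "\<exists>Q. continuous_on UNIV Q \<and> Q 0 = w 0 \<and> (\<forall>x. Q (- x) = Q x) \<and>
    (\<forall>x. ((\<lambda>x. d * Q x) has_real_derivative (if x \<ge> 0 then w x - Q x else Q x - w (- x))) (at x))"
proof (cases "d = 0")
  case True
  then show ?thesis
    by (intro exI[of _ "\<lambda>x. w \<bar>x\<bar>"]) (auto intro!: continuous_on_compose2[OF w] continuous_intros)
next
  case False
  then have d0: "d > 0" using d by simp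
  have wc: "isCont w x" for x using w by (simp add: continuous_on_eq_continuous_at)
  have "continuous_on UNIV (\<lambda>y. exp (y / d) * w y / d)"
    using d0 by (intro continuous_intros w) auto
  then obtain H where H: "\<And>x. (H has_real_derivative exp (x / d) * w x / d) (at x)" "H 0 = 0"
    by (rule antiderivative_at_0) (auto simp: has_real_derivative_iff_has_vector_derivative)
  define q where "q x = exp (- x / d) * (w 0 + H x)" for x
  have q': "(q has_real_derivative (w x - q x) / d) (at x)" for x
  proof -
    have "((\<lambda>x. exp (- x / d) * (w 0 + H x)) has_real_derivative
        exp (- x / d) * (- 1 / d) * (w 0 + H x) + (0 + exp (x / d) * w x / d) * exp (- x / d)) (at x)"
      using d0 by (intro DERIV_mult DERIV_fun_exp DERIV_add DERIV_const H) (auto intro!: derivative_eq_intros)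
    moreover have "exp (- x / d) * exp (x / d) = 1" by (simp add: exp_add[symmetric])
    then have "exp (- x / d) * (- 1 / d) * (w 0 + H x) + (0 + exp (x / d) * w x / d) * exp (- x / d)
        = (w x - q x) / d"
      using d0 by (simp add: q_def field_simps)
    ultimately show ?thesis by (simp add: q_def[abs_def])
  qed
  define m where "m x = w x - q x" for x
  have m0: "m 0 = 0" by (simp add: m_def q_def H(2))
  have mc: "continuous_on UNIV m"
    unfolding m_def using q' by (intro continuous_intros w DERIV_continuous_on) (auto intro: has_field_derivative_at_within)
  \<comment> \<open>The odd reflection of \<open>m\<close>, continuous because
    \<open>m 0 = 0\<close>; its antiderivative is the even solution, so no half-line solutions have
    to be glued.\<close>
  define k where "k x = m (max x 0) - m (max (- x) 0)" for x
  have "continuous_on UNIV (\<lambda>x. k x / d)"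
    unfolding k_def using d0 by (intro continuous_intros continuous_on_compose2[OF mc]) auto
  then obtain K where K: "\<And>x. (K has_real_derivative k x / d) (at x)" "K 0 = 0"
    by (rule antiderivative_at_0) (auto simp: has_real_derivative_iff_has_vector_derivative)
  define Q where "Q x = w 0 + K x" for x
  have Q': "(Q has_real_derivative k x / d) (at x)" for x
    unfolding Q_def using DERIV_add[OF DERIV_const K(1)] by simp
  have Qm: "((\<lambda>x. Q (- x)) has_real_derivative - (k (- x) / d)) (at x)" for x
    using DERIV_chain2[OF Q' DERIV_minus[OF DERIV_ident]] by simp
  have even: "Q (- x) = Q x" for x
  proof -
    have "((\<lambda>x. Q (- x) - Q x) has_real_derivative 0) (at x)" for x
    proof -
      have "- (k (- x) / d) - k x / d = 0" by (simp add: k_def diff_divide_distrib)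
      then show ?thesis using DERIV_diff[OF Qm Q', of x] by simp
    qed
    then have "Q (- x) - Q x = Q (- 0) - Q 0" using DERIV_isconst_all by blast
    then show ?thesis by simp
  qed
  have Qq: "Q x = q x" if "x \<ge> 0" for x
  proof -
    have "\<exists>c. \<forall>x\<in>{0..}. Q x - q x = c"
    proof (rule has_field_derivative_zero_constant)
      fix x :: real assume "x \<in> {0..}"
      then have "k x = w x - q x" using m0 by (simp add: k_def m_def)
      then show "((\<lambda>x. Q x - q x) has_real_derivative 0) (at x within {0..})"
        using DERIV_diff[OF Q' q', of x] by (simp add: has_field_derivative_at_within)
    qed simp
    then have "Q x - q x = Q 0 - q 0" using that by auto
    then show ?thesis by (simp add: Q_def q_def K(2) H(2))
  qed
  have "((\<lambda>x. d * Q x) has_real_derivative (if x \<ge> 0 then w x - Q x else Q x - w (- x))) (at x)" for x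
  proof -
    have "k x = (if x \<ge> 0 then w x - Q x else Q x - w (- x))"
      using m0 Qq[of x] Qq[of "- x"] even[of x] by (auto simp: k_def m_def)
    then show ?thesis using DERIV_cmult[OF Q', of d x] d0 by simp
  qed
  moreover have "continuous_on UNIV Q"
    using Q' by (intro DERIV_continuous_on) (auto intro: has_field_derivative_at_within)
  moreover have "Q 0 = w 0" by (simp add: Q_def K(2))
  ultimately show ?thesis using even by (intro exI[of _ Q]) simp
qed

text \<open>A pair \<open>(a, b)\<close> is compatible if its common even part \<open>q\<close> satisfies
  \<open>d q' = p a\<^sub>o - (1 - p) b\<^sub>o\<close>, with \<open>a\<^sub>o, b\<^sub>o\<close> the odd parts (everything doubled). For
  \<open>d = 0\<close> the derivative condition says that the right-hand side vanishes.\<close>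

definition compat :: "real \<Rightarrow> real \<Rightarrow> (real \<Rightarrow> real) \<Rightarrow> (real \<Rightarrow> real) \<Rightarrow> bool" where
  "compat p d a b \<longleftrightarrow> (\<forall>x. a x + a (- x) = b x + b (- x)) \<and>
    (\<forall>x. ((\<lambda>x. d * (a x + a (- x))) has_real_derivative
      p * (a x - a (- x)) - (1 - p) * (b x - b (- x))) (at x))"

lemma compat_lincomb:
  assumes "compat p d a b" "compat p d a' b'"
  shows "compat p d (\<lambda>x. s * a x + t * a' x) (\<lambda>x. s * b x + t * b' x)"
  unfolding compat_def
proof (intro conjI allI)
  fix x
  have "s * (a x + a (- x)) + t * (a' x + a' (- x)) = s * (b x + b (- x)) + t * (b' x + b' (- x))"
    using assms by (simp add: compat_def)
  then show "s * a x + t * a' x + (s * a (- x) + t * a' (- x)) = s * b x + t * b' x + (s * b (- x) + t * b' (- x))"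
    by (simp add: algebra_simps)
  have "((\<lambda>x. s * (d * (a x + a (- x))) + t * (d * (a' x + a' (- x)))) has_real_derivative
      s * (p * (a x - a (- x)) - (1 - p) * (b x - b (- x)))
      + t * (p * (a' x - a' (- x)) - (1 - p) * (b' x - b' (- x)))) (at x)"
    using assms unfolding compat_def by (intro DERIV_add DERIV_cmult) auto
  then show "((\<lambda>x. d * (s * a x + t * a' x + (s * a (- x) + t * a' (- x)))) has_real_derivative
      p * (s * a x + t * a' x - (s * a (- x) + t * a' (- x)))
      - (1 - p) * (s * b x + t * b' x - (s * b (- x) + t * b' (- x)))) (at x)"
    by (simp add: algebra_simps)
qed

text \<open>Reflection swaps the two shifts, \<open>- x + t = - (x - t)\<close>. Hence sums and
  differences over \<open>x\<close> and \<open>- x\<close> of the averaged functions are averages of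
  those of \<open>a\<close> and \<open>b\<close> at \<open>x + t\<close> and
  \<open>x - t\<close>.\<close>

lemma compat_shift:
  assumes "compat p d a b"
  shows "compat p d (\<lambda>x. (a (x + t) + a (x - t)) / 2) (\<lambda>x. (b (x + t) + b (x - t)) / 2)"
  unfolding compat_def
proof (intro conjI allI)
  fix x
  have e: "a y + a (- y) = b y + b (- y)" for y using assms by (simp add: compat_def)
  have m: "- x + t = - (x - t)" "- x - t = - (x + t)" by auto
  show "(a (x + t) + a (x - t)) / 2 + (a (- x + t) + a (- x - t)) / 2
      = (b (x + t) + b (x - t)) / 2 + (b (- x + t) + b (- x - t)) / 2"
    unfolding m using e[of "x + t"] e[of "x - t"] by argo
  have D: "((\<lambda>x. d * (a (x + s) + a (- (x + s)))) has_real_derivative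
      p * (a (x + s) - a (- (x + s))) - (1 - p) * (b (x + s) - b (- (x + s)))) (at x)" for s
  proof -
    have "((\<lambda>x. d * (a x + a (- x))) has_real_derivative
        p * (a (x + s) - a (- (x + s))) - (1 - p) * (b (x + s) - b (- (x + s)))) (at (x + s))"
      using assms unfolding compat_def by blast
    then show ?thesis by (subst (asm) DERIV_shift)
  qed
  have "((\<lambda>x. (d * (a (x + t) + a (- (x + t))) + d * (a (x + - t) + a (- (x + - t)))) / 2) has_real_derivative
      ((p * (a (x + t) - a (- (x + t))) - (1 - p) * (b (x + t) - b (- (x + t))))
      + (p * (a (x + - t) - a (- (x + - t))) - (1 - p) * (b (x + - t) - b (- (x + - t))))) / 2) (at x)"
    by (intro DERIV_cdivide DERIV_add D)
  moreover have "(\<lambda>x. (d * (a (x + t) + a (- (x + t))) + d * (a (x + - t) + a (- (x + - t)))) / 2)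
      = (\<lambda>x. d * ((a (x + t) + a (x - t)) / 2 + (a (- x + t) + a (- x - t)) / 2))"
  proof
    fix y
    have n: "- (y + t) = - y - t" "- (y + - t) = - y + t" "y + - t = y - t" by auto
    show "(d * (a (y + t) + a (- (y + t))) + d * (a (y + - t) + a (- (y + - t)))) / 2
        = d * ((a (y + t) + a (y - t)) / 2 + (a (- y + t) + a (- y - t)) / 2)"
      unfolding n by argo
  qed
  moreover have "((p * (a (x + t) - a (- (x + t))) - (1 - p) * (b (x + t) - b (- (x + t))))
      + (p * (a (x + - t) - a (- (x + - t))) - (1 - p) * (b (x + - t) - b (- (x + - t))))) / 2
      = p * ((a (x + t) + a (x - t)) / 2 - (a (- x + t) + a (- x - t)) / 2)
      - (1 - p) * ((b (x + t) + b (x - t)) / 2 - (b (- x + t) + b (- x - t)) / 2)"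
  proof -
    have n: "- (x + t) = - x - t" "- (x + - t) = - x + t" "x + - t = x - t" by auto
    show ?thesis unfolding n by argo
  qed
  ultimately show "((\<lambda>x. d * ((a (x + t) + a (x - t)) / 2 + (a (- x + t) + a (- x - t)) / 2)) has_real_derivative
      p * ((a (x + t) + a (x - t)) / 2 - (a (- x + t) + a (- x - t)) / 2)
      - (1 - p) * ((b (x + t) + b (x - t)) / 2 - (b (- x + t) + b (- x - t)) / 2)) (at x)"
    by (simp only:)
qed

text \<open>For \<open>g = J f\<close>, \<open>p = \<beta> / (\<alpha> + \<beta>)\<close> and
  \<open>d = 1 / (\<alpha> + \<beta>)\<close>, solving the relaxation equation recovers the explicit
  extensions with kernel \<open>exp (- (\<alpha> + \<beta>) (x - y))\<close>: \<open>a\<close> is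
  the one of the right part of \<open>f\<close> and \<open>b\<close> is minus the one of the left
  part.\<close>

definition extends :: "real \<Rightarrow> real \<Rightarrow> (real \<Rightarrow> real) \<Rightarrow> (real \<Rightarrow> real) \<Rightarrow> (real \<Rightarrow> real) \<Rightarrow> bool" where
  "extends p d g a b \<longleftrightarrow> compat p d a b \<and> (\<forall>x\<ge>0. a x = g x) \<and> (\<forall>x\<le>0. b x = g x)"

definition weighted :: "real \<Rightarrow> (real \<Rightarrow> real) \<Rightarrow> real \<Rightarrow> real" where
  "weighted p g x = p * g x + (1 - p) * g (- x)"

lemma extends_lincomb:
  assumes "extends p d f a b" "extends p d g a' b'"
  shows "extends p d (\<lambda>x. s * f x + t * g x) (\<lambda>x. s * a x + t * a' x) (\<lambda>x. s * b x + t * b' x)"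
  using assms compat_lincomb by (simp add: extends_def)

lemma extends_even_ode:
  assumes e: "extends p d g a b" and x: "x \<ge> 0"
  shows "((\<lambda>x. d * (a x + a (- x))) has_real_derivative 2 * weighted p g x - (a x + a (- x))) (at x)"
proof -
  have c: "compat p d a b" and ab: "a x = g x" "b (- x) = g (- x)" using e x by (auto simp: extends_def)
  have "a x + a (- x) = b x + b (- x)" using c by (simp add: compat_def)
  then have bx: "b x = g x + a (- x) - g (- x)" using ab by simp
  have eq: "p * (a x - a (- x)) - (1 - p) * (b x - b (- x)) = 2 * weighted p g x - (a x + a (- x))"
    unfolding bx ab weighted_def by (simp add: algebra_simps)
  have "((\<lambda>x. d * (a x + a (- x))) has_real_derivative
      p * (a x - a (- x)) - (1 - p) * (b x - b (- x))) (at x)"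
    using c unfolding compat_def by blast
  then show ?thesis unfolding eq .
qed

text \<open>One formula for the whole line, so that uniform continuity passes to \<open>a\<close>
  and \<open>b\<close> without gluing at 0. On the side where the extension is \<open>g\<close>, the
  surplus terms cancel because the doubled even part at 0 is \<open>2 * g 0\<close>.\<close>

lemma extends_outer:
  assumes e: "extends p d g a b"
  shows "a x = g (max x 0) + (a (max (- x) 0) + a (- max (- x) 0)) - g (max (- x) 0) - g 0"
    and "b x = g (min x 0) + (a (max x 0) + a (- max x 0)) - g (min (- x) 0) - g 0"
proof -
  have c: "a x + a (- x) = b x + b (- x)" for x using e by (simp add: extends_def compat_def)
  have ab: "x \<ge> 0 \<Longrightarrow> a x = g x" "x \<le> 0 \<Longrightarrow> b x = g x" for x using e by (auto simp: extends_def)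
  show "a x = g (max x 0) + (a (max (- x) 0) + a (- max (- x) 0)) - g (max (- x) 0) - g 0"
    using ab(1)[of x] ab(1)[of "- x"] ab(1)[of 0] by (cases "x \<ge> 0") (auto simp: max_def)
  show "b x = g (min x 0) + (a (max x 0) + a (- max x 0)) - g (min (- x) 0) - g 0"
    using ab(2)[of x] ab(2)[of "- x"] ab(1)[of 0] c[of x] by (cases "x \<ge> 0") (auto simp: max_def min_def)
qed

lemma weighted_0: "weighted p g 0 = g 0"
  by (simp add: weighted_def algebra_simps)

locale transmission =
  fixes p d :: real
  assumes p: "0 \<le> p" "p \<le> 1" and d: "0 \<le> d"
begin

lemma weighted_diff_le:
  assumes "\<bar>g x - u\<bar> \<le> M" "\<bar>g (- x) - v\<bar> \<le> M"
  shows "\<bar>weighted p g x - (p * u + (1 - p) * v)\<bar> \<le> M"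
proof -
  have "weighted p g x - (p * u + (1 - p) * v) = p * (g x - u) + (1 - p) * (g (- x) - v)"
    by (simp add: weighted_def algebra_simps)
  moreover have "\<bar>p * (g x - u)\<bar> \<le> p * M" "\<bar>(1 - p) * (g (- x) - v)\<bar> \<le> (1 - p) * M"
    using assms p by (auto simp: abs_mult intro!: mult_left_mono)
  moreover have "p * M + (1 - p) * M = M" by (simp add: algebra_simps)
  ultimately show ?thesis by linarith
qed

lemma weighted_bound:
  assumes "\<And>x. \<bar>g x\<bar> \<le> M"
  shows "\<bar>weighted p g x\<bar> \<le> M"
  using weighted_diff_le[of g x 0 M 0] assms by simp

text \<open>The constant \<open>2 * M\<close> is a supersolution of \<open>d E' = 2 w - E\<close>,
  and it dominates the initial value because \<open>E 0 = 2 * g 0 = 2 * w 0\<close>.\<close>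

lemma extends_even_upper:
  assumes e: "extends p d g a b" and M: "\<And>x. weighted p g x \<le> M" and x: "x \<ge> 0"
  shows "a x + a (- x) \<le> 2 * M"
proof -
  have a0: "a 0 = g 0" using e by (simp add: extends_def)
  have "(a x + a (- x)) - 2 * M \<le> 0"
  proof (rule relaxation_comparison[OF d x, where k = "\<lambda>x. 2 * weighted p g x - (a x + a (- x)) - 0"])
    fix y :: real assume y: "0 \<le> y"
    have "((\<lambda>x. d * (a x + a (- x)) - d * (2 * M)) has_real_derivative 2 * weighted p g y - (a y + a (- y)) - 0) (at y)"
      by (intro DERIV_diff extends_even_ode[OF e y] DERIV_const)
    then show "((\<lambda>x. d * ((a x + a (- x)) - 2 * M)) has_real_derivative 2 * weighted p g y - (a y + a (- y)) - 0) (at y)"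
      by (simp add: algebra_simps)
    show "2 * weighted p g y - (a y + a (- y)) - 0 + ((a y + a (- y)) - 2 * M) \<le> 0" using M[of y] by simp
  qed (use M[of 0] in \<open>simp add: a0 weighted_0\<close>)
  then show ?thesis by simp
qed

lemma extends_uminus:
  assumes "extends p d g a b"
  shows "extends p d (\<lambda>x. - g x) (\<lambda>x. - a x) (\<lambda>x. - b x)"
  using extends_lincomb[OF assms assms, of "-1" 0] by simp

lemma extends_even_bound:
  assumes e: "extends p d g a b" and M: "\<And>x. \<bar>g x\<bar> \<le> M" and x: "x \<ge> 0"
  shows "\<bar>a x + a (- x)\<bar> \<le> 2 * M"
proof -
  have "weighted p g y \<le> M" "weighted p (\<lambda>x. - g x) y \<le> M" for y
    using weighted_bound[of g M y] weighted_bound[of "\<lambda>x. - g x" M y] M by auto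
  then show ?thesis
    using extends_even_upper[OF e _ x] extends_even_upper[OF extends_uminus[OF e] _ x] by fastforce
qed

text \<open>On its outer side an extension is the doubled even part, at most \<open>2 * M\<close>,
  minus a value of \<open>g\<close>. Hence the factor 3, independent of \<open>p\<close> and
  \<open>d\<close>, which becomes the norm bound of the cosine families.\<close>

lemma extends_bound:
  assumes e: "extends p d g a b" and M: "\<And>x. \<bar>g x\<bar> \<le> M"
  shows "\<bar>a x\<bar> \<le> 3 * M" "\<bar>b x\<bar> \<le> 3 * M"
proof -
  have c: "a x + a (- x) = b x + b (- x)" for x using e by (simp add: extends_def compat_def)
  have ab: "x \<ge> 0 \<Longrightarrow> a x = g x" "x \<le> 0 \<Longrightarrow> b x = g x" for x using e by (auto simp: extends_def)
  note E = extends_even_bound[OF e M]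
  show "\<bar>a x\<bar> \<le> 3 * M"
    using ab(1)[of x] ab(1)[of "- x"] E[of "- x"] M[of x] M[of "- x"] by (cases "x \<ge> 0") auto
  show "\<bar>b x\<bar> \<le> 3 * M"
    using ab(2)[of x] ab(2)[of "- x"] E[of x] c[of x] M[of x] M[of "- x"] by (cases "x \<le> 0") auto
qed

text \<open>By linearity the difference of two extensions extends 0, and the bound with
  \<open>M = 0\<close> makes it vanish.\<close>

lemma extends_unique:
  assumes "extends p d g a b" "extends p d g a' b'"
  shows "a = a'" "b = b'"
proof -
  have "extends p d (\<lambda>x. 0) (\<lambda>x. a x - a' x) (\<lambda>x. b x - b' x)"
    using extends_lincomb[OF assms, of 1 "-1"] by simp
  from extends_bound[OF this, of 0] show "a = a'" "b = b'" by (auto simp: fun_eq_iff)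
qed

lemma extends_exists:
  assumes g: "continuous_on UNIV g"
  shows "\<exists>a b. extends p d g a b"
proof -
  have "continuous_on UNIV (weighted p g)"
    unfolding weighted_def by (intro continuous_intros continuous_on_compose2[OF g]) auto
  from relaxation_exists[OF this d] obtain Q where
    Q: "Q 0 = g 0" "\<And>x. Q (- x) = Q x"
      "\<And>x. ((\<lambda>x. d * Q x) has_real_derivative (if x \<ge> 0 then weighted p g x - Q x else Q x - weighted p g (- x))) (at x)"
    by (auto simp: weighted_0)
  define a where "a x = (if x \<ge> 0 then g x else 2 * Q x - g (- x))" for x
  define b where "b x = (if x \<le> 0 then g x else 2 * Q x - g (- x))" for x
  have E: "a x + a (- x) = 2 * Q x" "b x + b (- x) = 2 * Q x" for x
    using Q(1,2) by (cases "x = 0"; auto simp: a_def b_def)+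
  have "compat p d a b"
    unfolding compat_def
  proof (intro conjI allI)
    fix x
    show "a x + a (- x) = b x + b (- x)" by (simp add: E)
    have "((\<lambda>x. 2 * (d * Q x)) has_real_derivative
        2 * (if x \<ge> 0 then weighted p g x - Q x else Q x - weighted p g (- x))) (at x)"
      by (intro DERIV_cmult Q(3))
    moreover have "p * (a x - a (- x)) - (1 - p) * (b x - b (- x))
        = 2 * (if x \<ge> 0 then weighted p g x - Q x else Q x - weighted p g (- x))"
      using Q(1) Q(2)[of x] by (cases "x = 0") (auto simp: a_def b_def weighted_def algebra_simps)
    ultimately show "((\<lambda>x. d * (a x + a (- x))) has_real_derivative
        p * (a x - a (- x)) - (1 - p) * (b x - b (- x))) (at x)"
      by (simp add: E mult.left_commute)
  qed
  then have "extends p d g a b" by (simp add: extends_def a_def b_def)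
  then show ?thesis by blast
qed

text \<open>This yields strong continuity of the family. For \<open>d > 0\<close> the equation makes
  \<open>E\<close> Lipschitz with constant \<open>4 * M / d\<close>, which blows up as
  \<open>d\<close> tends to 0; for \<open>d = 0\<close> the explicit value \<open>E = 2 w\<close> is
  used instead.\<close>

lemma uniformly_continuous_extends:
  assumes e: "extends p d g a b" and g: "g \<in> C_infty"
  shows "uniformly_continuous_on UNIV a" "uniformly_continuous_on UNIV b"
proof -
  have ug: "uniformly_continuous_on UNIV g" by (rule uniformly_continuous_C_infty[OF g])
  obtain M where M: "\<And>x. \<bar>g x\<bar> \<le> M"
    using bounded_fun_C_infty[OF g] by (auto simp: bounded_fun_def)
  define E where "E x = a x + a (- x)" for x
  have comp: "uniformly_continuous_on UNIV (\<lambda>x. f (h x))"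
    if "uniformly_continuous_on S f" "uniformly_continuous_on UNIV h" "\<And>x. h x \<in> S"
    for f h :: "real \<Rightarrow> real" and S
    using uniformly_continuous_on_compose[OF that(2), of f] uniformly_continuous_on_subset[OF that(1)] that(3)
    by blast
  have lip: "uniformly_continuous_on UNIV h" if "\<And>x y. \<bar>h x - h y\<bar> \<le> \<bar>x - y\<bar>" for h :: "real \<Rightarrow> real"
    unfolding uniformly_continuous_on_def dist_real_def using that by (meson le_less_trans)
  have uE: "uniformly_continuous_on {0..} E"
  proof (cases "d = 0")
    case True
    have "E x = 2 * weighted p g x" if "x \<in> {0..}" for x
      using extends_even_ode[OF e, of x] that True DERIV_unique[OF _ DERIV_const] by (fastforce simp: E_def)
    moreover have "uniformly_continuous_on UNIV (\<lambda>x. 2 * (p * g x + (1 - p) * g (- x)))"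
      by (intro uniformly_continuous_on_cmul_left uniformly_continuous_on_add ug comp[OF ug] lip) auto
    then have "uniformly_continuous_on {0..} (\<lambda>x. 2 * weighted p g x)"
      unfolding weighted_def by (rule uniformly_continuous_on_subset) simp
    ultimately show ?thesis by (simp add: uniformly_continuous_on_def)
  next
    case False
    have E': "(E has_real_derivative (2 * weighted p g x - E x) / d) (at x within {0..})" if "x \<in> {0..}" for x
      using DERIV_cdivide[OF extends_even_ode[OF e, of x], of d] that False
      by (simp add: E_def[abs_def] has_field_derivative_at_within)
    have "norm (E x - E y) \<le> (4 * M / d) * norm (x - y)" if "x \<in> {0..}" "y \<in> {0..}" for x y
    proof (rule field_differentiable_bound[OF _ E' _ that])
      fix z :: real assume z: "z \<in> {0..}"
      have "\<bar>2 * weighted p g z - E z\<bar> \<le> 4 * M"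
        using weighted_bound[of g M z, OF M] extends_even_bound[OF e M, of z] z by (simp add: E_def)
      then show "norm ((2 * weighted p g z - E z) / d) \<le> 4 * M / d"
        using d False by (simp add: divide_right_mono)
    qed auto
    then have "(4 * M / d)-lipschitz_on {0..} E"
      using M[of 0] d by (intro lipschitz_onI) (auto simp: dist_norm)
    then show ?thesis by (rule lipschitz_on_uniformly_continuous)
  qed
  have mm: "uniformly_continuous_on UNIV (\<lambda>x::real. max x 0)" "uniformly_continuous_on UNIV (\<lambda>x::real. max (- x) 0)"
    "uniformly_continuous_on UNIV (\<lambda>x::real. min x 0)" "uniformly_continuous_on UNIV (\<lambda>x::real. min (- x) 0)"
    by (rule lip, auto simp: max_def min_def)+
  have "uniformly_continuous_on UNIV (\<lambda>x. g (max x 0) + E (max (- x) 0) - g (max (- x) 0) - g 0)"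
    "uniformly_continuous_on UNIV (\<lambda>x. g (min x 0) + E (max x 0) - g (min (- x) 0) - g 0)"
    by (intro uniformly_continuous_on_diff uniformly_continuous_on_add uniformly_continuous_on_const
        comp[OF ug] comp[OF uE] mm; simp)+
  then show "uniformly_continuous_on UNIV a" "uniformly_continuous_on UNIV b"
    unfolding E_def extends_outer[OF e, symmetric] by auto
qed

end

section \<open>The cosine family of the transmission problem\<close>

context transmission
begin

definition right_ext :: "cinf \<Rightarrow> real \<Rightarrow> real" where
  "right_ext g = (THE a. \<exists>b. extends p d (Rep_cinf g) a b)"

definition left_ext :: "cinf \<Rightarrow> real \<Rightarrow> real" where
  "left_ext g = (THE b. \<exists>a. extends p d (Rep_cinf g) a b)"

lemma ext_eqI:
  assumes "extends p d (Rep_cinf g) a b"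
  shows "right_ext g = a" "left_ext g = b"
  unfolding right_ext_def left_ext_def using assms extends_unique by (blast intro: the_equality)+

lemma extends_ext: "extends p d (Rep_cinf g) (right_ext g) (left_ext g)"
proof -
  have "continuous_on UNIV (Rep_cinf g)" using Rep_cinf[of g] by (simp add: C_infty_def)
  then obtain a b where "extends p d (Rep_cinf g) a b" using extends_exists by blast
  then show ?thesis using ext_eqI by metis
qed

lemma right_ext_nonneg: "x \<ge> 0 \<Longrightarrow> right_ext g x = Rep_cinf g x"
  and left_ext_nonpos: "x \<le> 0 \<Longrightarrow> left_ext g x = Rep_cinf g x"
  and ext_even: "right_ext g x + right_ext g (- x) = left_ext g x + left_ext g (- x)"
  using extends_ext[of g] by (auto simp: extends_def compat_def)

lemma ext_bound: "\<bar>right_ext g x\<bar> \<le> 3 * norm g" "\<bar>left_ext g x\<bar> \<le> 3 * norm g"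
  using extends_bound[OF extends_ext abs_Rep_cinf_le] by auto

lemma uniformly_continuous_ext:
  "uniformly_continuous_on UNIV (right_ext g)" "uniformly_continuous_on UNIV (left_ext g)"
  using uniformly_continuous_extends[OF extends_ext Rep_cinf] by auto

lemma continuous_ext: "continuous_on UNIV (right_ext g)" "continuous_on UNIV (left_ext g)"
  using uniformly_continuous_ext uniformly_continuous_imp_continuous by blast+

lemma ext_lincomb:
  "right_ext (s *\<^sub>R f + t *\<^sub>R g) x = s * right_ext f x + t * right_ext g x"
  "left_ext (s *\<^sub>R f + t *\<^sub>R g) x = s * left_ext f x + t * left_ext g x"
proof -
  have "Rep_cinf (s *\<^sub>R f + t *\<^sub>R g) = (\<lambda>x. s * Rep_cinf f x + t * Rep_cinf g x)"
    by (simp add: plus_cinf.rep_eq scaleR_cinf.rep_eq)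
  then have "extends p d (Rep_cinf (s *\<^sub>R f + t *\<^sub>R g)) (\<lambda>x. s * right_ext f x + t * right_ext g x)
      (\<lambda>x. s * left_ext f x + t * left_ext g x)"
    using extends_lincomb[OF extends_ext extends_ext] by simp
  from ext_eqI[OF this] show "right_ext (s *\<^sub>R f + t *\<^sub>R g) x = s * right_ext f x + t * right_ext g x"
    "left_ext (s *\<^sub>R f + t *\<^sub>R g) x = s * left_ext f x + t * left_ext g x" by simp_all
qed

definition cos_fun :: "real \<Rightarrow> cinf \<Rightarrow> real \<Rightarrow> real" where
  "cos_fun t g x = (if x \<ge> 0 then (right_ext g (x + t) + right_ext g (x - t)) / 2
    else (left_ext g (x + t) + left_ext g (x - t)) / 2)"

text \<open>At 0 both branches equal the common even part at \<open>t\<close>; this is the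
  continuity across the interface.\<close>

lemma cos_fun_nonpos: "x \<le> 0 \<Longrightarrow> cos_fun t g x = (left_ext g (x + t) + left_ext g (x - t)) / 2"
  using ext_even[of g t] by (cases "x = 0") (auto simp: cos_fun_def)

lemma cos_fun_C_infty: "cos_fun t g \<in> C_infty"
proof -
  let ?r = "\<lambda>x. (right_ext g (x + t) + right_ext g (x - t)) / 2"
  let ?l = "\<lambda>x. (left_ext g (x + t) + left_ext g (x - t)) / 2"
  have "cos_fun t g x = ?r (max x 0) + ?l (min x 0) - ?r 0" for x
    using ext_even[of g t] by (cases "x \<ge> 0") (auto simp: cos_fun_def max_def min_def)
  moreover have "continuous_on UNIV (\<lambda>x. ?r (max x 0) + ?l (min x 0) - ?r 0)"
    by (intro continuous_intros continuous_on_compose2[OF continuous_ext(1)]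
        continuous_on_compose2[OF continuous_ext(2)]) auto
  ultimately have 1: "continuous_on UNIV (cos_fun t g)" by (simp cong: continuous_on_cong)
  obtain k l where g: "(Rep_cinf g \<longlongrightarrow> k) at_bot" "(Rep_cinf g \<longlongrightarrow> l) at_top"
    using Rep_cinf[of g] by (auto simp: C_infty_def)
  have sh_top: "filterlim (\<lambda>x::real. x + c) at_top at_top" for c
    using filterlim_tendsto_add_at_top[OF tendsto_const filterlim_ident, of c] by (simp add: add.commute)
  have sh_bot: "filterlim (\<lambda>x::real. x + c) at_bot at_bot" for c
    unfolding filterlim_at_bot eventually_at_bot_linorder
    by (metis add.commute le_diff_eq)
  have "((\<lambda>x. (Rep_cinf g (x + t) + Rep_cinf g (x + - t)) / 2) \<longlongrightarrow> (l + l) / 2) at_top"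
    by (intro tendsto_intros filterlim_compose[OF g(2)] sh_top) auto
  moreover have "eventually (\<lambda>x. (Rep_cinf g (x + t) + Rep_cinf g (x + - t)) / 2 = cos_fun t g x) at_top"
    using eventually_ge_at_top[of "\<bar>t\<bar>"]
    by eventually_elim (auto simp: cos_fun_def right_ext_nonneg)
  ultimately have 2: "(cos_fun t g \<longlongrightarrow> (l + l) / 2) at_top" by (rule Lim_transform_eventually)
  have "((\<lambda>x. (Rep_cinf g (x + t) + Rep_cinf g (x + - t)) / 2) \<longlongrightarrow> (k + k) / 2) at_bot"
    by (intro tendsto_intros filterlim_compose[OF g(1)] sh_bot) auto
  moreover have "eventually (\<lambda>x. (Rep_cinf g (x + t) + Rep_cinf g (x + - t)) / 2 = cos_fun t g x) at_bot"
    using eventually_le_at_bot[of "- \<bar>t\<bar>"]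
    by eventually_elim (auto simp: cos_fun_nonpos left_ext_nonpos)
  ultimately have 3: "(cos_fun t g \<longlongrightarrow> (k + k) / 2) at_bot" by (rule Lim_transform_eventually)
  show ?thesis using 1 2 3 by (auto simp: C_infty_def)
qed

definition cos_op :: "real \<Rightarrow> cinf \<Rightarrow>\<^sub>L cinf" where
  "cos_op t = Blinfun (\<lambda>g. Abs_cinf (cos_fun t g))"

lemma cos_op_apply: "cos_op t g = Abs_cinf (cos_fun t g)"
proof -
  have R: "Rep_cinf (Abs_cinf (cos_fun t g)) = cos_fun t g" for g
    by (rule Abs_cinf_inverse[OF cos_fun_C_infty])
  have "bounded_linear (\<lambda>g. Abs_cinf (cos_fun t g))"
  proof (rule bounded_linear_intro[of _ 3])
    fix f g :: cinf and r :: real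
    have "cos_fun t (f + g) x = cos_fun t f x + cos_fun t g x" for x
      using ext_lincomb[of 1 f 1 g] by (simp add: cos_fun_def add_divide_distrib)
    then show "Abs_cinf (cos_fun t (f + g)) = Abs_cinf (cos_fun t f) + Abs_cinf (cos_fun t g)"
      by (intro cinf_eqI) (simp add: plus_cinf.rep_eq R)
    have "cos_fun t (r *\<^sub>R f) x = r * cos_fun t f x" for x
      using ext_lincomb[of r f 0 f] by (simp add: cos_fun_def algebra_simps)
    then show "Abs_cinf (cos_fun t (r *\<^sub>R f)) = r *\<^sub>R Abs_cinf (cos_fun t f)"
      by (intro cinf_eqI) (simp add: scaleR_cinf.rep_eq R)
    have "\<bar>cos_fun t f x\<bar> \<le> norm f * 3" for x
      using ext_bound(1)[of f "x + t"] ext_bound(1)[of f "x - t"]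
        ext_bound(2)[of f "x + t"] ext_bound(2)[of f "x - t"] by (auto simp: cos_fun_def)
    then show "norm (Abs_cinf (cos_fun t f)) \<le> norm f * 3"
      by (intro norm_cinf_le) (simp add: R)
  qed
  then show ?thesis by (simp add: cos_op_def bounded_linear_Blinfun_apply)
qed

lemma Rep_cos_op: "Rep_cinf (cos_op t g) = cos_fun t g"
  by (simp add: cos_op_apply Abs_cinf_inverse[OF cos_fun_C_infty])

lemma norm_cos_op: "norm (cos_op t) \<le> 3"
proof (rule norm_blinfun_bound)
  fix g
  show "norm (cos_op t g) \<le> 3 * norm g"
  proof (rule norm_cinf_le)
    show "\<bar>Rep_cinf (cos_op t g) x\<bar> \<le> 3 * norm g" for x
      unfolding Rep_cos_op
      using ext_bound(1)[of g "x + t"] ext_bound(1)[of g "x - t"]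
        ext_bound(2)[of g "x + t"] ext_bound(2)[of g "x - t"] by (auto simp: cos_fun_def)
  qed
qed simp

text \<open>The averaged extensions are again compatible and restrict to \<open>cos_fun t g\<close>
  on the proper half-lines, so uniqueness identifies them. After this the cosine equation is mere
  addition of shifts.\<close>

lemma ext_cos_op:
  "right_ext (cos_op t g) = (\<lambda>x. (right_ext g (x + t) + right_ext g (x - t)) / 2)"
  "left_ext (cos_op t g) = (\<lambda>x. (left_ext g (x + t) + left_ext g (x - t)) / 2)"
proof -
  have "compat p d (right_ext g) (left_ext g)" using extends_ext by (simp add: extends_def)
  from compat_shift[OF this]
  have "extends p d (Rep_cinf (cos_op t g)) (\<lambda>x. (right_ext g (x + t) + right_ext g (x - t)) / 2)
      (\<lambda>x. (left_ext g (x + t) + left_ext g (x - t)) / 2)"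
    unfolding extends_def Rep_cos_op by (auto simp: cos_fun_nonpos) (simp add: cos_fun_def)
  from ext_eqI[OF this] show
    "right_ext (cos_op t g) = (\<lambda>x. (right_ext g (x + t) + right_ext g (x - t)) / 2)"
    "left_ext (cos_op t g) = (\<lambda>x. (left_ext g (x + t) + left_ext g (x - t)) / 2)" .
qed

lemma cosine_family_cos_op: "cosine_family cos_op"
  unfolding cosine_family_def
proof (intro conjI allI)
  show "cos_op 0 = id_blinfun"
  proof (rule blinfun_eqI, rule cinf_eqI)
    show "Rep_cinf (cos_op 0 g) x = Rep_cinf (id_blinfun g) x" for g x
      by (simp add: Rep_cos_op cos_fun_def right_ext_nonneg left_ext_nonpos)
  qed
  show "2 *\<^sub>R (cos_op t o\<^sub>L cos_op s) = cos_op (t + s) + cos_op (t - s)" for t s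
  proof (rule blinfun_eqI, rule cinf_eqI)
    fix g x
    have shifts: "x + t + s = x + (t + s)" "x + t - s = x + (t - s)" "x - t + s = x - (t - s)" "x - t - s = x - (t + s)"
      by auto
    show "Rep_cinf ((2 *\<^sub>R (cos_op t o\<^sub>L cos_op s)) g) x = Rep_cinf ((cos_op (t + s) + cos_op (t - s)) g) x"
      by (simp add: blinfun.bilinear_simps scaleR_cinf.rep_eq plus_cinf.rep_eq Rep_cos_op)
        (simp add: cos_fun_def ext_cos_op shifts add_divide_distrib)
  qed
  fix g
  show "continuous_on UNIV (\<lambda>t. cos_op t g)"
    unfolding continuous_on_iff
  proof (intro ballI allI impI)
    fix t e :: real assume e: "e > 0"
    obtain d1 where d1: "d1 > 0" "\<And>x y. dist y x < d1 \<Longrightarrow> dist (right_ext g y) (right_ext g x) < e / 2"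
      using uniformly_continuous_ext(1)[of g] e unfolding uniformly_continuous_on_def
      by (metis UNIV_I half_gt_zero)
    obtain d2 where d2: "d2 > 0" "\<And>x y. dist y x < d2 \<Longrightarrow> dist (left_ext g y) (left_ext g x) < e / 2"
      using uniformly_continuous_ext(2)[of g] e unfolding uniformly_continuous_on_def
      by (metis UNIV_I half_gt_zero)
    have "dist (cos_op s g) (cos_op t g) < e" if s: "dist s t < min d1 d2" for s
    proof -
      have "\<bar>Rep_cinf (cos_op s g - cos_op t g) x\<bar> \<le> e / 2" for x
      proof -
        have near: "dist (x + s) (x + t) < d1" "dist (x - s) (x - t) < d1"
          "dist (x + s) (x + t) < d2" "dist (x - s) (x - t) < d2"
          using s by (auto simp: dist_real_def)
        have avg: "\<bar>(u + v) / 2 - (u' + v') / 2\<bar> \<le> e / 2" if "dist u u' < e / 2" "dist v v' < e / 2" for u v u' v' :: real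
          using that unfolding dist_real_def by argo
        show ?thesis
          using avg[OF d1(2)[OF near(1)] d1(2)[OF near(2)]] avg[OF d2(2)[OF near(3)] d2(2)[OF near(4)]]
          by (simp add: Rep_cinf_diff Rep_cos_op cos_fun_def)
      qed
      then have "dist (cos_op s g) (cos_op t g) \<le> e / 2"
        unfolding dist_norm by (rule norm_cinf_le)
      then show ?thesis using e by simp
    qed
    then show "\<exists>d>0. \<forall>s\<in>UNIV. dist s t < d \<longrightarrow> dist (cos_op s g) (cos_op t g) < e"
      using d1(1) d2(1) by (intro exI[of _ "min d1 d2"]) auto
  qed
qed

text \<open>The second derivatives are the values of \<open>g\<close> itself, so their continuity,
  their matching at 0 and their limits at infinity are contained in \<open>g\<close> being an
  element of \<open>cinf\<close>.\<close>

definition transmission_generator :: "(cinf \<times> cinf) set" where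
  "transmission_generator = {(f, g). \<exists>l r.
     (\<forall>x\<in>{..0}. (Rep_cinf f has_real_derivative l x) (at x within {..0})) \<and>
     (\<forall>x\<in>{..0}. (l has_real_derivative Rep_cinf g x) (at x within {..0})) \<and>
     (\<forall>x\<in>{0..}. (Rep_cinf f has_real_derivative r x) (at x within {0..})) \<and>
     (\<forall>x\<in>{0..}. (r has_real_derivative Rep_cinf g x) (at x within {0..})) \<and>
     d * Rep_cinf g 0 = p * r 0 - (1 - p) * l 0}"

text \<open>Extension is linear and bounded with constant 3, so convergence of the generator
  quotient in norm becomes convergence of the symmetric second quotients of both extensions at every
  point of the line. By Schwarz's theorem the extensions of \<open>f\<close> are twice
  differentiable with second derivatives the extensions of \<open>g\<close>, and their slopes at 0
  are the one-sided derivatives of \<open>f\<close>.\<close>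

lemma cosine_generator_subset: "cosine_generator cos_op \<subseteq> transmission_generator"
proof (clarify)
  fix f g assume fg: "(f, g) \<in> cosine_generator cos_op"
  define u where "u h = (2 / h\<^sup>2) *\<^sub>R (cos_op h f - f) - g" for h
  have "((\<lambda>h. 3 * norm (u h)) \<longlongrightarrow> 3 * norm (g - g)) (at_right 0)"
    using fg unfolding cosine_generator_iff[OF cosine_family_cos_op] u_def by (intro tendsto_intros)
  then have u0: "((\<lambda>h. 3 * norm (u h)) \<longlongrightarrow> 0) (at_right 0)" by simp
  have u: "u h = 1 *\<^sub>R ((2 / h\<^sup>2) *\<^sub>R cos_op h f + (- (2 / h\<^sup>2)) *\<^sub>R f) + (- 1) *\<^sub>R g" for h
    by (simp add: u_def algebra_simps)
  have ur: "right_ext (u h) x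
      = (1 / h\<^sup>2) *\<^sub>R (right_ext f (x + h) + right_ext f (x - h) - 2 *\<^sub>R right_ext f x) - right_ext g x" for h x
    unfolding u ext_lincomb ext_cos_op by (simp add: algebra_simps diff_divide_distrib add_divide_distrib)
  have ul: "left_ext (u h) x
      = (1 / h\<^sup>2) *\<^sub>R (left_ext f (x + h) + left_ext f (x - h) - 2 *\<^sub>R left_ext f x) - left_ext g x" for h x
    unfolding u ext_lincomb ext_cos_op by (simp add: algebra_simps diff_divide_distrib add_divide_distrib)
  have sr: "sym_deriv2 (right_ext f) (right_ext g x) x" for x
    unfolding sym_deriv2_def
    by (rule LIM_zero_cancel, rule Lim_null_comparison[OF _ u0])
      (rule always_eventually, simp only: ur[symmetric] real_norm_def ext_bound simp_thms)
  have sl: "sym_deriv2 (left_ext f) (left_ext g x) x" for x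
    unfolding sym_deriv2_def
    by (rule LIM_zero_cancel, rule Lim_null_comparison[OF _ u0])
      (rule always_eventually, simp only: ul[symmetric] real_norm_def ext_bound simp_thms)
  obtain r where r: "\<And>x. (right_ext f has_real_derivative r x) (at x)"
    "\<And>x. (r has_real_derivative right_ext g x) (at x)"
    by (rule sym_deriv2_imp_C2[OF continuous_ext(1) continuous_ext(1) sr])
      (auto simp: has_real_derivative_iff_has_vector_derivative)
  obtain l where l: "\<And>x. (left_ext f has_real_derivative l x) (at x)"
    "\<And>x. (l has_real_derivative left_ext g x) (at x)"
    by (rule sym_deriv2_imp_C2[OF continuous_ext(2) continuous_ext(2) sl])
      (auto simp: has_real_derivative_iff_has_vector_derivative)
  have neg: "((\<lambda>x. h (- x)) has_real_derivative - h' (- x)) (at x)"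
    if "\<And>x. (h has_real_derivative h' x) (at x)" for h h' :: "real \<Rightarrow> real" and x
    using DERIV_chain2[OF that DERIV_minus[OF DERIV_ident]] by simp
  \<comment> \<open>The compatibility relation with its derivative carried out. It may now be
    differentiated once more, and at 0 this gives twice the transmission condition.\<close>
  have bc: "d * (r x - r (- x)) = p * (right_ext f x - right_ext f (- x)) - (1 - p) * (left_ext f x - left_ext f (- x))" for x
  proof -
    have "((\<lambda>x. d * (right_ext f x + right_ext f (- x))) has_real_derivative d * (r x + - r (- x))) (at x)"
      by (intro DERIV_cmult DERIV_add r neg)
    moreover have "((\<lambda>x. d * (right_ext f x + right_ext f (- x))) has_real_derivative
        p * (right_ext f x - right_ext f (- x)) - (1 - p) * (left_ext f x - left_ext f (- x))) (at x)"
      using extends_ext[of f] unfolding extends_def compat_def by blast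
    ultimately show ?thesis using DERIV_unique by fastforce
  qed
  have "((\<lambda>x. d * (r x - r (- x))) has_real_derivative d * (right_ext g 0 - - right_ext g (- 0))) (at 0)"
    by (intro DERIV_cmult DERIV_diff r neg)
  moreover have "((\<lambda>x. d * (r x - r (- x))) has_real_derivative
      p * (r 0 - - r (- 0)) - (1 - p) * (l 0 - - l (- 0))) (at 0)"
    unfolding bc by (intro DERIV_cmult DERIV_diff r l neg)
  ultimately have "d * (right_ext g 0 - - right_ext g (- 0)) = p * (r 0 - - r (- 0)) - (1 - p) * (l 0 - - l (- 0))"
    by (rule DERIV_unique)
  then have bc0: "d * Rep_cinf g 0 = p * r 0 - (1 - p) * l 0" by (simp add: right_ext_nonneg algebra_simps)
  have R: "(Rep_cinf f has_real_derivative r x) (at x within {0..})"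
    "(r has_real_derivative Rep_cinf g x) (at x within {0..})" if "x \<in> {0..}" for x
  proof -
    show "(Rep_cinf f has_real_derivative r x) (at x within {0..})"
      using has_vector_derivative_transform[OF that _ has_vector_derivative_at_within, of "Rep_cinf f" "right_ext f"]
        r(1)[of x] by (simp add: has_real_derivative_iff_has_vector_derivative right_ext_nonneg)
    show "(r has_real_derivative Rep_cinf g x) (at x within {0..})"
      using has_field_derivative_at_within[OF r(2)[of x]] that by (simp add: right_ext_nonneg)
  qed
  have L: "(Rep_cinf f has_real_derivative l x) (at x within {..0})"
    "(l has_real_derivative Rep_cinf g x) (at x within {..0})" if "x \<in> {..0}" for x
  proof -
    show "(Rep_cinf f has_real_derivative l x) (at x within {..0})"
      using has_vector_derivative_transform[OF that _ has_vector_derivative_at_within, of "Rep_cinf f" "left_ext f"]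
        l(1)[of x] by (simp add: has_real_derivative_iff_has_vector_derivative left_ext_nonpos)
    show "(l has_real_derivative Rep_cinf g x) (at x within {..0})"
      using has_field_derivative_at_within[OF l(2)[of x]] that by (simp add: left_ext_nonpos)
  qed
  show "(f, g) \<in> transmission_generator" unfolding transmission_generator_def using R L bc0 by blast
qed

text \<open>The extensions \<open>a\<close>, \<open>b\<close> of \<open>g\<close> are integrated
  twice from the data of \<open>f\<close> at 0. The results restrict to \<open>f\<close> on the two
  half-lines and are compatible, so by uniqueness they are the extensions of \<open>f\<close>;
  uniform continuity of \<open>a\<close> and \<open>b\<close> then makes the second quotients
  converge uniformly.\<close>

lemma subset_cosine_generator: "transmission_generator \<subseteq> cosine_generator cos_op"
proof (clarify)
  fix f g assume "(f, g) \<in> transmission_generator"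
  then obtain l r where
    l: "\<And>x. x \<in> {..0} \<Longrightarrow> (Rep_cinf f has_real_derivative l x) (at x within {..0})"
      "\<And>x. x \<in> {..0} \<Longrightarrow> (l has_real_derivative Rep_cinf g x) (at x within {..0})"
    and r: "\<And>x. x \<in> {0..} \<Longrightarrow> (Rep_cinf f has_real_derivative r x) (at x within {0..})"
      "\<And>x. x \<in> {0..} \<Longrightarrow> (r has_real_derivative Rep_cinf g x) (at x within {0..})"
    and bc: "d * Rep_cinf g 0 = p * r 0 - (1 - p) * l 0"
    unfolding transmission_generator_def by blast
  define a b where "a = right_ext g" and "b = left_ext g"
  have anti: "\<exists>F. F 0 = c \<and> (\<forall>x. (F has_real_derivative h x) (at x))" if h: "continuous_on UNIV h"
    for h :: "real \<Rightarrow> real" and c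
  proof -
    obtain F where "\<And>x. (F has_real_derivative h x) (at x)" "F 0 = 0"
      by (rule antiderivative_at_0[OF h]) (auto simp: has_real_derivative_iff_has_vector_derivative)
    then show ?thesis
      using DERIV_add[OF DERIV_const[of c], of F] by (intro exI[of _ "\<lambda>x. c + F x"]) auto
  qed
  have anti2: "\<exists>F F'. F 0 = c \<and> F' 0 = c' \<and> (\<forall>x. (F has_real_derivative F' x) (at x)) \<and> (\<forall>x. (F' has_real_derivative h x) (at x))"
    if h: "continuous_on UNIV h" for h :: "real \<Rightarrow> real" and c c'
  proof -
    obtain F' where F': "F' 0 = c'" "\<And>x. (F' has_real_derivative h x) (at x)" using anti[OF h] by blast
    then have "continuous_on UNIV F'"
      by (intro DERIV_continuous_on) (auto intro: has_field_derivative_at_within)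
    from anti[OF this] F' show ?thesis by blast
  qed
  obtain A A' where A: "A 0 = Rep_cinf f 0" "A' 0 = r 0" "\<And>x. (A has_real_derivative A' x) (at x)"
    "\<And>x. (A' has_real_derivative a x) (at x)"
    using anti2[OF continuous_ext(1)[of g], of "Rep_cinf f 0" "r 0"] unfolding a_def by blast
  obtain B B' where B: "B 0 = Rep_cinf f 0" "B' 0 = l 0" "\<And>x. (B has_real_derivative B' x) (at x)"
    "\<And>x. (B' has_real_derivative b x) (at x)"
    using anti2[OF continuous_ext(2)[of g], of "Rep_cinf f 0" "l 0"] unfolding b_def by blast
  have eq_on: "F x = G x" if "convex S" "0 \<in> S" "x \<in> S" "F 0 = G 0"
    "\<And>x. x \<in> S \<Longrightarrow> (F has_real_derivative h x) (at x within S)"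
    "\<And>x. x \<in> S \<Longrightarrow> (G has_real_derivative h x) (at x within S)" for F G h :: "real \<Rightarrow> real" and x S
  proof -
    have "\<exists>c. \<forall>x\<in>S. F x - G x = c"
      using DERIV_diff[OF that(5,6)] that(1) by (intro has_field_derivative_zero_constant) auto
    then have "F x - G x = F 0 - G 0" using that(2,3) by metis
    then show ?thesis using that(4) by simp
  qed
  have A'r: "A' x = r x" if "x \<in> {0..}" for x
    using r(2) that A(2) has_field_derivative_at_within[OF A(4)]
    by (intro eq_on[of "{0..}" x A' r "Rep_cinf g"]) (auto simp: a_def right_ext_nonneg[symmetric])
  have Af: "A x = Rep_cinf f x" if "x \<in> {0..}" for x
    using r(1) that A(1) has_field_derivative_at_within[OF A(3)]
    by (intro eq_on[of "{0..}" x A "Rep_cinf f" r]) (auto simp: A'r[symmetric])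
  have B'l: "B' x = l x" if "x \<in> {..0}" for x
    using l(2) that B(2) has_field_derivative_at_within[OF B(4)]
    by (intro eq_on[of "{..0}" x B' l "Rep_cinf g"]) (auto simp: b_def left_ext_nonpos[symmetric])
  have Bf: "B x = Rep_cinf f x" if "x \<in> {..0}" for x
    using l(1) that B(1) has_field_derivative_at_within[OF B(3)]
    by (intro eq_on[of "{..0}" x B "Rep_cinf f" l]) (auto simp: B'l[symmetric])
  have neg: "((\<lambda>x. h (- x)) has_real_derivative - h' (- x)) (at x)"
    if "\<And>x. (h has_real_derivative h' x) (at x)" for h h' :: "real \<Rightarrow> real" and x
    using DERIV_chain2[OF that DERIV_minus[OF DERIV_ident]] by simp
  have const: "F x = F 0" if "\<And>x. (F has_real_derivative 0) (at x)" for F :: "real \<Rightarrow> real" and x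
    using DERIV_isconst_all that by blast
  have ab: "compat p d a b" using extends_ext[of g] by (simp add: extends_def a_def b_def)
  then have ev: "a x + a (- x) = b x + b (- x)" for x by (simp add: compat_def)
  \<comment> \<open>The identities \<open>ev1\<close>, \<open>ev0\<close>, \<open>F1\<close>,
    \<open>F0\<close> integrate the compatibility of \<open>a\<close> and \<open>b\<close>: each
    difference of sides has derivative 0 and vanishes at 0. For \<open>F1\<close> the vanishing at 0
    is the transmission condition.\<close>
  have ev1: "A' x - A' (- x) = B' x - B' (- x)" for x
  proof -
    have "((\<lambda>x. (A' x - A' (- x)) - (B' x - B' (- x))) has_real_derivative
        (a x - - a (- x)) - (b x - - b (- x))) (at x)" for x
      by (intro DERIV_diff neg A B)
    then have "((\<lambda>x. (A' x - A' (- x)) - (B' x - B' (- x))) has_real_derivative 0) (at x)" for x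
      using ev by simp
    from const[OF this, of x] show ?thesis by simp
  qed
  have ev0: "A x + A (- x) = B x + B (- x)" for x
  proof -
    have "((\<lambda>x. (A x + A (- x)) - (B x + B (- x))) has_real_derivative
        (A' x + - A' (- x)) - (B' x + - B' (- x))) (at x)" for x
      by (intro DERIV_diff DERIV_add neg A B)
    then have "((\<lambda>x. (A x + A (- x)) - (B x + B (- x))) has_real_derivative 0) (at x)" for x
      using ev1 by simp
    from const[OF this, of x] show ?thesis by (simp add: A(1) B(1))
  qed
  have F1: "d * (a x + a (- x)) = p * (A' x + A' (- x)) - (1 - p) * (B' x + B' (- x))" for x
  proof -
    have "((\<lambda>x. d * (a x + a (- x)) - (p * (A' x + A' (- x)) - (1 - p) * (B' x + B' (- x)))) has_real_derivative
        (p * (a x - a (- x)) - (1 - p) * (b x - b (- x))) -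
        (p * (a x + - a (- x)) - (1 - p) * (b x + - b (- x)))) (at x)" for x
    proof (intro DERIV_diff[of "\<lambda>x. d * (a x + a (- x))"])
      show "((\<lambda>x. d * (a x + a (- x))) has_real_derivative p * (a x - a (- x)) - (1 - p) * (b x - b (- x))) (at x)"
        using ab unfolding compat_def by blast
    qed (intro DERIV_diff DERIV_cmult DERIV_add neg A B)
    then have "((\<lambda>x. d * (a x + a (- x)) - (p * (A' x + A' (- x)) - (1 - p) * (B' x + B' (- x)))) has_real_derivative 0) (at x)" for x
      by simp
    from const[OF this, of x] show ?thesis
      using bc by (simp add: A(2) B(2) a_def right_ext_nonneg algebra_simps)
  qed
  have F0: "d * (A' x - A' (- x)) = p * (A x - A (- x)) - (1 - p) * (B x - B (- x))" for x
  proof -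
    have "((\<lambda>x. d * (A' x - A' (- x)) - (p * (A x - A (- x)) - (1 - p) * (B x - B (- x)))) has_real_derivative
        d * (a x - - a (- x)) - (p * (A' x - - A' (- x)) - (1 - p) * (B' x - - B' (- x)))) (at x)" for x
      by (intro DERIV_diff DERIV_cmult neg A B)
    then have "((\<lambda>x. d * (A' x - A' (- x)) - (p * (A x - A (- x)) - (1 - p) * (B x - B (- x)))) has_real_derivative 0) (at x)" for x
      using F1 by simp
    from const[OF this, of x] show ?thesis by simp
  qed
  have "compat p d A B"
    unfolding compat_def
  proof (intro conjI allI ev0)
    fix x
    have "((\<lambda>x. d * (A x + A (- x))) has_real_derivative d * (A' x + - A' (- x))) (at x)"
      by (intro DERIV_cmult DERIV_add neg A)
    then show "((\<lambda>x. d * (A x + A (- x))) has_real_derivative p * (A x - A (- x)) - (1 - p) * (B x - B (- x))) (at x)"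
      using F0[of x] by simp
  qed
  then have "extends p d (Rep_cinf f) A B" using Af Bf by (simp add: extends_def)
  then have fAB: "right_ext f = A" "left_ext f = B" by (rule ext_eqI)+
  show "(f, g) \<in> cosine_generator cos_op"
    unfolding cosine_generator_iff[OF cosine_family_cos_op]
  proof (rule tendstoI)
    fix e :: real assume e: "e > 0"
    obtain d1 where d1: "d1 > 0" "\<And>x y. dist y x < d1 \<Longrightarrow> dist (a y) (a x) < e / 2"
      using uniformly_continuous_ext(1)[of g] e unfolding uniformly_continuous_on_def a_def
      by (metis UNIV_I half_gt_zero)
    obtain d2 where d2: "d2 > 0" "\<And>x y. dist y x < d2 \<Longrightarrow> dist (b y) (b x) < e / 2"
      using uniformly_continuous_ext(2)[of g] e unfolding uniformly_continuous_on_def b_def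
      by (metis UNIV_I half_gt_zero)
    have "norm (2 *\<^sub>R (cos_op h f - f) - h\<^sup>2 *\<^sub>R g) \<le> e / 2 * h\<^sup>2" if h: "0 < h" "h < min d1 d2" for h
    proof (rule norm_cinf_le)
      fix x
      have Rx: "Rep_cinf (2 *\<^sub>R (cos_op h f - f) - h\<^sup>2 *\<^sub>R g) x
          = 2 * (cos_fun h f x - Rep_cinf f x) - h\<^sup>2 * Rep_cinf g x"
        by (simp add: Rep_cinf_diff scaleR_cinf.rep_eq Rep_cos_op)
      show "\<bar>Rep_cinf (2 *\<^sub>R (cos_op h f - f) - h\<^sup>2 *\<^sub>R g) x\<bar> \<le> e / 2 * h\<^sup>2"
      proof (cases "x \<ge> 0")
        case True
        have "norm (A (x + h) + A (x - h) - 2 *\<^sub>R A x - h\<^sup>2 *\<^sub>R a x) \<le> e / 2 * h\<^sup>2"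
        proof (rule C2_second_difference_bound)
          show "norm (a s - a x) \<le> e / 2" if "\<bar>s - x\<bar> \<le> \<bar>h\<bar>" for s
            using d1(2)[of s x] that h by (simp add: dist_norm)
        qed (use A in \<open>simp_all add: has_real_derivative_iff_has_vector_derivative\<close>)
        moreover have "A x = Rep_cinf f x" "a x = Rep_cinf g x" using True Af by (auto simp: a_def right_ext_nonneg)
        ultimately show ?thesis unfolding Rx using True by (simp add: cos_fun_def fAB add_divide_distrib algebra_simps)
      next
        case False
        have "norm (B (x + h) + B (x - h) - 2 *\<^sub>R B x - h\<^sup>2 *\<^sub>R b x) \<le> e / 2 * h\<^sup>2"
        proof (rule C2_second_difference_bound)
          show "norm (b s - b x) \<le> e / 2" if "\<bar>s - x\<bar> \<le> \<bar>h\<bar>" for s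
            using d2(2)[of s x] that h by (simp add: dist_norm)
        qed (use B in \<open>simp_all add: has_real_derivative_iff_has_vector_derivative\<close>)
        moreover have "B x = Rep_cinf f x" "b x = Rep_cinf g x" using False Bf by (auto simp: b_def left_ext_nonpos)
        ultimately show ?thesis unfolding Rx using False by (simp add: cos_fun_def fAB add_divide_distrib algebra_simps)
      qed
    qed
    note bound = norm_rescaled_diff_le[OF _ this]
    have "eventually (\<lambda>h. h < min d1 d2) (at_right 0)"
      using d1(1) d2(1) by (intro order_tendstoD(2)[OF tendsto_ident_at]) simp
    then show "eventually (\<lambda>h. dist ((2 / h\<^sup>2) *\<^sub>R (cos_op h f - f)) g < e) (at_right 0)"
      using eventually_at_right_less[of "0::real"]
    proof eventually_elim
      case (elim h)
      then show ?case using bound[of h] e unfolding dist_norm by fastforce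
    qed
  qed
qed

lemma cosine_generator_cos_op: "cosine_generator cos_op = transmission_generator"
  using cosine_generator_subset subset_cosine_generator by blast

end

section \<open>The two operators and their limit\<close>

lemma cinf_separating:
  fixes x y :: cinf
  assumes "\<And>L :: cinf \<Rightarrow> real. bounded_linear L \<Longrightarrow> L x = L y"
  shows "x = y"
proof (rule cinf_eqI)
  fix s
  have "bounded_linear (\<lambda>f. Rep_cinf f s)"
    by (rule bounded_linear_intro[of _ 1])
      (auto simp: plus_cinf.rep_eq scaleR_cinf.rep_eq abs_Rep_cinf_le)
  from assms[OF this] show "Rep_cinf x s = Rep_cinf y s" .
qed

sublocale transmission \<subseteq> separated_bounded_cosine cos_op 3
  by unfold_locales (auto intro: cosine_family_cos_op norm_cos_op cinf_separating)

lemma (in transmission) generated_cosine_transmission: "generated_cosine transmission_generator = cos_op"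
  using generated_cosine_eq[OF cosine_family_cos_op norm_cos_op] by (simp add: cosine_generator_cos_op)

lemma (in transmission) generated_semigroup_transmission:
  "t \<ge> 0 \<Longrightarrow> generated_semigroup transmission_generator t = weierstrass cos_op t"
  using generated_semigroup_weierstrass by (simp add: cosine_generator_cos_op)

section \<open>Transport along the isometry \<open>J\<close>\<close>

lemma J_inv: "J (inv J g) = g"
  by (rule surj_f_inv_f[OF bij_is_surj[OF bij_J]])

lemma inv_J: "inv J (J f) = f"
  by (rule inv_f_f[OF bij_is_inj[OF bij_J]])

lemma linear_inv_J: "linear (inv J)"
proof (rule linearI)
  show "inv J (x + y) = inv J x + inv J y" for x y
    using inv_J[of "inv J x + inv J y"] by (simp add: linear_add[OF linear_J] J_inv)
  show "inv J (c *\<^sub>R x) = c *\<^sub>R inv J x" for c x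
    using inv_J[of "c *\<^sub>R inv J x"] by (simp add: linear_scale[OF linear_J] J_inv)
qed

lemma norm_inv_J: "norm (inv J g) = norm g"
  using norm_J[of "inv J g"] by (simp add: J_inv)

lemma bounded_linear_J: "bounded_linear J"
  using linear_J by (intro bounded_linear_intro[of _ 1]) (auto simp: linear_add linear_scale norm_J)

lemma bounded_linear_inv_J: "bounded_linear (inv J)"
  using linear_inv_J by (intro bounded_linear_intro[of _ 1]) (auto simp: linear_add linear_scale norm_inv_J)

definition conj_J :: "(cinf \<Rightarrow>\<^sub>L cinf) \<Rightarrow> cov \<Rightarrow>\<^sub>L cov" where
  "conj_J A = Blinfun (inv J) o\<^sub>L A o\<^sub>L Blinfun J"

lemma conj_J_apply: "conj_J A f = inv J (A (J f))"
  by (simp add: conj_J_def bounded_linear_Blinfun_apply[OF bounded_linear_J]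
      bounded_linear_Blinfun_apply[OF bounded_linear_inv_J])

lemma norm_conj_J: "norm (conj_J A) \<le> norm A"
  by (rule norm_blinfun_bound) (use norm_blinfun[of A "J _"] in \<open>simp_all add: conj_J_apply norm_inv_J norm_J\<close>)

lemma cosine_family_conj_J:
  assumes C: "cosine_family C"
  shows "cosine_family (\<lambda>t. conj_J (C t))"
  unfolding cosine_family_def
proof (intro conjI allI)
  show "conj_J (C 0) = id_blinfun"
    by (rule blinfun_eqI) (simp add: conj_J_apply cosine_family_0[OF C] inv_J)
  show "2 *\<^sub>R (conj_J (C t) o\<^sub>L conj_J (C s)) = conj_J (C (t + s)) + conj_J (C (t - s))" for t s
    by (rule blinfun_eqI)
      (simp add: blinfun.bilinear_simps conj_J_apply J_inv cosine_family_mult[OF C]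
        flip: linear_scale[OF linear_inv_J] linear_add[OF linear_inv_J])
  show "continuous_on UNIV (\<lambda>t. conj_J (C t) f)" for f
    unfolding conj_J_apply
    by (rule bounded_linear.continuous_on[OF bounded_linear_inv_J cosine_family_continuous[OF C]])
qed

lemma cosine_generator_conj_J:
  "cosine_generator (\<lambda>t. conj_J (C t)) = {(f, g). (J f, J g) \<in> cosine_generator C}"
proof -
  have eq: "(2 / t\<^sup>2) *\<^sub>R (conj_J (C t) f - f) = inv J ((2 / t\<^sup>2) *\<^sub>R (C t (J f) - J f))" for t f
    by (simp only: conj_J_apply linear_scale[OF linear_inv_J] linear_diff[OF linear_inv_J] inv_J)
  have "((\<lambda>t. inv J ((2 / t\<^sup>2) *\<^sub>R (C t (J f) - J f))) \<longlongrightarrow> g) (at 0) \<longleftrightarrow>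
      ((\<lambda>t. (2 / t\<^sup>2) *\<^sub>R (C t (J f) - J f)) \<longlongrightarrow> J g) (at 0)" for f g
    using bounded_linear.tendsto[OF bounded_linear_J, of "\<lambda>t. inv J ((2 / t\<^sup>2) *\<^sub>R (C t (J f) - J f))" g]
      bounded_linear.tendsto[OF bounded_linear_inv_J, of "\<lambda>t. (2 / t\<^sup>2) *\<^sub>R (C t (J f) - J f)" "J g"]
    by (auto simp: J_inv inv_J)
  then show ?thesis by (simp add: cosine_generator_def eq)
qed

lemma cov_separating:
  fixes x y :: cov
  assumes "\<And>L :: cov \<Rightarrow> real. bounded_linear L \<Longrightarrow> L x = L y"
  shows "x = y"
proof -
  have "J x = J y"
    by (rule cinf_separating, rule assms[OF bounded_linear_compose[OF _ bounded_linear_J]])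
  then show ?thesis using inv_J by metis
qed

lemma Lim_cov_0:
  "(Rep_cov f \<longlongrightarrow> Rep_cinf (J f) 0) (at_right 0)"
  "Lim (at_right 0) (Rep_cov f) = Rep_cinf (J f) 0" "Lim (at_left 0) (Rep_cov f) = - Rep_cinf (J f) 0"
proof -
  obtain l where l: "(Rep_cov f \<longlongrightarrow> - l) (at_left 0)" "(Rep_cov f \<longlongrightarrow> l) (at_right 0)"
    using Rep_cov[of f] unfolding C_ov_iff by blast
  then have "Lim (at_right 0) (Rep_cov f) = l" "Lim (at_left 0) (Rep_cov f) = - l"
    by (auto intro!: tendsto_Lim)
  then show "(Rep_cov f \<longlongrightarrow> Rep_cinf (J f) 0) (at_right 0)"
    "Lim (at_right 0) (Rep_cov f) = Rep_cinf (J f) 0" "Lim (at_left 0) (Rep_cov f) = - Rep_cinf (J f) 0"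
    using l by (simp_all add: Rep_J)
qed

lemma left_part_J: "x \<le> 0 \<Longrightarrow> left_part (Rep_cov f) x = - Rep_cinf (J f) x"
  by (cases "x = 0") (simp_all add: left_part_def Lim_cov_0(2,3), simp add: Rep_J)

lemma right_part_J: "x \<ge> 0 \<Longrightarrow> right_part (Rep_cov f) x = Rep_cinf (J f) x"
  by (cases "x = 0") (simp_all add: right_part_def Lim_cov_0(2,3), simp add: Rep_J)

section \<open>Identification of the two operators as transmission generators\<close>

lemma has_real_derivative_within_cong:
  assumes "\<And>y. y \<in> S \<Longrightarrow> f y = g y" "x \<in> S" "f' = g'"
  shows "(f has_real_derivative f') (at x within S) \<longleftrightarrow> (g has_real_derivative g') (at x within S)"
  using has_vector_derivative_transform[OF assms(2), of f g f'] has_vector_derivative_transform[OF assms(2), of g f f']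
    assms(1,3) by (auto simp: has_real_derivative_iff_has_vector_derivative)

lemma cinf_limits: "\<exists>c. (Rep_cinf g \<longlongrightarrow> c) at_bot" "\<exists>c. (Rep_cinf g \<longlongrightarrow> c) at_top"
  and cinf_continuous: "continuous_on S (Rep_cinf g)"
  using Rep_cinf[of g] by (auto simp: C_infty_def intro: continuous_on_subset)

lemma A_skew_eq:
  assumes ab: "\<alpha> \<ge> 0" "\<beta> \<ge> 0" "\<alpha> + \<beta> > 0"
  shows "A_skew \<beta> \<alpha> = transmission.transmission_generator (\<beta> / (\<alpha> + \<beta>)) 0"
proof -
  interpret transmission "\<beta> / (\<alpha> + \<beta>)" 0 using ab by unfold_locales auto
  have bc: "0 * z = \<beta> / (\<alpha> + \<beta>) * r - (1 - \<beta> / (\<alpha> + \<beta>)) * l \<longleftrightarrow> \<beta> * r = \<alpha> * l" for z r l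
  proof -
    have "1 - \<beta> / (\<alpha> + \<beta>) = \<alpha> / (\<alpha> + \<beta>)" using ab by (simp add: field_simps)
    then show ?thesis using ab by (auto simp: diff_divide_distrib[symmetric])
  qed
  have "(f, g) \<in> A_skew \<beta> \<alpha> \<longleftrightarrow> (f, g) \<in> transmission_generator" for f g
  proof
    assume "(f, g) \<in> A_skew \<beta> \<alpha>"
    then obtain l' l'' r' r'' where *: "C2_on {..0} (Rep_cinf f) l' l''" "C2_on {0..} (Rep_cinf f) r' r''"
      "\<beta> * r' 0 = \<alpha> * l' 0" "\<forall>x\<le>0. Rep_cinf g x = l'' x" "\<forall>x\<ge>0. Rep_cinf g x = r'' x"
      unfolding A_skew_def by blast
    then show "(f, g) \<in> transmission_generator"
      unfolding transmission_generator_def C2_on_def bc mem_Collect_eq case_prod_conv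
      by (rule_tac exI[of _ l'], rule_tac exI[of _ r']) auto
  next
    assume "(f, g) \<in> transmission_generator"
    then obtain l r where "\<forall>x\<in>{..0}. (Rep_cinf f has_real_derivative l x) (at x within {..0})"
      "\<forall>x\<in>{..0}. (l has_real_derivative Rep_cinf g x) (at x within {..0})"
      "\<forall>x\<in>{0..}. (Rep_cinf f has_real_derivative r x) (at x within {0..})"
      "\<forall>x\<in>{0..}. (r has_real_derivative Rep_cinf g x) (at x within {0..})" "\<beta> * r 0 = \<alpha> * l 0"
      unfolding transmission_generator_def bc by blast
    then show "(f, g) \<in> A_skew \<beta> \<alpha>"
      unfolding A_skew_def C2_on_def mem_Collect_eq case_prod_conv
      by (rule_tac exI[of _ l], rule_tac exI[of _ "Rep_cinf g"], rule_tac exI[of _ r],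
          rule_tac exI[of _ "Rep_cinf g"]) (auto intro!: cinf_limits cinf_continuous)
  qed
  then show ?thesis by auto
qed

lemma A_perp_eq:
  assumes ab: "\<alpha> \<ge> 0" "\<beta> \<ge> 0" "\<alpha> + \<beta> > 0"
  shows "A_perp \<alpha> \<beta> = {(f, g). (J f, J g) \<in> transmission.transmission_generator (\<beta> / (\<alpha> + \<beta>)) (1 / (\<alpha> + \<beta>))}"
proof -
  interpret transmission "\<beta> / (\<alpha> + \<beta>)" "1 / (\<alpha> + \<beta>)" using ab by unfold_locales auto
  \<comment> \<open>\<open>J\<close> reverses signs on the left half-line, so the left derivative
    enters as \<open>- l\<close>; dividing the boundary condition by
    \<open>\<alpha> + \<beta>\<close> produces the weights \<open>p\<close>, \<open>1 - p\<close>
    and the parameter \<open>d\<close>.\<close>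
  have bc: "1 / (\<alpha> + \<beta>) * z = \<beta> / (\<alpha> + \<beta>) * r - (1 - \<beta> / (\<alpha> + \<beta>)) * l \<longleftrightarrow> z = \<alpha> * (- l) + \<beta> * r" for z r l
  proof -
    have "1 - \<beta> / (\<alpha> + \<beta>) = \<alpha> / (\<alpha> + \<beta>)" using ab by (simp add: field_simps)
    then show ?thesis using ab by (auto simp: diff_divide_distrib[symmetric])
  qed
  have "(f, g) \<in> A_perp \<alpha> \<beta> \<longleftrightarrow> (J f, J g) \<in> transmission_generator" for f g
  proof
    assume "(f, g) \<in> A_perp \<alpha> \<beta>"
    then obtain l' l'' r' r'' where *: "C2_on {..0} (left_part (Rep_cov f)) l' l''"
      "C2_on {0..} (right_part (Rep_cov f)) r' r''"
      "r'' 0 = \<alpha> * l' 0 + \<beta> * r' 0" "r'' 0 = - l'' 0"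
      "\<forall>x<0. Rep_cov g x = l'' x" "\<forall>x>0. Rep_cov g x = r'' x"
      unfolding A_perp_def by blast
    \<comment> \<open>The representative of \<open>g\<close> is 0 at 0 by convention, so the value
      of \<open>J g\<close> there has to be recovered as a right limit.\<close>
    have "(r'' \<longlongrightarrow> r'' 0) (at_right 0)"
      using *(2) unfolding C2_on_def continuous_on_def
      by (auto intro: tendsto_within_subset[of _ _ 0 "{0..}"])
    moreover have "eventually (\<lambda>x. r'' x = Rep_cov g x) (at_right 0)"
      using *(6) by (simp add: eventually_at_filter)
    ultimately have "(Rep_cov g \<longlongrightarrow> r'' 0) (at_right 0)" by (rule Lim_transform_eventually)
    then have g0: "Rep_cinf (J g) 0 = r'' 0" using tendsto_unique[OF _ Lim_cov_0(1)] by auto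
    have gl: "Rep_cinf (J g) x = - l'' x" if "x \<le> 0" for x
      using that *(4,5) g0 by (cases "x = 0") (auto simp: Rep_J)
    have gr: "Rep_cinf (J g) x = r'' x" if "x \<ge> 0" for x
      using that *(6) g0 by (cases "x = 0") (auto simp: Rep_J)
    have "(Rep_cinf (J f) has_real_derivative - l' x) (at x within {..0})"
      "((\<lambda>x. - l' x) has_real_derivative Rep_cinf (J g) x) (at x within {..0})" if x: "x \<in> {..0}" for x
    proof -
      have "((\<lambda>x. - left_part (Rep_cov f) x) has_real_derivative - l' x) (at x within {..0})"
        using *(1) x unfolding C2_on_def by (intro DERIV_minus) auto
      then show "(Rep_cinf (J f) has_real_derivative - l' x) (at x within {..0})"
        by (rule has_real_derivative_within_cong[THEN iffD1, rotated 3]) (use x in \<open>auto simp: left_part_J\<close>)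
      have "((\<lambda>x. - l' x) has_real_derivative - l'' x) (at x within {..0})"
        using *(1) x unfolding C2_on_def by (intro DERIV_minus) auto
      then show "((\<lambda>x. - l' x) has_real_derivative Rep_cinf (J g) x) (at x within {..0})"
        using gl x by simp
    qed
    moreover have "(Rep_cinf (J f) has_real_derivative r' x) (at x within {0..})"
      "(r' has_real_derivative Rep_cinf (J g) x) (at x within {0..})" if x: "x \<in> {0..}" for x
    proof -
      have "(right_part (Rep_cov f) has_real_derivative r' x) (at x within {0..})"
        using *(2) x unfolding C2_on_def by auto
      then show "(Rep_cinf (J f) has_real_derivative r' x) (at x within {0..})"
        by (rule has_real_derivative_within_cong[THEN iffD1, rotated 3]) (use x in \<open>auto simp: right_part_J\<close>)
      show "(r' has_real_derivative Rep_cinf (J g) x) (at x within {0..})"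
        using *(2) x gr unfolding C2_on_def by simp
    qed
    ultimately show "(J f, J g) \<in> transmission_generator"
      using *(3) unfolding transmission_generator_def bc g0[symmetric]
      unfolding mem_Collect_eq case_prod_conv
      by (rule_tac exI[of _ "\<lambda>x. - l' x"], rule_tac exI[of _ r']) simp
  next
    assume "(J f, J g) \<in> transmission_generator"
    then obtain l r where l: "\<And>x. x \<in> {..0} \<Longrightarrow> (Rep_cinf (J f) has_real_derivative l x) (at x within {..0})"
      "\<And>x. x \<in> {..0} \<Longrightarrow> (l has_real_derivative Rep_cinf (J g) x) (at x within {..0})"
      and r: "\<And>x. x \<in> {0..} \<Longrightarrow> (Rep_cinf (J f) has_real_derivative r x) (at x within {0..})"
      "\<And>x. x \<in> {0..} \<Longrightarrow> (r has_real_derivative Rep_cinf (J g) x) (at x within {0..})"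
      and b0: "Rep_cinf (J g) 0 = \<alpha> * (- l 0) + \<beta> * r 0"
      unfolding transmission_generator_def bc by blast
    have L: "C2_on {..0} (left_part (Rep_cov f)) (\<lambda>x. - l x) (\<lambda>x. - Rep_cinf (J g) x)"
      unfolding C2_on_def
    proof (intro conjI ballI)
      fix x :: real assume x: "x \<in> {..0}"
      show "(left_part (Rep_cov f) has_real_derivative - l x) (at x within {..0})"
        by (rule has_real_derivative_within_cong[THEN iffD1, OF _ x _ DERIV_minus[OF l(1)[OF x]]])
          (auto simp: left_part_J)
      show "((\<lambda>x. - l x) has_real_derivative - Rep_cinf (J g) x) (at x within {..0})"
        by (rule DERIV_minus[OF l(2)[OF x]])
    qed (intro continuous_intros cinf_continuous)
    have R: "C2_on {0..} (right_part (Rep_cov f)) r (Rep_cinf (J g))"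
      unfolding C2_on_def
    proof (intro conjI ballI)
      fix x :: real assume x: "x \<in> {0..}"
      show "(right_part (Rep_cov f) has_real_derivative r x) (at x within {0..})"
        by (rule has_real_derivative_within_cong[THEN iffD1, OF _ x _ r(1)[OF x]])
          (auto simp: right_part_J)
    qed (intro cinf_continuous r(2); simp)+
    have "\<exists>c. ((\<lambda>x. - Rep_cinf (J g) x) \<longlongrightarrow> c) at_bot" using cinf_limits(1) tendsto_minus by blast
    moreover have "\<forall>x<0. Rep_cov g x = - Rep_cinf (J g) x" "\<forall>x>0. Rep_cov g x = Rep_cinf (J g) x"
      by (auto simp: Rep_J)
    ultimately show "(f, g) \<in> A_perp \<alpha> \<beta>"
      unfolding A_perp_def mem_Collect_eq case_prod_conv using L R b0 cinf_limits(2)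
      by (rule_tac exI[of _ "\<lambda>x. - l x"], rule_tac exI[of _ "\<lambda>x. - Rep_cinf (J g) x"],
          rule_tac exI[of _ r], rule_tac exI[of _ "Rep_cinf (J g)"]) auto
  qed
  then show ?thesis by auto
qed

lemma Cos_skew_eq:
  assumes "\<alpha> \<ge> 0" "\<beta> \<ge> 0" "\<alpha> + \<beta> > 0"
  shows "Cos_skew \<beta> \<alpha> t = transmission.cos_op (\<beta> / (\<alpha> + \<beta>)) 0 t"
    and "t \<ge> 0 \<Longrightarrow> exp_skew \<beta> \<alpha> t = weierstrass (transmission.cos_op (\<beta> / (\<alpha> + \<beta>)) 0) t"
proof -
  interpret transmission "\<beta> / (\<alpha> + \<beta>)" 0 using assms by unfold_locales auto
  show "Cos_skew \<beta> \<alpha> t = cos_op t"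
    by (simp add: Cos_skew_def A_skew_eq[OF assms] generated_cosine_transmission)
  show "t \<ge> 0 \<Longrightarrow> exp_skew \<beta> \<alpha> t = weierstrass cos_op t"
    by (simp add: exp_skew_def A_skew_eq[OF assms] generated_semigroup_transmission)
qed

text \<open>\<open>exp_perp\<close> is described by its generator on \<open>cov\<close>, so the
  Weierstrass formula is applied to the conjugated family in that space. Then \<open>inv J\<close>,
  being bounded and linear, is pulled out of the Gaussian mean.\<close>

lemma Cos_perp_eq:
  assumes "\<alpha> \<ge> 0" "\<beta> \<ge> 0" "\<alpha> + \<beta> > 0"
  shows "Cos_perp \<alpha> \<beta> t = conj_J (transmission.cos_op (\<beta> / (\<alpha> + \<beta>)) (1 / (\<alpha> + \<beta>)) t)"
    and "t \<ge> 0 \<Longrightarrow> exp_perp \<alpha> \<beta> t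
      = conj_J (weierstrass (transmission.cos_op (\<beta> / (\<alpha> + \<beta>)) (1 / (\<alpha> + \<beta>))) t)"
proof -
  interpret transmission "\<beta> / (\<alpha> + \<beta>)" "1 / (\<alpha> + \<beta>)" using assms by unfold_locales auto
  let ?C = "\<lambda>t. conj_J (cos_op t)"
  have fam: "cosine_family ?C" by (rule cosine_family_conj_J[OF cosine_family_cos_op])
  have norm: "norm (?C t) \<le> 3" for t using norm_conj_J norm_cos_op order_trans by blast
  have A: "A_perp \<alpha> \<beta> = cosine_generator ?C"
    by (simp add: A_perp_eq[OF assms] cosine_generator_conj_J cosine_generator_cos_op)
  show "Cos_perp \<alpha> \<beta> t = ?C t"
    by (simp add: Cos_perp_def A generated_cosine_eq[OF fam norm])
  interpret perp: separated_bounded_cosine ?C 3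
    by unfold_locales (auto intro: fam norm cov_separating)
  show "exp_perp \<alpha> \<beta> t = conj_J (weierstrass cos_op t)" if "t \<ge> 0"
  proof -
    have "weierstrass ?C t = conj_J (weierstrass cos_op t)"
      by (rule blinfun_eqI)
        (simp add: perp.weierstrass_apply conj_J_apply weierstrass_linear[OF bounded_linear_inv_J])
    then show ?thesis
      by (simp add: exp_perp_def A perp.generated_semigroup_weierstrass[OF that])
  qed
qed

text \<open>The Gaussian weight has total mass 1 for every \<open>t\<close>, so an error bound
  uniform in the time of the cosine families is inherited by the semigroups uniformly in
  \<open>t\<close>.\<close>

lemma norm_weierstrass_diff_le:
  assumes "bounded_cosine C M" "bounded_cosine C' M'" "\<And>s. norm (C s f - C' s f) \<le> e"
  shows "norm (weierstrass C t f - weierstrass C' t f) \<le> e"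
proof -
  interpret C: bounded_cosine C M by fact
  interpret C': bounded_cosine C' M' by fact
  have "weierstrass C t f - weierstrass C' t f
      = gauss_mean (\<lambda>z. C (sqrt (2 * t) * z) f - C' (sqrt (2 * t) * z) f)"
    unfolding C.weierstrass_apply C'.weierstrass_apply
    by (rule gauss_mean_diff[symmetric, OF C.integrable_C C'.integrable_C])
  also have "norm \<dots> \<le> e"
    by (rule gauss_mean_norm_le) (auto intro!: continuous_on_diff C.continuous_C_scaled C'.continuous_C_scaled assms(3))
  finally show ?thesis .
qed

text \<open>Comparison with the affine supersolution \<open>2 (w(x) + \<eta> + K (x - y + d))\<close> of
  \<open>d E' = 2 w - E\<close> on \<open>[0, x]\<close>.\<close>

lemma (in transmission) extends_even_close_upper:
  assumes e: "extends p d g a b" and K: "K \<ge> 0" and x: "x \<ge> 0"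
    and w: "\<And>y. 0 \<le> y \<Longrightarrow> y \<le> x \<Longrightarrow> weighted p g y \<le> weighted p g x + \<eta> + K * (x - y)"
  shows "a x + a (- x) \<le> 2 * weighted p g x + 2 * (\<eta> + K * d)"
proof -
  have a0: "a 0 = g 0" using e by (simp add: extends_def)
  define c where "c y = 2 * (weighted p g x + \<eta> + K * (x - y + d))" for y
  have "(a x + a (- x)) - c x \<le> 0"
  proof (rule relaxation_comparison[OF d x, where z = "\<lambda>y. (a y + a (- y)) - c y"
        and k = "\<lambda>y. (2 * weighted p g y - (a y + a (- y))) + 2 * K * d"])
    fix y :: real assume y: "0 \<le> y" "y \<le> x"
    have "((\<lambda>y. d * (a y + a (- y)) - d * c y) has_real_derivative
        (2 * weighted p g y - (a y + a (- y))) - d * (- 2 * K)) (at y)"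
      unfolding c_def
      by (intro DERIV_diff extends_even_ode[OF e y(1)] DERIV_cmult) (auto intro!: derivative_eq_intros)
    then show "((\<lambda>y. d * ((a y + a (- y)) - c y)) has_real_derivative
        (2 * weighted p g y - (a y + a (- y))) + 2 * K * d) (at y)"
      by (simp add: algebra_simps)
    show "(2 * weighted p g y - (a y + a (- y))) + 2 * K * d + ((a y + a (- y)) - c y) \<le> 0"
      using w[OF y] by (simp add: c_def algebra_simps)
  next
    have "0 \<le> K * d" using K d by simp
    then show "a 0 + a (- 0) - c 0 \<le> 0"
      using w[of 0] x by (simp add: c_def a0 weighted_0 algebra_simps)
  qed
  then show ?thesis by (simp add: c_def)
qed

text \<open>On their outer sides the extensions for two values of \<open>d\<close> differ exactly by
  their doubled even parts \<open>E\<close>, and d'Alembert's formula only averages extensions. So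
  it suffices to compare \<open>E\<close> with \<open>2 w\<close> on all of
  \<open>[0, \<infinity>)\<close>, and uniformity in \<open>t\<close> is automatic.\<close>

lemma cos_op_tendsto:
  assumes p: "0 \<le> p" "p \<le> 1" and e: "e > 0"
  shows "\<exists>d0>0. \<forall>d. 0 \<le> d \<longrightarrow> d \<le> d0 \<longrightarrow>
    (\<forall>t. norm (transmission.cos_op p d t g - transmission.cos_op p 0 t g) \<le> e)"
proof -
  interpret L: transmission p 0 using p by unfold_locales auto
  define M where "M = norm g"
  have M: "\<bar>Rep_cinf g x\<bar> \<le> M" for x by (simp add: M_def abs_Rep_cinf_le)
  obtain \<delta> where \<delta>: "\<delta> > 0" "\<And>x y. dist y x < \<delta> \<Longrightarrow> dist (Rep_cinf g y) (Rep_cinf g x) < e / 4"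
    using uniformly_continuous_C_infty[OF Rep_cinf[of g]] e unfolding uniformly_continuous_on_def
    by (metis UNIV_I zero_less_divide_iff zero_less_numeral)
  \<comment> \<open>Turns the modulus of continuity into the affine majorant that the supersolution
    needs: at distance at least \<open>\<delta>\<close> the trivial bound \<open>2 * M\<close> is at
    most \<open>K * (x - y)\<close>.\<close>
  define K where "K = 2 * M / \<delta>"
  have K0: "K \<ge> 0" using \<delta>(1) by (simp add: K_def M_def)
  have w: "\<bar>weighted p (Rep_cinf g) y - weighted p (Rep_cinf g) x\<bar> \<le> e / 4 + K * (x - y)" if "y \<le> x" for x y
  proof (cases "x - y < \<delta>")
    case True
    then have "\<bar>Rep_cinf g y - Rep_cinf g x\<bar> \<le> e / 4" "\<bar>Rep_cinf g (- y) - Rep_cinf g (- x)\<bar> \<le> e / 4"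
      using \<delta>(2)[of y x] \<delta>(2)[of "- y" "- x"] that by (auto simp: dist_real_def)
    from L.weighted_diff_le[OF this]
    have "\<bar>weighted p (Rep_cinf g) y - weighted p (Rep_cinf g) x\<bar> \<le> e / 4"
      by (simp add: weighted_def)
    moreover have "0 \<le> K * (x - y)" using K0 that by simp
    ultimately show ?thesis by linarith
  next
    case False
    then have "2 * M * 1 \<le> 2 * M * ((x - y) / \<delta>)"
      using \<delta>(1) by (intro mult_left_mono) (auto simp: M_def)
    then have "2 * M \<le> K * (x - y)" by (simp add: K_def)
    moreover have "\<bar>weighted p (Rep_cinf g) y\<bar> \<le> M" "\<bar>weighted p (Rep_cinf g) x\<bar> \<le> M"
      using L.weighted_bound[of "Rep_cinf g" M, OF M] by auto
    ultimately show ?thesis using e by linarith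
  qed
  \<comment> \<open>For \<open>d \<le> d0\<close> one gets \<open>K * d \<le> e / 4\<close>, so the
    supersolution exceeds \<open>2 w\<close> by at most \<open>2 * (e / 4 + e / 4) = e\<close>. The
    summand 1 guards against \<open>K = 0\<close>, which occurs for \<open>g = 0\<close>.\<close>
  define d0 where "d0 = e / (4 * (K + 1))"
  have d0: "d0 > 0" using e K0 by (simp add: d0_def)
  have close: "norm (transmission.cos_op p d t g - L.cos_op t g) \<le> e" if dd: "0 \<le> d" "d \<le> d0" for d t
  proof -
    interpret D: transmission p d using p dd by unfold_locales auto
    have "K * d \<le> (K + 1) * d0" using dd K0 by (intro mult_mono) auto
    moreover have "(K + 1) * d0 = e / 4" using K0 by (simp add: d0_def field_simps)
    ultimately have Kd: "2 * (e / 4 + K * d) \<le> e" by argo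
    have E: "\<bar>(D.right_ext g x + D.right_ext g (- x)) - (L.right_ext g x + L.right_ext g (- x))\<bar> \<le> e"
      if x: "x \<ge> 0" for x
    proof -
      have "D.right_ext g x + D.right_ext g (- x) \<le> 2 * weighted p (Rep_cinf g) x + 2 * (e / 4 + K * d)"
        using w by (intro D.extends_even_close_upper[OF D.extends_ext K0 x]) (fastforce simp: abs_le_iff)
      moreover have "- D.right_ext g x + - D.right_ext g (- x)
          \<le> 2 * weighted p (\<lambda>x. - Rep_cinf g x) x + 2 * (e / 4 + K * d)"
      proof (rule D.extends_even_close_upper[OF D.extends_uminus[OF D.extends_ext] K0 x])
        fix y assume "0 \<le> y" "y \<le> x"
        then show "weighted p (\<lambda>x. - Rep_cinf g x) y \<le> weighted p (\<lambda>x. - Rep_cinf g x) x + e / 4 + K * (x - y)"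
          using w[of y x] by (simp add: weighted_def abs_le_iff algebra_simps)
      qed
      moreover have "weighted p (\<lambda>x. - Rep_cinf g x) x = - weighted p (Rep_cinf g) x"
        by (simp add: weighted_def algebra_simps)
      moreover have "L.right_ext g x + L.right_ext g (- x) = 2 * weighted p (Rep_cinf g) x"
      proof -
        have "((\<lambda>x. 0) has_real_derivative 2 * weighted p (Rep_cinf g) x
            - (L.right_ext g x + L.right_ext g (- x))) (at x)"
          using extends_even_ode[OF L.extends_ext x, of g] by simp
        from DERIV_unique[OF this DERIV_const] show ?thesis by simp
      qed
      ultimately show ?thesis using Kd by (simp add: abs_le_iff)
    qed
    have r: "\<bar>D.right_ext g x - L.right_ext g x\<bar> \<le> e" for x
      using E[of "- x"] e by (cases "x \<ge> 0") (auto simp: D.right_ext_nonneg L.right_ext_nonneg)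
    have l: "\<bar>D.left_ext g x - L.left_ext g x\<bar> \<le> e" for x
    proof (cases "x \<le> 0")
      case True
      then show ?thesis using e by (simp add: D.left_ext_nonpos L.left_ext_nonpos)
    next
      case False
      then show ?thesis
        using E[of x] D.ext_even[of g x] L.ext_even[of g x]
        by (simp add: D.left_ext_nonpos L.left_ext_nonpos)
    qed
    show ?thesis
    proof (rule norm_cinf_le)
      fix x
      have avg: "\<bar>(u + v) / 2 - (u' + v') / 2\<bar> \<le> e" if "\<bar>u - u'\<bar> \<le> e" "\<bar>v - v'\<bar> \<le> e" for u v u' v' :: real
        using that by argo
      show "\<bar>Rep_cinf (D.cos_op t g - L.cos_op t g) x\<bar> \<le> e"
        using avg[OF r r] avg[OF l l]
        by (simp add: Rep_cinf_diff D.Rep_cos_op L.Rep_cos_op D.cos_fun_def L.cos_fun_def)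
    qed
  qed
  then show ?thesis using d0 by blast
qed

text \<open>In \<open>ereal\<close> the suprema exist without prior boundedness; nonemptiness of
  \<open>S\<close> keeps them from being \<open>- \<infinity>\<close>.\<close>

lemma SUP_ereal_tendsto_0:
  fixes F :: "nat \<Rightarrow> 'b \<Rightarrow> real"
  assumes S: "S \<noteq> {}" and nonneg: "\<And>n t. 0 \<le> F n t"
    and small: "\<And>e. e > 0 \<Longrightarrow> eventually (\<lambda>n. \<forall>t\<in>S. F n t \<le> e) sequentially"
  shows "(\<lambda>n. SUP t\<in>S. ereal (F n t)) \<longlonglongrightarrow> 0"
proof (rule order_tendstoI)
  fix a :: ereal assume a: "a < 0"
  obtain s where s: "s \<in> S" using S by blast
  have "a < (SUP t\<in>S. ereal (F n t))" for n
  proof -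
    have "0 \<le> ereal (F n s)" using nonneg by simp
    also have "\<dots> \<le> (SUP t\<in>S. ereal (F n t))" by (rule SUP_upper[OF s])
    finally show ?thesis using a by simp
  qed
  then show "eventually (\<lambda>n. a < (SUP t\<in>S. ereal (F n t))) sequentially" by simp
next
  fix a :: ereal assume "0 < a"
  then obtain e where e: "0 < ereal e" "ereal e < a" using ereal_dense2 by blast
  have "eventually (\<lambda>n. \<forall>t\<in>S. F n t \<le> e) sequentially" using small e(1) by simp
  then show "eventually (\<lambda>n. (SUP t\<in>S. ereal (F n t)) < a) sequentially"
  proof eventually_elim
    case (elim n)
    then have "(SUP t\<in>S. ereal (F n t)) \<le> ereal e" by (intro SUP_least) simp
    then show ?case using e(2) by simp
  qed
qed

lemma norm_inv_J_diff: "norm (inv J u - inv J v) = norm (u - v)"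
  using norm_inv_J[of "u - v"] by (simp add: linear_diff[OF linear_inv_J])

theorem theorem5p2:
  shows "(\<forall>\<alpha> \<beta> t. \<alpha> \<ge> 0 \<longrightarrow> \<beta> \<ge> 0 \<longrightarrow> \<alpha> + \<beta> > 0 \<longrightarrow> norm (Cos_perp \<alpha> \<beta> t) \<le> 5) \<and>
    (\<forall>\<alpha> \<beta>. \<alpha> \<ge> 0 \<longrightarrow> \<beta> \<ge> 0 \<longrightarrow> \<alpha> + \<beta> > 0 \<longrightarrow>
      (\<forall>f. (\<lambda>n::nat. SUP t. ereal (norm (Cos_perp (n * \<alpha>) (n * \<beta>) t f
              - inv J (Cos_skew \<beta> \<alpha> t (J f))))) \<longlonglongrightarrow> 0) \<and>
      (\<forall>f. (\<lambda>n::nat. SUP t\<in>{0..}. ereal (norm (exp_perp (n * \<alpha>) (n * \<beta>) t f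
              - inv J (exp_skew \<beta> \<alpha> t (J f))))) \<longlonglongrightarrow> 0))"
proof (intro conjI allI impI)
  fix \<alpha> \<beta> t :: real assume ab: "\<alpha> \<ge> 0" "\<beta> \<ge> 0" "\<alpha> + \<beta> > 0"
  interpret transmission "\<beta> / (\<alpha> + \<beta>)" "1 / (\<alpha> + \<beta>)" using ab by unfold_locales auto
  \<comment> \<open>The bound 3 on extensions survives averaging and conjugation by the isometry
    \<open>J\<close>, and leaves room below 5.\<close>
  have "norm (Cos_perp \<alpha> \<beta> t) \<le> 3"
    unfolding Cos_perp_eq(1)[OF ab] using norm_conj_J norm_cos_op order_trans by blast
  then show "norm (Cos_perp \<alpha> \<beta> t) \<le> 5" by simp
next
  fix \<alpha> \<beta> :: real and f :: cov assume ab: "\<alpha> \<ge> 0" "\<beta> \<ge> 0" "\<alpha> + \<beta> > 0"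
  define p where "p = \<beta> / (\<alpha> + \<beta>)"
  have p: "0 \<le> p" "p \<le> 1" using ab by (auto simp: p_def)
  define C where "C d = transmission.cos_op p d" for d
  have bc: "bounded_cosine (C d) 3" if "d \<ge> 0" for d
  proof -
    interpret transmission p d using p that by unfold_locales auto
    show ?thesis unfolding C_def by unfold_locales
  qed
  \<comment> \<open>The value of \<open>d\<close> belonging to the parameters
    \<open>n * \<alpha>\<close> and \<open>n * \<beta>\<close>. At \<open>n = 0\<close> both
    parameters vanish and the generation hypothesis fails, so the identities below are stated for
    \<open>n > 0\<close>, which is harmless in the limit.\<close>
  define \<epsilon> where "\<epsilon> n = 1 / (real n * (\<alpha> + \<beta>))" for n
  have nab: "real n * \<alpha> \<ge> 0" "real n * \<beta> \<ge> 0" "real n * \<alpha> + real n * \<beta> > 0"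
    "real n * \<beta> / (real n * \<alpha> + real n * \<beta>) = p" "1 / (real n * \<alpha> + real n * \<beta>) = \<epsilon> n" if "n > 0" for n
    using ab that by (auto simp: p_def \<epsilon>_def distrib_left[symmetric])
  have cosn: "norm (Cos_perp (real n * \<alpha>) (real n * \<beta>) t f - inv J (Cos_skew \<beta> \<alpha> t (J f)))
      = norm (C (\<epsilon> n) t (J f) - C 0 t (J f))" if "n > 0" for n :: nat and t
    using Cos_perp_eq(1)[OF nab(1-3)[OF that], of t] Cos_skew_eq(1)[OF ab, of t]
    by (simp only: nab[OF that] conj_J_apply norm_inv_J_diff C_def p_def[symmetric])
  have expn: "norm (exp_perp (real n * \<alpha>) (real n * \<beta>) t f - inv J (exp_skew \<beta> \<alpha> t (J f)))
      = norm (weierstrass (C (\<epsilon> n)) t (J f) - weierstrass (C 0) t (J f))" if "n > 0" "t \<ge> 0" for n :: nat and t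
    using Cos_perp_eq(2)[OF nab(1-3)[OF that(1)] that(2)] Cos_skew_eq(2)[OF ab that(2)]
    by (simp only: nab[OF that(1)] conj_J_apply norm_inv_J_diff C_def p_def[symmetric])
  have ev: "eventually (\<lambda>n. n > 0 \<and> (\<forall>t. norm (C (\<epsilon> n) t (J f) - C 0 t (J f)) \<le> e)) sequentially"
    if e: "e > 0" for e
  proof -
    obtain d0 where d0: "d0 > 0" "\<And>d t. 0 \<le> d \<Longrightarrow> d \<le> d0 \<Longrightarrow> norm (C d t (J f) - C 0 t (J f)) \<le> e"
      using cos_op_tendsto[OF p e, of "J f"] unfolding C_def by blast
    have "\<epsilon> = (\<lambda>n. (1 / (\<alpha> + \<beta>)) * (1 / real n))" by (auto simp: \<epsilon>_def)
    then have "\<epsilon> \<longlonglongrightarrow> 0" using tendsto_mult_right_zero[OF lim_1_over_n, of "1 / (\<alpha> + \<beta>)"] by simp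
    then have "eventually (\<lambda>n. \<epsilon> n < d0) sequentially" using d0(1) by (rule order_tendstoD(2))
    then show ?thesis
      using eventually_gt_at_top[of "0::nat"]
    proof eventually_elim
      case (elim n)
      have "0 \<le> \<epsilon> n" using ab by (simp add: \<epsilon>_def)
      then show ?case using d0(2)[of "\<epsilon> n"] elim by simp
    qed
  qed
  show "(\<lambda>n::nat. SUP t. ereal (norm (Cos_perp (n * \<alpha>) (n * \<beta>) t f
              - inv J (Cos_skew \<beta> \<alpha> t (J f))))) \<longlonglongrightarrow> 0"
  proof (rule SUP_ereal_tendsto_0)
    fix e :: real assume "e > 0"
    from ev[OF this] show "eventually (\<lambda>n::nat. \<forall>t\<in>UNIV. norm (Cos_perp (n * \<alpha>) (n * \<beta>) t f
        - inv J (Cos_skew \<beta> \<alpha> t (J f))) \<le> e) sequentially"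
      by eventually_elim (simp add: cosn)
  qed auto
  show "(\<lambda>n::nat. SUP t\<in>{0..}. ereal (norm (exp_perp (n * \<alpha>) (n * \<beta>) t f
              - inv J (exp_skew \<beta> \<alpha> t (J f))))) \<longlonglongrightarrow> 0"
  proof (rule SUP_ereal_tendsto_0)
    fix e :: real assume "e > 0"
    from ev[OF this] show "eventually (\<lambda>n::nat. \<forall>t\<in>{0..}. norm (exp_perp (n * \<alpha>) (n * \<beta>) t f
        - inv J (exp_skew \<beta> \<alpha> t (J f))) \<le> e) sequentially"
    proof eventually_elim
      case (elim n)
      have "\<epsilon> n \<ge> 0" using ab by (simp add: \<epsilon>_def)
      then show ?case
        using elim norm_weierstrass_diff_le[OF bc bc, of "\<epsilon> n" 0 "J f" e] by (simp add: expn)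
    qed
  qed auto
qed

end
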